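(* Let $\mathbb{F}$ be a locally compact non-Archimedean field, let $M\ge 2$, let $T_1,\dots,T_M$ be non-singular contractive linear transformations of $\mathbb{F}^n$ (i.e. $\|T_i\|<1$), and for $\mathbf{b}=(b_1,\dots,b_M)\in\mathbb{F}^{nM}$ (with $b_i\in\mathbb{F}^n$) let $K(\mathbf{b})$ be the self-affine set of the system $S_i(x)=T_ix+b_i$, $1\le i\le M$. Then: (i) $\dim_H K(\mathbf{b})\le \overline{\dim}_B K(\mathbf{b})\le d(T_1,\dots,T_M)$ for all $\mathbf{b}\in\mathbb{F}^{nM}$; (ii) $\dim_H K(\mathbf{b})=\dim_B K(\mathbf{b})=\min\{n,d(T_1,\dots,T_M)\}$ for $\mu^{nM}$-almost every $\mathbf{b}\in\mathbb{F}^{nM}$.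
   Context: $\mathbb{F}$ is a field with a non-Archimedean absolute value $\|\cdot\|$ ($\|x\|=0$ iff $x=0$, $\|xy\|=\|x\|\|y\|$, $\|x+y\|\le\max\{\|x\|,\|y\|\}$), locally compact for the metric $\|x-y\|$. Let $O=\{a:\|a\|\le1\}$, $P=\{a:\|a\|<1\}$, $q=\#(O/P)$ (finite), $P=\pi O$, with normalization $\|\pi\|=1/q$. $\mu$ is the Haar measure on $(\mathbb{F},+)$ with $\mu(O)=1$, and $\mu^k$ the product measure on $\mathbb{F}^k$. On $\mathbb{F}^k$ use the norm $\|x\|=\max_i\|x_i\|$ and its metric; Hausdorff and box dimensions are with respect to this metric. For a linear map $T$ of $\mathbb{F}^n$ (identified with its matrix in the standard basis), $\|T\|=\sup_{x\ne0}\|Tx\|/\|x\|$. Let $I_n=\{T:\|T\|=1=\|\det T\|\}$. Every non-singular $T$ factors as $T=PDQ$ with $P,Q\in I_n$ and $D=\mathrm{diag}(\sigma_1,\dots,\sigma_n)$, $\|\sigma_1\|\ge\dots\ge\|\sigma_n\|>0$, and the numbers $\alpha_i=\|\sigma_i\|$ (the singular values of $T$) are uniquely determined by $T$. The singular value function is $\phi^s(T)=\alpha_1\cdots\alpha_{m-1}\alpha_m^{s-m+1}$ for $0\le s\le n$, where $m=\lceil s\rceil$, and $\phi^s(T)=(\alpha_1\cdots\alpha_n)^{s/n}$ for $s>n$. For a word $w=(i_1,\dots,i_r)\in\{1,\dots,M\}^r$ write $T_w=T_{i_1}\cdots T_{i_r}$, and $J_r=\{1,\dots,M\}^r$. $d(T_1,\dots,T_M)$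 is the unique $s\ge0$ with $\lim_{r\to\infty}\frac1r\log\sum_{w\in J_r}\phi^s(T_w)=0$. $K(\mathbf{b})$ is the unique non-empty compact set with $K(\mathbf{b})=\bigcup_{i=1}^M S_i(K(\mathbf{b}))$. *)

theory Defs
  imports "HOL-Analysis.Analysis" "HOL-Probability.Probability"
begin

definition nonarch_lc_field :: "('a::{field,metric_space} \<Rightarrow> real) \<Rightarrow> bool" where
  "nonarch_lc_field av \<longleftrightarrow>
     (\<forall>x. 0 \<le> av x) \<and> (\<forall>x. av x = 0 \<longleftrightarrow> x = 0) \<and>
     (\<forall>x y. av (x * y) = av x * av y) \<and>
     (\<forall>x y. av (x + y) \<le> max (av x) (av y)) \<and>
     (\<forall>x y. dist x y = av (x - y)) \<and>
     (\<forall>x::'a. \<exists>r>0. compact (cball x r))"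

definition valring :: "('a::field \<Rightarrow> real) \<Rightarrow> 'a set" where
  "valring av = {a. av a \<le> 1}"

definition valideal :: "('a::field \<Rightarrow> real) \<Rightarrow> 'a set" where
  "valideal av = {a. av a < 1}"

text \<open>The residue field O/P, represented as the set of cosets x + P, x in O.\<close>
definition residue_classes :: "('a::field \<Rightarrow> real) \<Rightarrow> 'a set set" where
  "residue_classes av = (\<lambda>x. {y \<in> valring av. av (x - y) < 1}) ` valring av"

definition normalised_av :: "('a::field \<Rightarrow> real) \<Rightarrow> bool" where
  "normalised_av av \<longleftrightarrow> finite (residue_classes av) \<and>
     (\<exists>\<pi>. valideal av = (\<lambda>a. \<pi> * a) ` valring av \<and>
          av \<pi> = 1 / real (card (residue_classes av)))"

definition haar_measure :: "('a::{field,metric_space} \<Rightarrow> real) \<Rightarrow> 'a measure \<Rightarrow> bool" where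
  "haar_measure av \<mu> \<longleftrightarrow> sets \<mu> = sets borel \<and> space \<mu> = UNIV \<and>
     (\<forall>a A. A \<in> sets borel \<longrightarrow> emeasure \<mu> ((\<lambda>x. a + x) ` A) = emeasure \<mu> A) \<and>
     emeasure \<mu> (valring av) = 1"

definition vnorm :: "('a \<Rightarrow> real) \<Rightarrow> 'a^'n \<Rightarrow> real" where
  "vnorm av x = Max (range (\<lambda>i. av (x $ i)))"

definition vdist :: "('a::ab_group_add \<Rightarrow> real) \<Rightarrow> 'a^'n \<Rightarrow> 'a^'n \<Rightarrow> real" where
  "vdist av x y = vnorm av (x - y)"

definition opnorm :: "('a::field \<Rightarrow> real) \<Rightarrow> 'a^'n^'n \<Rightarrow> real" where
  "opnorm av T = (SUP x\<in>{x. x \<noteq> 0}. vnorm av (T *v x) / vnorm av x)"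

definition In_group :: "('a::field \<Rightarrow> real) \<Rightarrow> ('a^'n^'n) set" where
  "In_group av = {T. opnorm av T = 1 \<and> av (det T) = 1}"

definition is_diag :: "'a::zero^'n^'n \<Rightarrow> bool" where
  "is_diag D \<longleftrightarrow> (\<forall>i j. i \<noteq> j \<longrightarrow> D $ i $ j = 0)"

text \<open>Decreasingly sorted list (alpha_1, ..., alpha_n) of the absolute values of the
  diagonal entries of D, for any factorisation T = P D Q with P, Q in I_n.\<close>
definition singular_values :: "('a::field \<Rightarrow> real) \<Rightarrow> 'a^'n^'n \<Rightarrow> real list" where
  "singular_values av T = (SOME xs. \<exists>P D Q. P \<in> In_group av \<and> Q \<in> In_group av \<and>
      is_diag D \<and> T = P ** D ** Q \<and>
      xs = rev (sorted_list_of_multiset (image_mset (\<lambda>i. av (D $ i $ i)) (mset_set UNIV))))"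

text \<open>phi^s(T); alpha_i is (singular_values av T) ! (i - 1). Convention phi^0 = 1.\<close>
definition sv_fun :: "('a::field \<Rightarrow> real) \<Rightarrow> real \<Rightarrow> 'a^'n^'n \<Rightarrow> real" where
  "sv_fun av s T =
     (let \<alpha> = singular_values av T; n = CARD('n); m = nat \<lceil>s\<rceil> in
      if s = 0 then 1
      else if s \<le> real n then (\<Prod>i<m - 1. \<alpha> ! i) * (\<alpha> ! (m - 1)) powr (s - real m + 1)
      else (\<Prod>i<n. \<alpha> ! i) powr (s / real n))"

definition words :: "nat \<Rightarrow> nat \<Rightarrow> nat list set" where
  "words M r = {w. length w = r \<and> set w \<subseteq> {..<M}}"

definition word_map :: "(nat \<Rightarrow> 'a::semiring_1^'n^'n) \<Rightarrow> nat list \<Rightarrow> 'a^'n^'n" where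
  "word_map T w = foldr (\<lambda>i A. T i ** A) w (mat 1)"

definition affinity_dim :: "('a::field \<Rightarrow> real) \<Rightarrow> (nat \<Rightarrow> 'a^'n^'n) \<Rightarrow> nat \<Rightarrow> real" where
  "affinity_dim av T M = (THE s. 0 \<le> s \<and>
     ((\<lambda>r. ln (\<Sum>w\<in>words M r. sv_fun av s (word_map T w)) / real r) \<longlonglongrightarrow> 0))"

definition self_affine_set :: "(nat \<Rightarrow> 'a::{field,metric_space}^'n^'n) \<Rightarrow> nat \<Rightarrow> (nat \<Rightarrow> 'a^'n) \<Rightarrow> ('a^'n) set" where
  "self_affine_set T M b = (THE K. K \<noteq> {} \<and> compact K \<and>
     K = (\<Union>i<M. (\<lambda>x. T i *v x + b i) ` K))"

definition gdiam :: "('x \<Rightarrow> 'x \<Rightarrow> real) \<Rightarrow> 'x set \<Rightarrow> real" where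
  "gdiam d U = (if U = {} then 0 else (SUP p\<in>U \<times> U. d (fst p) (snd p)))"

definition hausdorff_pre :: "('x \<Rightarrow> 'x \<Rightarrow> real) \<Rightarrow> real \<Rightarrow> real \<Rightarrow> 'x set \<Rightarrow> ennreal" where
  "hausdorff_pre d s \<delta> E = (INF U\<in>{U :: nat \<Rightarrow> 'x set.
        (\<forall>i. \<forall>x\<in>U i. \<forall>y\<in>U i. d x y \<le> \<delta>) \<and> E \<subseteq> (\<Union>i. U i)}.
        (\<Sum>i. ennreal (gdiam d (U i) powr s)))"

definition hausdorff_measure :: "('x \<Rightarrow> 'x \<Rightarrow> real) \<Rightarrow> real \<Rightarrow> 'x set \<Rightarrow> ennreal" where
  "hausdorff_measure d s E = (SUP \<delta>\<in>{0<..}. hausdorff_pre d s \<delta> E)"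

definition hausdorff_dim :: "('x \<Rightarrow> 'x \<Rightarrow> real) \<Rightarrow> 'x set \<Rightarrow> real" where
  "hausdorff_dim d E = Inf {s. 0 < s \<and> hausdorff_measure d s E = 0}"

definition cover_number :: "('x \<Rightarrow> 'x \<Rightarrow> real) \<Rightarrow> real \<Rightarrow> 'x set \<Rightarrow> nat" where
  "cover_number d \<delta> E = (LEAST k. \<exists>U :: nat \<Rightarrow> 'x set.
       (\<forall>i<k. \<forall>x\<in>U i. \<forall>y\<in>U i. d x y \<le> \<delta>) \<and> E \<subseteq> (\<Union>i<k. U i))"

definition upper_box_dim :: "('x \<Rightarrow> 'x \<Rightarrow> real) \<Rightarrow> 'x set \<Rightarrow> ereal" where
  "upper_box_dim d E = Limsup (at_right 0)
      (\<lambda>\<delta>. ereal (ln (real (cover_number d \<delta> E)) / - ln \<delta>))"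

definition lower_box_dim :: "('x \<Rightarrow> 'x \<Rightarrow> real) \<Rightarrow> 'x set \<Rightarrow> ereal" where
  "lower_box_dim d E = Liminf (at_right 0)
      (\<lambda>\<delta>. ereal (ln (real (cover_number d \<delta> E)) / - ln \<delta>))"

end

theory Submission
  imports Defs
begin

text \<open>
  Over the valuation ring every matrix has a Smith form, so the singular values of \<open>T\<close> count the balls
  needed to cover the image of a ball under \<open>T\<close>, and \<open>\<phi>\<^sup>s(T)\<close> is the minimum over \<open>\<rho>\<close> of \<open>\<rho>\<^sup>s\<close> times
  such a covering number. This gives submultiplicativity, hence the pressure function and its zero \<open>d\<close>.
  If \<open>s > d\<close>, some level \<open>r\<close> has \<open>\<Sum>w. \<phi>\<^sup>s(T\<^sub>w) \<le> 1\<close>; covering the attractor by the images of its own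
  covers under the words of length \<open>r\<close> bounds its covering numbers by \<open>C \<delta>\<^sup>-\<^sup>s\<close> inductively.

  If \<open>t < min n d\<close>, max-flow min-cut on the tree of words yields a mass distribution \<open>\<nu>\<close> with
  \<open>\<nu> \<le> \<phi>\<^sup>t\<close>. For two words that first differ after \<open>p\<close>, the difference of the corresponding points is
  \<open>T\<^sub>p (U b\<^sub>i + c)\<close>, where \<open>U\<close> is the identity plus a contraction and hence an isometry, by the
  ultrametric inequality. So it is at most \<open>\<rho>\<close> with probability at most \<open>C \<rho>\<^sup>t / \<phi>\<^sup>t(T\<^sub>p)\<close>, the expected energy
  is finite, and Cauchy-Schwarz bounds the Hausdorff measure of almost every attractor from below.
\<close>

text \<open>The mass distribution is a function on finite words. At radius \<open>rad k\<close>
  points of the attractor are replaced by \<open>S b w 0\<close> for words of a length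
  \<open>len k\<close> at which the error is at most \<open>rad k\<close>; an ultrametric ball of
  that radius does not see the error, so by compactness a cover is tested on finitely many points.
  The flow is built for an exponent \<open>t'\<close> slightly above \<open>t\<close>. The
  probability bound for a pair of words involves their common prefix; summing over all possible
  prefix lengths costs a factor \<open>len k + 1\<close>, linear in \<open>k\<close>, while the gap
  between the exponents gains a geometric factor. So the expected energy converges. Radii are taken
  from the discrete value group, the integer powers of \<open>q\<close>, where nets have exactly the
  expected cardinality and balls the expected measure; any other radius is rounded at the cost of a
  factor \<open>q\<close>, which dimensions do not see. Contraction ratios below 1 suffice because
  the perturbations coming from two words do not add up: their difference is bounded by the larger
  one. Over the reals norms add up, and the same argument asks for a smaller bound.\<close>

lemma matrix_mult_distribs:
  fixes A B C :: "'a::comm_ring_1^'n^'n"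
  shows "(A + B) ** C = A ** C + B ** C" "(A - B) ** C = A ** C - B ** C"
    "A ** (B - C) = A ** B - A ** C"
  by (simp_all add: vec_eq_iff matrix_matrix_mult_def sum.distrib[symmetric] sum_subtractf[symmetric] algebra_simps)

section \<open>The absolute value and its value group\<close>

locale nonarch =
  fixes av :: "'a::{field,metric_space} \<Rightarrow> real"
  assumes lc_field: "nonarch_lc_field av"
    and normalised: "normalised_av av"
begin

lemma av_nonneg [simp]: "0 \<le> av x"
  and av_eq_0_iff [simp]: "av x = 0 \<longleftrightarrow> x = 0"
  and av_mult: "av (x * y) = av x * av y"
  and av_ultra: "av (x + y) \<le> max (av x) (av y)"
  and dist_av: "dist x y = av (x - y)"
  using lc_field unfolding nonarch_lc_field_def by auto

lemma av_0 [simp]: "av 0 = 0"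
  by simp

lemma av_pos_iff [simp]: "0 < av x \<longleftrightarrow> x \<noteq> 0"
  using av_nonneg[of x] av_eq_0_iff[of x] by linarith

lemma av_1 [simp]: "av 1 = 1"
  using av_mult[of 1 1] av_eq_0_iff[of 1] by (metis mult.right_neutral mult_cancel_left one_neq_zero)

lemma av_minus [simp]: "av (- x) = av x"
proof -
  have "(av (-1))\<^sup>2 = 1"
    using av_mult[of "-1" "-1"] by (simp add: power2_eq_square)
  then have "av (-1) = 1"
    using av_nonneg[of "-1"] by (simp add: power2_eq_1_iff)
  then show ?thesis
    using av_mult[of "-1" x] by simp
qed

lemma av_minus_commute: "av (x - y) = av (y - x)"
  using av_minus[of "x - y"] by simp

lemma av_diff: "av (x - y) \<le> max (av x) (av y)"
  using av_ultra[of x "- y"] by simp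

lemma av_inverse: "av (inverse x) = inverse (av x)"
proof (cases "x = 0")
  case False
  then have "av x * av (inverse x) = 1"
    using av_mult[of x "inverse x"] by simp
  then show ?thesis
    by (simp add: inverse_unique)
qed simp

lemma av_divide: "av (x / y) = av x / av y"
  by (simp add: divide_inverse av_mult av_inverse)

lemma av_power: "av (x ^ k) = av x ^ k"
  by (induction k) (auto simp: av_mult)

lemma av_power_int: "av (x powi k) = av x powi k"
  by (auto simp: power_int_def av_power av_inverse)

lemma av_sum_le:
  assumes "\<And>i. i \<in> A \<Longrightarrow> av (f i) \<le> c" "0 \<le> c"
  shows "av (sum f A) \<le> c"
  using assms
proof (induction A rule: infinite_finite_induct)
  case (insert i A)
  then show ?case
    using av_ultra[of "f i" "sum f A"] by (auto simp: max_def split: if_splits intro: order_trans)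
qed auto

lemma av_prod: "av (prod f A) = (\<Prod>i\<in>A. av (f i))"
  by (induction A rule: infinite_finite_induct) (auto simp: av_mult)

definition q :: real where
  "q = real (card (residue_classes av))"

lemma uniformiser:
  obtains p where "valideal av = (\<lambda>a. p * a) ` valring av" "av p = 1 / q"
  using normalised unfolding normalised_av_def q_def by auto

lemma finite_residue_classes: "finite (residue_classes av)"
  using normalised unfolding normalised_av_def by auto

lemma q_ge_2: "q \<ge> 2"
proof -
  let ?f = "\<lambda>x. {y \<in> valring av. av (x - y) < 1}"
  have "0 \<in> ?f 0" "0 \<notin> ?f 1"
    by (auto simp: valring_def)
  then have "?f 0 \<noteq> ?f 1" by blast
  then have "card {?f 0, ?f 1} = 2"
    by simp
  moreover have "{?f 0, ?f 1} \<subseteq> residue_classes av"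
    unfolding residue_classes_def using imageI[of 0 "valring av" ?f] imageI[of 1 "valring av" ?f]
    by (simp add: valring_def)
  ultimately have "2 \<le> card (residue_classes av)"
    using card_mono[OF finite_residue_classes, of "{?f 0, ?f 1}"] by simp
  then show ?thesis unfolding q_def by simp
qed

lemma q_pos [simp]: "q > 0" and q_gt_1 [simp]: "q > 1" and q_nz [simp]: "q \<noteq> 0" and q_neq_1 [simp]: "q \<noteq> 1"
  using q_ge_2 by auto

text \<open>The value group: \<open>av_in_vgrp\<close> and \<open>vgrp_av\<close> identify it with
  the absolute values of the nonzero elements.\<close>

definition vgrp :: "real set" where
  "vgrp = range (\<lambda>k::int. q powi k)"

lemma vgrpI [intro, simp]: "q powi k \<in> vgrp"
  unfolding vgrp_def by auto

lemma vgrp_pos: "a \<in> vgrp \<Longrightarrow> a > 0"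
  unfolding vgrp_def by (auto intro: zero_less_power_int)

lemma vgrp_1 [simp]: "1 \<in> vgrp"
  using vgrpI[of 0] by simp

lemma vgrp_mult: "a \<in> vgrp \<Longrightarrow> b \<in> vgrp \<Longrightarrow> a * b \<in> vgrp"
  unfolding vgrp_def by (auto simp: power_int_add[symmetric])

lemma vgrp_divide: "a \<in> vgrp \<Longrightarrow> b \<in> vgrp \<Longrightarrow> a / b \<in> vgrp"
  unfolding vgrp_def by (auto simp: power_int_diff[symmetric])

lemma vgrp_av: assumes "a \<in> vgrp" obtains x where "x \<noteq> 0" "av x = a"
proof -
  obtain p where p: "valideal av = (\<lambda>a. p * a) ` valring av" "av p = 1 / q"
    using uniformiser .
  obtain k where k: "a = q powi k"
    using assms unfolding vgrp_def by auto
  have "av (p powi (-k)) = a"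
    unfolding av_power_int p(2) k by (simp add: power_int_minus power_int_divide_distrib)
  moreover have "p powi (-k) \<noteq> 0"
    using p(2) by auto
  ultimately show ?thesis using that by blast
qed

text \<open>Rounds an arbitrary radius down to an admissible one, losing less than a factor
  \<open>q\<close>.\<close>

lemma vgrp_below: assumes "x > 0" obtains a where "a \<in> vgrp" "a \<le> x" "x < q * a"
proof -
  define k where "k = \<lfloor>log q x\<rfloor>"
  have "q powr of_int k \<le> q powr (log q x)" "q powr (log q x) < q powr of_int (k + 1)"
    unfolding k_def by (simp_all del: of_int_add) linarith
  moreover have "q powr log q x = x" using assms by (intro powr_log_cancel) auto
  moreover have "q powr of_int j = q powi j" for j :: int
    using q_pos powr_real_of_int'[of q j] by (metis less_imp_le q_nz)
  moreover have "q powi (k + 1) = q * q powi k"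
    by (simp add: power_int_add)
  ultimately have "q powi k \<le> x" "x < q * q powi k"
    by metis+
  then show ?thesis using that by blast
qed

text \<open>With \<open>a\<close> the power of \<open>q\<close> just below \<open>av x\<close>,
  dividing \<open>x\<close> by an element of absolute value \<open>a * q\<close> lands in the ideal
  \<open>P\<close>, whose elements have absolute value at most \<open>1 / q\<close>; hence
  \<open>av x \<le> a\<close>.\<close>

lemma av_in_vgrp:
  assumes "x \<noteq> 0" shows "av x \<in> vgrp"
proof -
  obtain p where p: "valideal av = (\<lambda>a. p * a) ` valring av" "av p = 1 / q"
    using uniformiser .
  obtain a where a: "a \<in> vgrp" "a \<le> av x" "av x < q * a"
    using vgrp_below[of "av x"] assms by auto
  have "a * q \<in> vgrp" using vgrp_mult[OF a(1), of q] vgrpI[of 1] by simp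
  then obtain y where y: "y \<noteq> 0" "av y = a * q"
    using vgrp_av by metis
  have "av (x / y) < 1"
    using a y vgrp_pos[OF a(1)] by (simp add: av_divide field_simps)
  then obtain z where "x / y = p * z" "av z \<le> 1"
    using p unfolding valideal_def valring_def by auto
  then have "av x = (av z / q) * (a * q)"
    using y p by (metis av_mult nonzero_eq_divide_eq times_divide_eq_left mult.commute mult_1)
  then have "av x = av z * a" by simp
  then have "av x \<le> a"
    using \<open>av z \<le> 1\<close> vgrp_pos[OF a(1)] by (simp add: mult_left_le_one_le)
  then show ?thesis using a by simp
qed

text \<open>Nothing lies between neighbouring powers of \<open>q\<close>, so a strict inequality
  gains a factor \<open>q\<close>.\<close>

lemma vgrp_gap: "a \<in> vgrp \<Longrightarrow> b \<in> vgrp \<Longrightarrow> a < b \<Longrightarrow> q * a \<le> b"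
proof -
  assume *: "a \<in> vgrp" "b \<in> vgrp" "a < b"
  then obtain i j where ij: "a = q powi i" "b = q powi j" unfolding vgrp_def by auto
  then have "i < j"
    using * by (metis linorder_not_less power_int_increasing q_gt_1 less_imp_le)
  then have "q powi (1 + i) \<le> q powi j"
    by (intro power_int_increasing) (use q_gt_1 in linarith)+
  then show ?thesis using ij by (simp add: power_int_add)
qed

subsection \<open>Vectors and matrices\<close>

lemma vnorm_le_iff: "vnorm av (x :: 'a^'n) \<le> c \<longleftrightarrow> (\<forall>i. av (x $ i) \<le> c)"
  unfolding vnorm_def by (subst Max_le_iff) auto

lemma av_le_vnorm: "av ((x :: 'a^'n) $ i) \<le> vnorm av x"
  using vnorm_le_iff[of x "vnorm av x"] by blast

lemma vnorm_attained: obtains i where "vnorm av (x :: 'a^'n) = av (x $ i)"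
proof -
  have "vnorm av x \<in> range (\<lambda>i. av (x $ i))"
    unfolding vnorm_def by (rule Max_in) auto
  then show ?thesis using that by blast
qed

lemma vnorm_nonneg [simp]: "0 \<le> vnorm av (x :: 'a^'n)"
  using av_le_vnorm av_nonneg order_trans by blast

lemma vnorm_eq_0_iff [simp]: "vnorm av (x :: 'a^'n) = 0 \<longleftrightarrow> x = 0"
proof -
  have "vnorm av x = 0 \<longleftrightarrow> vnorm av x \<le> 0"
    using vnorm_nonneg[of x] by linarith
  also have "\<dots> \<longleftrightarrow> x = 0"
    unfolding vnorm_le_iff using av_nonneg av_eq_0_iff by (metis antisym order_refl vec_eq_iff zero_index)
  finally show ?thesis .
qed

lemma vnorm_0 [simp]: "vnorm av (0 :: 'a^'n) = 0"
  by simp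

lemma vnorm_pos_iff [simp]: "0 < vnorm av (x :: 'a^'n) \<longleftrightarrow> x \<noteq> 0"
  using vnorm_nonneg[of x] vnorm_eq_0_iff[of x] by linarith

lemma vnorm_in_vgrp: "(x :: 'a^'n) \<noteq> 0 \<Longrightarrow> vnorm av x \<in> vgrp"
  by (metis av_in_vgrp av_0 vnorm_attained vnorm_eq_0_iff)

lemma vnorm_minus [simp]: "vnorm av (- x :: 'a^'n) = vnorm av x"
  unfolding vnorm_def by simp

lemma vnorm_minus_commute: "vnorm av (x - y :: 'a^'n) = vnorm av (y - x)"
  using vnorm_minus[of "x - y"] by simp

lemma vnorm_ultra: "vnorm av (x + y :: 'a^'n) \<le> max (vnorm av x) (vnorm av y)"
  unfolding vnorm_le_iff
proof
  fix i show "av ((x + y) $ i) \<le> max (vnorm av x) (vnorm av y)"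
    using av_ultra[of "x $ i" "y $ i"] av_le_vnorm[of x i] av_le_vnorm[of y i] by auto
qed

lemma vnorm_diff: "vnorm av (x - y :: 'a^'n) \<le> max (vnorm av x) (vnorm av y)"
  using vnorm_ultra[of x "- y"] by simp

lemma vnorm_add_le: "vnorm av (x :: 'a^'n) \<le> c \<Longrightarrow> vnorm av y \<le> c \<Longrightarrow> vnorm av (x + y) \<le> c"
  using vnorm_ultra[of x y] by auto

lemma vnorm_diff_le: "vnorm av (x :: 'a^'n) \<le> c \<Longrightarrow> vnorm av y \<le> c \<Longrightarrow> vnorm av (x - y) \<le> c"
  using vnorm_diff[of x y] by auto

lemma vnorm_diff_trans:
  "vnorm av (x - y :: 'a^'n) \<le> c \<Longrightarrow> vnorm av (y - z) \<le> c \<Longrightarrow> vnorm av (x - z) \<le> c"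
  using vnorm_add_le[of "x - y" c "y - z"] by simp

text \<open>The isosceles triangle principle: \<open>x\<close> is recovered as
  \<open>(x + y) - y\<close>, so the shorter vector cannot change the norm.\<close>

lemma vnorm_add_eq: "vnorm av (y :: 'a^'n) < vnorm av x \<Longrightarrow> vnorm av (x + y) = vnorm av x"
  using vnorm_ultra[of x y] vnorm_diff[of "x + y" y] by (auto simp: max_def split: if_splits)

lemma vnorm_axis [simp]: "vnorm av (axis i c :: 'a^'n) = av c"
  by (rule antisym) (use av_le_vnorm[of "axis i c" i] in \<open>auto simp: vnorm_le_iff axis_def\<close>)

lemma vnorm_matrix_le:
  fixes A :: "'a^'n^'n"
  assumes "\<And>i j. av (A $ i $ j) \<le> c"
  shows "vnorm av (A *v x) \<le> c * vnorm av x"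
  unfolding vnorm_le_iff
proof
  fix i
  have c: "0 \<le> c" using assms av_nonneg order_trans by blast
  show "av ((A *v x) $ i) \<le> c * vnorm av x"
    unfolding matrix_vector_mult_def vec_lambda_beta
    by (rule av_sum_le) (auto simp: av_mult c intro!: mult_mono assms av_le_vnorm)
qed

lemma matrix_vector_mult_axis: "((A :: 'a^'n^'n) *v axis j 1) $ i = A $ i $ j"
  by (simp add: matrix_vector_mult_def axis_def if_distrib cong: if_cong)

lemma entries_bounded: obtains c where "\<And>i j. av ((A :: 'a^'n^'n) $ i $ j) \<le> c"
proof -
  have "av (A $ i $ j) \<le> Max (range (\<lambda>(i, j). av (A $ i $ j)))" for i j
    by (rule Max_ge) auto
  then show ?thesis using that by blast
qed

lemma opnorm_bound: "vnorm av ((A :: 'a^'n^'n) *v x) \<le> opnorm av A * vnorm av x"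
proof (cases "x = 0")
  case False
  obtain c where c: "\<And>i j. av (A $ i $ j) \<le> c"
    using entries_bounded by blast
  have "vnorm av (A *v x) / vnorm av x \<le> opnorm av A"
    unfolding opnorm_def
  proof (rule cSUP_upper)
    \<comment> \<open>A real \<open>SUP\<close> says nothing without an upper bound; any bound on
      the entries provides one.\<close>
    show "bdd_above ((\<lambda>x. vnorm av (A *v x) / vnorm av x) ` {x. x \<noteq> 0})"
      by (rule bdd_aboveI2[where M = c]) (auto simp: divide_le_eq intro: vnorm_matrix_le c)
  qed (use False in auto)
  then show ?thesis using False by (simp add: divide_le_eq)
qed simp

lemma entries_le_opnorm: "av ((A :: 'a^'n^'n) $ i $ j) \<le> opnorm av A"
  using opnorm_bound[of A "axis j 1"] av_le_vnorm[of "A *v axis j 1" i]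
  by (simp add: matrix_vector_mult_axis)

lemma opnorm_le:
  assumes "\<And>i j. av ((A :: 'a^'n^'n) $ i $ j) \<le> c"
  shows "opnorm av A \<le> c"
  unfolding opnorm_def
proof (rule cSUP_least)
  have "(axis undefined 1 :: 'a^'n) \<noteq> 0" by (simp add: axis_eq_0_iff)
  then show "{x :: 'a^'n. x \<noteq> 0} \<noteq> {}" by blast
qed (auto simp: divide_le_eq intro: vnorm_matrix_le assms)

lemma opnorm_nonneg: "0 \<le> opnorm av (A :: 'a^'n^'n)"
  using entries_le_opnorm av_nonneg order_trans by blast

text \<open>Columns are images of unit vectors, and a sum of products is at most its largest term,
  so the operator norm is the largest entry.\<close>

lemma opnorm_le_iff: "opnorm av (A :: 'a^'n^'n) \<le> c \<longleftrightarrow> (\<forall>i j. av (A $ i $ j) \<le> c)"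
  using entries_le_opnorm[of A] opnorm_le[of A c] order_trans by blast

lemma opnorm_mult: "opnorm av ((A :: 'a^'n^'n) ** B) \<le> opnorm av A * opnorm av B"
  by (rule opnorm_le)
     (auto simp: matrix_matrix_mult_def av_mult
        intro!: av_sum_le mult_mono entries_le_opnorm mult_nonneg_nonneg opnorm_nonneg)

lemma opnorm_mat_1: "opnorm av (mat 1 :: 'a^'n^'n) = 1"
  by (rule antisym)
     (use entries_le_opnorm[of "mat 1 :: 'a^'n^'n" undefined undefined] in
       \<open>auto simp: opnorm_le_iff mat_def\<close>)

lemma av_of_int_sign [simp]: "av (of_int (sign p)) = 1"
  by (auto simp: sign_def)

text \<open>An ultrametric Hadamard inequality: every Leibniz term is at most the product of the
  column bounds, hence so is their sum.\<close>

lemma av_det_le: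
  assumes "\<And>i j. av ((A :: 'a^'n^'n) $ i $ j) \<le> c j" "\<And>j. 0 \<le> c j"
  shows "av (det A) \<le> (\<Prod>j\<in>UNIV. c j)"
  unfolding det_def
proof (rule av_sum_le)
  fix p :: "'n \<Rightarrow> 'n" assume "p \<in> {p. p permutes UNIV}"
  then have p: "p permutes UNIV" by simp
  have "av (of_int (sign p) * (\<Prod>i\<in>UNIV. A $ i $ p i)) = (\<Prod>i\<in>UNIV. av (A $ i $ p i))"
    by (simp add: av_mult av_prod)
  also have "\<dots> \<le> (\<Prod>i\<in>UNIV. c (p i))"
    by (intro prod_mono) (auto intro: assms)
  also have "\<dots> = (\<Prod>j\<in>UNIV. c j)"
    by (rule prod.permute[OF p, unfolded o_def, symmetric])
  finally show "av (of_int (sign p) * (\<Prod>i\<in>UNIV. A $ i $ p i)) \<le> (\<Prod>j\<in>UNIV. c j)" .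
qed (auto intro: prod_nonneg assms)

text \<open>The lower bound is Cramer's rule: \<open>x $ k * det P\<close> is the determinant with
  column \<open>k\<close> replaced by the image of \<open>x\<close>, and the other columns have
  entries of absolute value at most 1.\<close>

lemma In_group_isometry:
  assumes P: "P \<in> In_group av"
  shows "vnorm av ((P :: 'a^'n^'n) *v x) = vnorm av x"
proof (rule antisym)
  have e: "av (P $ i $ j) \<le> 1" for i j
    using P entries_le_opnorm[of P i j] unfolding In_group_def by auto
  show "vnorm av (P *v x) \<le> vnorm av x"
    using vnorm_matrix_le[of P 1 x] e by simp
  show "vnorm av x \<le> vnorm av (P *v x)"
    unfolding vnorm_le_iff
  proof
    fix k
    have "av (x $ k) = av (x $ k * det P)"
      using P unfolding In_group_def by (simp add: av_mult)
    also have "\<dots> = av (det (\<chi> i j. if j = k then (P *v x) $ i else P $ i $ j))"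
      by (simp only: cramer_lemma)
    also have "\<dots> \<le> (\<Prod>j\<in>UNIV. if j = k then vnorm av (P *v x) else 1)"
      by (rule av_det_le) (auto simp: av_le_vnorm e)
    also have "\<dots> = vnorm av (P *v x)"
      by simp
    finally show "av (x $ k) \<le> vnorm av (P *v x)" .
  qed
qed

lemma In_group_surj:
  assumes P: "P \<in> In_group av"
  obtains x where "(P :: 'a^'n^'n) *v x = y"
proof -
  have "det P \<noteq> 0" using P unfolding In_group_def by auto
  then obtain B where "P ** B = mat 1"
    unfolding invertible_det_nz[symmetric] invertible_def by blast
  then have "P *v (B *v y) = y" by (simp add: matrix_vector_mul_assoc)
  then show ?thesis using that by blast
qed

section \<open>Smith form over the valuation ring\<close>

text \<open>The group \<open>GL_n\<close> of the valuation ring, given by an explicit integral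
  inverse so that products and inverses are immediate; \<open>GLO_subset_In_group\<close> returns to
  the group of the statement.\<close>

definition GLO :: "('a^'n^'n) set" where
  "GLO = {P. opnorm av P \<le> 1 \<and> (\<exists>P'. opnorm av P' \<le> 1 \<and> P ** P' = mat 1 \<and> P' ** P = mat 1)}"

lemma GLO_subset_In_group: "(GLO :: ('a^'n^'n) set) \<subseteq> In_group av"
proof
  fix P :: "'a^'n^'n" assume "P \<in> GLO"
  then obtain P' where P: "opnorm av P \<le> 1" "opnorm av P' \<le> 1" "P ** P' = mat 1"
    unfolding GLO_def by blast
  have "1 \<le> opnorm av P * opnorm av P'"
    using opnorm_mult[of P P'] P opnorm_mat_1[where 'n = 'n] by simp
  also have "\<dots> \<le> opnorm av P"
    using P opnorm_nonneg[of P] by (simp add: mult_left_le)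
  finally have 1: "opnorm av P = 1" using P by simp
  have d: "av (det P) \<le> 1" "av (det P') \<le> 1"
    using av_det_le[of P "\<lambda>_. 1"] av_det_le[of P' "\<lambda>_. 1"] P by (auto simp: opnorm_le_iff)
  have "av (det P) * av (det P') = 1"
    using P(3) by (metis av_1 av_mult det_I det_mul)
  moreover have "av (det P) * av (det P') \<le> av (det P)"
    using d by (simp add: mult_left_le)
  ultimately have "av (det P) = 1" using d by simp
  then show "P \<in> In_group av" using 1 unfolding In_group_def by simp
qed

lemma GLO_mat_1: "mat 1 \<in> GLO"
  unfolding GLO_def by (auto simp: opnorm_mat_1 intro!: exI[of _ "mat 1"])

lemma GLO_mult: assumes "P \<in> GLO" "Q \<in> GLO" shows "P ** Q \<in> GLO"
proof -
  obtain P' Q' where *: "opnorm av P \<le> 1" "opnorm av P' \<le> 1" "P ** P' = mat 1" "P' ** P = mat 1"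
    "opnorm av Q \<le> 1" "opnorm av Q' \<le> 1" "Q ** Q' = mat 1" "Q' ** Q = mat 1"
    using assms unfolding GLO_def by blast
  have "opnorm av (P ** Q) \<le> 1" "opnorm av (Q' ** P') \<le> 1"
    using opnorm_mult[of P Q] opnorm_mult[of Q' P'] * opnorm_nonneg
    by (smt (verit) mult_le_one)+
  moreover have "(P ** Q) ** (Q' ** P') = mat 1"
    using * by (metis matrix_mul_assoc matrix_mul_rid)
  moreover have "(Q' ** P') ** (P ** Q) = mat 1"
    using * by (metis matrix_mul_assoc matrix_mul_rid)
  ultimately show ?thesis unfolding GLO_def by blast
qed

lemma GLO_inverse: assumes "P \<in> GLO" obtains P' where "P' \<in> GLO" "P' ** P = mat 1" "P ** P' = mat 1"
  using assms unfolding GLO_def by blast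

definition eqv :: "'a^'n^'n \<Rightarrow> 'a^'n^'n \<Rightarrow> bool" where
  "eqv A B \<longleftrightarrow> (\<exists>P\<in>GLO. \<exists>Q\<in>GLO. A = P ** B ** Q)"

lemma eqv_refl: "eqv A A"
  unfolding eqv_def using GLO_mat_1 by (metis matrix_mul_lid matrix_mul_rid)

lemma eqv_trans: assumes "eqv A B" "eqv B C" shows "eqv A C"
proof -
  obtain P Q P' Q' where "P \<in> GLO" "Q \<in> GLO" "P' \<in> GLO" "Q' \<in> GLO" "A = P ** B ** Q" "B = P' ** C ** Q'"
    using assms unfolding eqv_def by blast
  then show ?thesis
    unfolding eqv_def by (intro bexI[of _ "P ** P'"] bexI[of _ "Q' ** Q"])
      (auto simp: GLO_mult matrix_mul_assoc)
qed

lemma eqv_left: assumes "P \<in> GLO" shows "eqv A (P ** A)"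
proof -
  obtain P' where "P' \<in> GLO" "P' ** P = mat 1" using assms GLO_inverse by blast
  then show ?thesis
    unfolding eqv_def using GLO_mat_1
    by (metis matrix_mul_assoc matrix_mul_lid matrix_mul_rid)
qed

lemma eqv_right: assumes "P \<in> GLO" shows "eqv A (A ** P)"
proof -
  obtain P' where "P' \<in> GLO" "P ** P' = mat 1" using assms GLO_inverse by blast
  then show ?thesis
    unfolding eqv_def using GLO_mat_1
    by (metis matrix_mul_assoc matrix_mul_lid matrix_mul_rid)
qed

lemma GLO_swap: "(\<chi> i j. if i = Transposition.transpose r c j then 1 else (0 :: 'a)) \<in> (GLO :: ('a^'n^'n) set)"
  (is "?S \<in> _")
proof -
  have "(?S ** ?S) $ i $ j = (mat 1 :: 'a^'n^'n) $ i $ j" for i j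
  proof -
    have "(?S ** ?S) $ i $ j = (\<Sum>k\<in>UNIV. if k = Transposition.transpose r c j
        then (if i = Transposition.transpose r c k then 1 else 0) else 0)"
      unfolding matrix_matrix_mult_def vec_lambda_beta by (intro sum.cong) auto
    then show ?thesis by (simp add: mat_def)
  qed
  then have "?S ** ?S = mat 1" by (simp add: vec_eq_iff)
  moreover have "opnorm av ?S \<le> 1" by (auto simp: opnorm_le_iff)
  ultimately show ?thesis unfolding GLO_def by blast
qed

text \<open>The inverse is \<open>mat 1 + N\<close>. These matrices perform the row and column
  operations of the elimination.\<close>

lemma GLO_unipotent:
  fixes N :: "'a^'n^'n"
  assumes "opnorm av N \<le> 1" "N ** N = 0"
  shows "mat 1 - N \<in> GLO"
proof -
  have e: "av (N $ i $ j) \<le> 1" for i j using assms(1) by (simp add: opnorm_le_iff)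
  have "opnorm av (mat 1 - N) \<le> 1"
    unfolding opnorm_le_iff
    by (auto simp: mat_def e intro: order_trans[OF av_diff])
  moreover have "opnorm av (mat 1 + N) \<le> 1"
    unfolding opnorm_le_iff
    by (auto simp: mat_def e intro: order_trans[OF av_ultra])
  moreover have "(mat 1 - N) ** (mat 1 + N) = mat 1" "(mat 1 + N) ** (mat 1 - N) = mat 1"
    using assms(2) by (simp_all add: matrix_add_ldistrib matrix_mult_distribs)
  ultimately show ?thesis unfolding GLO_def by blast
qed

text \<open>Gaussian elimination with full pivoting, which keeps all multipliers in the valuation
  ring.\<close>

lemma smith_step:
  fixes A :: "'a^'n^'n"
  assumes diag: "\<And>i j. i \<noteq> j \<Longrightarrow> i \<in> S \<or> j \<in> S \<Longrightarrow> A $ i $ j = 0" and "S \<noteq> UNIV"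
  obtains B r where "eqv A B" "r \<notin> S"
    "\<And>i j. i \<noteq> j \<Longrightarrow> i \<in> insert r S \<or> j \<in> insert r S \<Longrightarrow> B $ i $ j = 0"
proof -
  let ?X = "(- S) \<times> (- S)"
  let ?f = "\<lambda>(i, j). av (A $ i $ j)"
  \<comment> \<open>The pivot is a largest entry outside the cleared rows and columns, so all
    quotients by it are integral.\<close>
  have "Max (?f ` ?X) \<in> ?f ` ?X"
    using assms(2) by (intro Max_in) auto
  then obtain r c where rc: "r \<notin> S" "c \<notin> S" "Max (?f ` ?X) = av (A $ r $ c)"
    by auto
  have max: "av (A $ i $ j) \<le> av (A $ r $ c)" if "i \<notin> S" "j \<notin> S" for i j
    unfolding rc(3)[symmetric] using that by (intro Max_ge) auto
  \<comment> \<open>A column swap puts the pivot on the diagonal; cleared columns stay in place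
    because \<open>r\<close> and \<open>c\<close> lie outside \<open>S\<close>.\<close>
  define A1 where "A1 = A ** (\<chi> i j. if i = Transposition.transpose r c j then 1 else 0)"
  have A1: "A1 $ i $ j = A $ i $ (Transposition.transpose r c j)" for i j
    unfolding A1_def by (simp add: matrix_matrix_mult_def if_distrib cong: if_cong)
  have eqv1: "eqv A A1"
    unfolding A1_def by (rule eqv_right[OF GLO_swap])
  have tr: "Transposition.transpose r c j \<in> S \<longleftrightarrow> j \<in> S" "j \<in> S \<Longrightarrow> Transposition.transpose r c j = j" for j
    using rc by (auto simp: Transposition.transpose_def)
  have diag1: "A1 $ i $ j = 0" if "i \<noteq> j" "i \<in> S \<or> j \<in> S" for i j
    unfolding A1 by (rule diag) (use that tr in metis)+
  have max1: "av (A1 $ i $ j) \<le> av (A1 $ r $ r)" if "i \<notin> S" "j \<notin> S" for i j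
    unfolding A1 using max[of i "Transposition.transpose r c j"] that tr by simp
  \<comment> \<open>If the pivot is 0, division by zero makes all multipliers 0, and the remaining
    block vanishes by maximality of the pivot.\<close>
  define u where "u i = (if i = r then 0 else A1 $ i $ r / A1 $ r $ r)" for i
  define v where "v j = (if j = r then 0 else A1 $ r $ j / A1 $ r $ r)" for j
  have u1: "av (u i) \<le> 1" for i
    using diag1[of i r] max1[of i r] rc by (cases "i \<in> S") (auto simp: u_def av_divide divide_le_eq)
  have v1: "av (v i) \<le> 1" for i
    using diag1[of r i] max1[of r i] rc by (cases "i \<in> S") (auto simp: v_def av_divide divide_le_eq)
  \<comment> \<open>\<open>N\<close> is supported in column \<open>r\<close> and \<open>L\<close> in
    row \<open>r\<close>, both with a zero at the pivot, which makes their squares vanish.\<close>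
  define N where "N = (\<chi> i j. if j = r then u i else 0)"
  define L where "L = (\<chi> i j. if i = r then v j else 0)"
  have "N ** N = 0"
    unfolding vec_eq_iff matrix_matrix_mult_def
    by (auto simp: N_def u_def intro!: sum.neutral)
  moreover have "L ** L = 0"
    unfolding vec_eq_iff matrix_matrix_mult_def
    by (auto simp: L_def v_def intro!: sum.neutral)
  moreover have "opnorm av N \<le> 1" "opnorm av L \<le> 1"
    by (auto simp: opnorm_le_iff N_def L_def u1 v1)
  ultimately have NL: "mat 1 - N \<in> GLO" "mat 1 - L \<in> GLO"
    using GLO_unipotent by blast+
  define A2 where "A2 = (mat 1 - N) ** A1"
  define A3 where "A3 = A2 ** (mat 1 - L)"
  have eqv3: "eqv A A3"
    using eqv1 eqv_left[OF NL(1), of A1] eqv_right[OF NL(2), of A2] eqv_trans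
    unfolding A2_def A3_def by blast
  have NA1: "(N ** A1) $ i $ j = u i * A1 $ r $ j" for i j
  proof -
    have "(N ** A1) $ i $ j = (\<Sum>k\<in>UNIV. if k = r then u i * A1 $ k $ j else 0)"
      unfolding matrix_matrix_mult_def N_def vec_lambda_beta by (intro sum.cong) auto
    then show ?thesis by simp
  qed
  have A2L: "(A2 ** L) $ i $ j = A2 $ i $ r * v j" for i j
  proof -
    have "(A2 ** L) $ i $ j = (\<Sum>k\<in>UNIV. if k = r then A2 $ i $ k * v j else 0)"
      unfolding matrix_matrix_mult_def L_def vec_lambda_beta by (intro sum.cong) auto
    then show ?thesis by simp
  qed
  have A2: "A2 $ i $ j = A1 $ i $ j - u i * A1 $ r $ j" for i j
    unfolding A2_def matrix_mult_distribs
    by (simp add: NA1)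
  have A3: "A3 $ i $ j = A2 $ i $ j - A2 $ i $ r * v j" for i j
    unfolding A3_def matrix_mult_distribs
    by (simp add: A2L)
  have z: "A1 $ i $ j = 0" if "A1 $ r $ r = 0" "i \<notin> S" "j \<notin> S" for i j
    using max1[of i j] that by (metis av_0 av_eq_0_iff av_nonneg order_antisym)
  have A2_col: "A2 $ i $ r = 0" if "i \<noteq> r" for i
    using that z[of i r] diag1[of i r] rc by (cases "i \<in> S") (auto simp: A2 u_def)
  have A2_row: "A2 $ r $ j = A1 $ r $ j" for j
    by (simp add: A2 u_def)
  have u0: "u i = 0" if "i \<in> S" for i
    using that diag1[of i r] rc by (auto simp: u_def)
  have v0: "v i = 0" if "i \<in> S" for i
    using that diag1[of r i] rc by (auto simp: v_def)
  have "A3 $ i $ j = 0" if ij: "i \<noteq> j" "i \<in> insert r S \<or> j \<in> insert r S" for i j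
  proof (cases "i = r")
    case True
    have "A1 $ r $ j = 0" if "A1 $ r $ r = 0"
      using z[of r j] diag1[of r j] that ij True rc by (cases "j \<in> S") auto
    then show ?thesis
      using True ij by (auto simp: A3 A2_row v_def)
  next
    case False
    have "A2 $ i $ j = 0"
    proof (cases "j = r")
      case True then show ?thesis using A2_col False by simp
    next
      case False
      then have "i \<in> S \<or> j \<in> S" using ij \<open>i \<noteq> r\<close> by simp
      then show ?thesis
        using u0[of i] diag1[OF ij(1)] diag1[of r j] False by (auto simp: A2)
    qed
    then show ?thesis using A2_col[OF False] by (simp add: A3)
  qed
  then show ?thesis using that[OF eqv3 rc(1)] by blast
qed

text \<open>Repeated pivoting; \<open>k\<close> counts the indices whose row and column are already
  clear off the diagonal.\<close>

lemma smith_form: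
  fixes A :: "'a^'n^'n"
  obtains P D Q where "P \<in> In_group av" "Q \<in> In_group av" "is_diag D" "A = P ** D ** Q"
proof -
  have "\<exists>S B. card S = k \<and> eqv A B \<and> (\<forall>i j. i \<noteq> j \<longrightarrow> i \<in> S \<or> j \<in> S \<longrightarrow> B $ i $ j = 0)"
    if "k \<le> CARD('n)" for k
    using that
  proof (induction k)
    case 0
    then show ?case using eqv_refl by (intro exI[of _ "{}"]) auto
  next
    case (Suc k)
    then obtain S B where SB: "card S = k" "eqv A B" "\<And>i j. i \<noteq> j \<Longrightarrow> i \<in> S \<or> j \<in> S \<Longrightarrow> B $ i $ j = 0"
      by auto
    moreover have "S \<noteq> UNIV" using SB(1) Suc.prems by auto
    ultimately obtain B' r where "eqv B B'" "r \<notin> S"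
      "\<And>i j. i \<noteq> j \<Longrightarrow> i \<in> insert r S \<or> j \<in> insert r S \<Longrightarrow> B' $ i $ j = 0"
      using smith_step by metis
    then show ?case
      using SB eqv_trans by (intro exI[of _ "insert r S"] exI[of _ B']) auto
  qed
  from this[OF order_refl] obtain S B where S: "card S = CARD('n)" "eqv A B"
    "\<forall>i j. i \<noteq> j \<longrightarrow> i \<in> S \<or> j \<in> S \<longrightarrow> B $ i $ j = 0"
    by blast
  then have "S = UNIV" by (simp add: card_eq_UNIV_imp_eq_UNIV)
  then have "is_diag B" using S unfolding is_diag_def by auto
  moreover obtain P Q where "P \<in> GLO" "Q \<in> GLO" "A = P ** B ** Q"
    using S(2) unfolding eqv_def by blast
  ultimately show ?thesis using that GLO_subset_In_group by blast
qed

end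

section \<open>Exponents of the singular values\<close>

text \<open>The exponent of the singular value with index \<open>i\<close>, counted from 0: first 1,
  then the fractional rest, then 0, and \<open>s / n\<close> throughout beyond \<open>n\<close>.
  With these exponents, which add up to \<open>s\<close>, \<open>sv_fun\<close> is one product
  formula for all \<open>s\<close>.\<close>

definition sexp :: "nat \<Rightarrow> real \<Rightarrow> nat \<Rightarrow> real" where
  "sexp n s i = (if s \<le> real n then max 0 (min 1 (s - real i)) else s / real n)"

lemma sum_sexp: assumes "0 \<le> s" "0 < n" shows "(\<Sum>i<n. sexp n s i) = s"
proof (cases "s \<le> real n")
  case True
  have "(\<Sum>i<k. max 0 (min 1 (s - real i))) = min s (real k)" for k
    using assms(1) by (induction k) auto
  from this[of n] show ?thesis using True by (simp add: sexp_def)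
qed (use assms in \<open>simp add: sexp_def\<close>)

lemma sexp_nonneg: "0 \<le> s \<Longrightarrow> 0 \<le> sexp n s i"
  by (simp add: sexp_def)

lemma sexp_le_1: "s \<le> real n \<Longrightarrow> sexp n s i \<le> 1"
  by (simp add: sexp_def)

text \<open>Where the formula changes at \<open>n\<close>, the old exponents are at most 1 and the
  new ones at least 1.\<close>

lemma sexp_mono: assumes "s \<le> t" "0 \<le> s" "0 < n" shows "sexp n s i \<le> sexp n t i"
proof -
  have "max 0 (min 1 (s - real i)) \<le> t / real n" if "\<not> t \<le> real n"
  proof -
    have "1 \<le> t / real n" using that assms by (simp add: field_simps)
    then show ?thesis by linarith
  qed
  moreover have "s / real n \<le> t / real n"
    using assms by (simp add: divide_right_mono)
  ultimately show ?thesis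
    using assms unfolding sexp_def by (auto split: if_splits)
qed

context nonarch
begin

lemma q_nonneg [simp]: "0 \<le> q"
  using q_pos by (rule less_imp_le)

subsection \<open>Separated nets\<close>

text \<open>One element is chosen from each residue class; elements of different classes are at
  distance at least 1.\<close>

lemma residue_representatives:
  obtains R where "finite R" "real (card R) = q" "\<And>x. x \<in> R \<Longrightarrow> av x \<le> 1"
    "\<And>x y. x \<in> R \<Longrightarrow> y \<in> R \<Longrightarrow> x \<noteq> y \<Longrightarrow> 1 \<le> av (x - y)"
    "\<And>x. av x \<le> 1 \<Longrightarrow> \<exists>y\<in>R. av (x - y) < 1"
proof -
  let ?g = "\<lambda>x. {y \<in> valring av. av (x - y) < 1}"
  obtain R where R: "R \<subseteq> valring av" "inj_on ?g R" "residue_classes av = ?g ` R"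
    using iffD1[OF subset_image_inj, OF eq_refl[OF residue_classes_def[of av]]] by (elim exE conjE)
  have eq: "?g x \<subseteq> ?g y" if "av (x - y) < 1" for x y
  proof
    fix z assume z: "z \<in> ?g x"
    then have "av (y - z) \<le> max (av (x - y)) (av (x - z))"
      using av_diff[of "x - z" "x - y"] by (simp add: algebra_simps max.commute)
    then show "z \<in> ?g y" using z that by auto
  qed
  show ?thesis
  proof
    show "finite R"
      using finite_residue_classes R(2,3) by (simp add: finite_image_iff)
    show "real (card R) = q"
      unfolding q_def R(3) using R(2) by (simp add: card_image)
    show "av x \<le> 1" if "x \<in> R" for x
      using R that by (auto simp: valring_def)
    show "1 \<le> av (x - y)" if "x \<in> R" "y \<in> R" "x \<noteq> y" for x y
    proof (rule ccontr)
      assume "\<not> 1 \<le> av (x - y)"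
      then have "av (x - y) < 1" "av (y - x) < 1" by (simp_all add: av_minus_commute)
      then have "?g x = ?g y" using eq by blast
      then show False using R(2) that unfolding inj_on_def by blast
    qed
    show "\<exists>y\<in>R. av (x - y) < 1" if "av x \<le> 1" for x
    proof -
      have "?g x \<in> ?g ` R"
        using that R(3) unfolding residue_classes_def valring_def by blast
      then obtain y where y: "y \<in> R" "?g x = ?g y" by auto
      have "x \<in> ?g x" using that by (simp add: valring_def)
      then have "x \<in> ?g y" using y by blast
      then show ?thesis using y by (auto simp: av_minus_commute)
    qed
  qed
qed

text \<open>Strict separation and weak covering together mean one point in each of the disjoint
  balls of radius \<open>r\<close>, so the cardinality is determined.\<close>

definition fnet :: "real \<Rightarrow> real \<Rightarrow> 'a set \<Rightarrow> bool" where
  "fnet r a R \<longleftrightarrow> finite R \<and> (\<forall>x\<in>R. av x \<le> a) \<and> (\<forall>x\<in>R. \<forall>y\<in>R. x \<noteq> y \<longrightarrow> r < av (x - y)) \<and>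
    (\<forall>x. av x \<le> a \<longrightarrow> (\<exists>y\<in>R. av (x - y) \<le> r))"

lemma fnetD:
  assumes "fnet r a R"
  shows "finite R" "\<And>x. x \<in> R \<Longrightarrow> av x \<le> a"
    "\<And>x y. x \<in> R \<Longrightarrow> y \<in> R \<Longrightarrow> x \<noteq> y \<Longrightarrow> r < av (x - y)"
    "\<And>x. av x \<le> a \<Longrightarrow> \<exists>y\<in>R. av (x - y) \<le> r"
  using assms unfolding fnet_def by auto

text \<open>A digit expansion: a net of the ball of radius \<open>q ^ k\<close> is refined by the
  residue representatives and scaled up, giving the points \<open>c * (x + r)\<close> with
  \<open>av c = q\<close>.\<close>

lemma net_power: "\<exists>R. fnet 1 (q ^ k) R \<and> real (card R) = q ^ k"
proof (induction k)
  case 0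
  show ?case by (rule exI[of _ "{0}"]) (auto simp: fnet_def)
next
  case (Suc k)
  then obtain R where net: "fnet 1 (q ^ k) R" and R5: "real (card R) = q ^ k"
    by blast
  note R = fnetD[OF net] R5
  obtain S where S: "finite S" "real (card S) = q" "\<And>x. x \<in> S \<Longrightarrow> av x \<le> 1"
    "\<And>x y. x \<in> S \<Longrightarrow> y \<in> S \<Longrightarrow> x \<noteq> y \<Longrightarrow> 1 \<le> av (x - y)"
    "\<And>x. av x \<le> 1 \<Longrightarrow> \<exists>y\<in>S. av (x - y) < 1"
    by (rule residue_representatives) (rule that)
  obtain c where c: "c \<noteq> 0" "av c = q"
    using vgrp_av[of q] vgrpI[of 1] by auto
  let ?f = "\<lambda>(x, r). c * (x + r)"
  have sep: "1 < av (?f u - ?f v)" if uv: "u \<in> R \<times> S" "v \<in> R \<times> S" "u \<noteq> v" for u v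
  proof -
    obtain x r y s where xy: "u = (x, r)" "v = (y, s)" by (meson surj_pair)
    have "1 \<le> av (x + r - (y + s))"
    proof (cases "x = y")
      case True
      then show ?thesis using S(4)[of r s] uv xy by auto
    next
      case False
      \<comment> \<open>Distinct net points are more than 1 apart and representatives differ by at
        most 1, so \<open>x - y\<close> dominates.\<close>
      have 1: "1 < av (x - y)" using R(3) False uv xy by auto
      have "av (r - s) \<le> 1"
        using av_diff[of r s] S(3)[of r] S(3)[of s] uv xy by auto
      moreover have "av (x - y) \<le> max (av (x + r - (y + s))) (av (r - s))"
        using av_diff[of "x + r - (y + s)" "r - s"] by (simp add: algebra_simps)
      ultimately show ?thesis using 1 by auto
    qed
    then have "q * 1 \<le> q * av (x + r - (y + s))"
      using q_pos by (intro mult_left_mono) auto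
    then have "1 < av c * av (x + r - (y + s))"
      using q_ge_2 unfolding c(2) by linarith
    then show ?thesis
      unfolding xy by (simp add: av_mult[symmetric] right_diff_distrib)
  qed
  have "inj_on ?f (R \<times> S)"
  proof (rule inj_onI)
    fix u v assume "u \<in> R \<times> S" "v \<in> R \<times> S" "?f u = ?f v"
    then show "u = v" using sep[of u v] by fastforce
  qed
  then have card: "real (card (?f ` (R \<times> S))) = q ^ Suc k"
    using R(5) S(2) by (simp add: card_image card_cartesian_product)
  have bound: "av (?f u) \<le> q ^ Suc k" if "u \<in> R \<times> S" for u
  proof -
    obtain x r where u: "u = (x, r)" by (meson surj_pair)
    have "1 \<le> q ^ k" using q_ge_2 by (intro one_le_power) auto
    then have "av (x + r) \<le> q ^ k"
      using av_ultra[of x r] R(2)[of x] S(3)[of r] that u by auto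
    then show ?thesis
      unfolding u using c q_pos by (simp add: av_mult)
  qed
  have cover: "\<exists>y\<in>?f ` (R \<times> S). av (x - y) \<le> 1" if "av x \<le> q ^ Suc k" for x
  proof -
    have "av (x / c) \<le> q ^ k" using that c q_pos by (simp add: av_divide divide_le_eq mult.commute)
    then obtain y where y: "y \<in> R" "av (x / c - y) \<le> 1" using R(4) by blast
    then obtain r where r: "r \<in> S" "av (x / c - y - r) < 1" using S(5) by blast
    \<comment> \<open>The remainder is smaller than 1, hence at most \<open>1 / q\<close> by
      discreteness; this compensates for the scaling by \<open>c\<close>.\<close>
    have "av (x / c - y - r) * q \<le> 1"
    proof (cases "x / c - y - r = 0")
      case False
      then show ?thesis
        using vgrp_gap[OF av_in_vgrp[OF False] vgrp_1 r(2)] by (simp add: mult.commute)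
    qed simp
    moreover have "x - c * (y + r) = (x / c - y - r) * c"
      using c by (simp add: field_simps)
    ultimately have "av (x - c * (y + r)) \<le> 1"
      using c av_mult[of "x / c - y - r" c] by simp
    then show ?thesis using y r by force
  qed
  have "fnet 1 (q ^ Suc k) (?f ` (R \<times> S))"
    unfolding fnet_def
  proof (intro conjI ballI allI impI)
    show "finite (?f ` (R \<times> S))" using R(1) S(1) by simp
    show "av x \<le> q ^ Suc k" if "x \<in> ?f ` (R \<times> S)" for x
      using that bound by blast
    show "1 < av (x - y)" if xy: "x \<in> ?f ` (R \<times> S)" "y \<in> ?f ` (R \<times> S)" "x \<noteq> y" for x y
    proof -
      obtain u v where "u \<in> R \<times> S" "v \<in> R \<times> S" "x = ?f u" "y = ?f v" using xy by blast
      then show ?thesis using sep[of u v] xy(3) by blast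
    qed
  qed (rule cover)
  then show ?case using card by blast
qed

text \<open>Scaling by an element of absolute value \<open>r\<close> reduces to separation 1. If
  \<open>a \<le> r\<close>, the point 0 alone is a net, whence the \<open>max\<close>.\<close>

lemma net_field:
  assumes "a \<in> vgrp" "r \<in> vgrp"
  shows "\<exists>R. fnet r a R \<and> real (card R) = max 1 (a / r)"
proof (cases "a \<le> r")
  case True
  then show ?thesis
    using vgrp_pos[OF assms(1)] vgrp_pos[OF assms(2)] by (intro exI[of _ "{0}"]) (auto simp: fnet_def)
next
  case False
  obtain c where c: "c \<noteq> 0" "av c = r" using vgrp_av assms(2) by blast
  have r: "r > 0" using vgrp_pos assms by blast
  obtain k where k: "a / r = q powi k" using vgrp_divide[OF assms] unfolding vgrp_def by auto
  have "k \<ge> 0"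
  proof (rule ccontr)
    assume "\<not> k \<ge> 0"
    then have "q powi k \<le> q powi 0" by (intro power_int_increasing) (use q_ge_2 in auto)
    then have "a / r \<le> 1" using k by simp
    then show False using False r by (simp add: divide_le_eq)
  qed
  then obtain j where j: "a / r = q ^ j" using k by (metis nonneg_int_cases power_int_of_nat)
  obtain R where net: "fnet 1 (q ^ j) R" and R5: "real (card R) = q ^ j"
    using net_power[of j] by blast
  note R = fnetD[OF net] R5
  have a: "a = r * q ^ j" using j r by (simp add: field_simps)
  have m: "max 1 (a / r) = q ^ j" using j False r by (simp add: field_simps)
  have sub: "av (c * x - c * y) = r * av (x - y)" for x y
    using c by (simp add: av_mult right_diff_distrib[symmetric])
  show ?thesis
    unfolding fnet_def
  proof (rule exI[of _ "(*) c ` R"], intro conjI ballI allI impI)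
    show "real (card ((*) c ` R)) = max 1 (a / r)"
      unfolding m using R(5) c by (subst card_image) (auto simp: inj_on_def)
    show "\<exists>y\<in>(*) c ` R. av (x - y) \<le> r" if "av x \<le> a" for x
    proof -
      have "av (x / c) \<le> q ^ j" using that c r by (simp add: av_divide divide_le_eq a mult.commute)
      then obtain y where "y \<in> R" "av (x / c - y) \<le> 1" using R(4) by blast
      then show ?thesis using sub[of "x / c" y] c r by (intro bexI[of _ "c * y"]) (auto simp: mult_le_cancel_left1)
    qed
  qed (use R c r in \<open>auto simp: sub av_mult a\<close>)
qed

definition net :: "real \<Rightarrow> ('a^'n) set \<Rightarrow> ('a^'n) set \<Rightarrow> bool" where
  "net r E R \<longleftrightarrow> finite R \<and> R \<subseteq> E \<and> (\<forall>x\<in>R. \<forall>y\<in>R. x \<noteq> y \<longrightarrow> r < vnorm av (x - y)) \<and>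
     (\<forall>x\<in>E. \<exists>y\<in>R. vnorm av (x - y) \<le> r)"

text \<open>In the maximum norm products of nets are nets, so the cardinalities multiply.\<close>

lemma net_box:
  fixes a :: "'n::finite \<Rightarrow> real"
  assumes a: "\<And>i. a i \<in> vgrp" and r: "r \<in> vgrp"
  obtains R where "net r {x :: 'a^'n. \<forall>i. av (x $ i) \<le> a i} R" "real (card R) = (\<Prod>i\<in>UNIV. max 1 (a i / r))"
proof -
  have "\<exists>F. \<forall>i. fnet r (a i) (F i) \<and> real (card (F i)) = max 1 (a i / r)"
    by (intro choice allI net_field a r)
  then obtain F where net: "\<And>i. fnet r (a i) (F i)" and F5: "\<And>i. real (card (F i)) = max 1 (a i / r)"
    by blast
  note F = fnetD[OF net] F5
  let ?R = "vec_lambda ` (Pi\<^sub>E UNIV F) :: ('a^'n) set"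
  have "inj_on vec_lambda (Pi\<^sub>E UNIV F)"
    by (auto simp: inj_on_def vec_lambda_inject)
  then have "card ?R = (\<Prod>i\<in>UNIV. card (F i))"
    by (simp add: card_image card_PiE)
  then have "real (card ?R) = (\<Prod>i\<in>UNIV. max 1 (a i / r))"
    using F(5) by simp
  moreover have "net r {x :: 'a^'n. \<forall>i. av (x $ i) \<le> a i} ?R"
    unfolding net_def
  proof (intro conjI ballI impI)
    show "finite ?R" using F(1) by (intro finite_imageI finite_PiE) auto
    show "?R \<subseteq> {x :: 'a^'n. \<forall>i. av (x $ i) \<le> a i}" using F(2) by (auto simp: PiE_iff)
    show "r < vnorm av (x - y)" if xy: "x \<in> ?R" "y \<in> ?R" "x \<noteq> y" for x y
    proof -
      obtain i where i: "x $ i \<noteq> y $ i" using xy(3) by (auto simp: vec_eq_iff)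
      have "x $ i \<in> F i" "y $ i \<in> F i" using xy by auto
      then have "r < av ((x - y) $ i)" using F(3) i by simp
      then show ?thesis using av_le_vnorm[of "x - y" i] by linarith
    qed
    show "\<exists>y\<in>?R. vnorm av (x - y) \<le> r" if "x \<in> {x :: 'a^'n. \<forall>i. av (x $ i) \<le> a i}" for x
    proof -
      have "\<exists>f. \<forall>i. f i \<in> F i \<and> av (x $ i - f i) \<le> r"
        using F(4) that by (intro choice) blast
      then obtain f where "\<And>i. f i \<in> F i" "\<And>i. av (x $ i - f i) \<le> r" by blast
      then show ?thesis by (intro bexI[of _ "vec_lambda f"]) (auto simp: vnorm_le_iff)
    qed
  qed
  ultimately show ?thesis using that by blast
qed

lemma net_isometry_image:
  assumes "net r E R" "P \<in> In_group av"
  shows "net r ((*v) P ` E) ((*v) P ` R)" "card ((*v) P ` R) = card R"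
proof -
  have iso: "vnorm av (P *v x - P *v y) = vnorm av (x - y)" for x y
    using In_group_isometry[OF assms(2), of "x - y"] by (simp add: matrix_vector_mult_diff_distrib)
  have "inj_on ((*v) P) R"
  proof (rule inj_onI)
    fix x y assume "P *v x = P *v y"
    then show "x = y" using iso[of x y] by simp
  qed
  then show "card ((*v) P ` R) = card R" by (rule card_image)
  show "net r ((*v) P ` E) ((*v) P ` R)"
    using assms(1) unfolding net_def by (auto simp: iso)
qed

text \<open>Packing numbers are at most covering numbers: two points of \<open>S\<close> near the
  same centre would be within \<open>r\<close> of each other, and the ultrametric inequality loses
  no factor 2 here.\<close>

lemma separated_card_le:
  assumes "finite R" "\<And>x y. x \<in> S \<Longrightarrow> y \<in> S \<Longrightarrow> x \<noteq> y \<Longrightarrow> r < vnorm av (x - y :: 'a^'n)"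
    "\<And>x. x \<in> S \<Longrightarrow> \<exists>y\<in>R. vnorm av (x - y) \<le> r"
  shows "card S \<le> card R"
proof -
  obtain f where f: "\<And>x. x \<in> S \<Longrightarrow> f x \<in> R \<and> vnorm av (x - f x) \<le> r"
    using assms(3) by metis
  have "inj_on f S"
  proof (rule inj_onI, rule ccontr)
    fix x y assume xy: "x \<in> S" "y \<in> S" "f x = f y" "x \<noteq> y"
    then have "vnorm av (x - y) \<le> r"
      using vnorm_diff_trans[of x "f x" r y] f[of x] f[of y] by (simp add: vnorm_minus_commute)
    then show False using assms(2)[of x y] xy by simp
  qed
  then show ?thesis using f assms(1) by (intro card_inj_on_le[of f]) auto
qed

subsection \<open>Singular values\<close>

text \<open>The clause quantified over \<open>g\<close> says that \<open>singular_values\<close>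
  rearranges the values \<open>av (d i)\<close>, in the product form in which it is used. The
  factorisation is stated on vectors so that no diagonal matrix has to be carried along.\<close>

definition svd :: "'a^'n^'n \<Rightarrow> 'a^'n^'n \<Rightarrow> 'a^'n^'n \<Rightarrow> ('n \<Rightarrow> 'a) \<Rightarrow> bool" where
  "svd T P Q d \<longleftrightarrow> P \<in> In_group av \<and> Q \<in> In_group av \<and> (\<forall>i. d i \<noteq> 0) \<and>
    (\<forall>x. T *v x = P *v (\<chi> i. d i * (Q *v x) $ i)) \<and>
    (\<forall>g :: real \<Rightarrow> real. (\<Prod>i\<in>UNIV. g (av (d i))) = (\<Prod>i<CARD('n). g (singular_values av T ! i))) \<and>
    set (singular_values av T) = range (\<lambda>i. av (d i)) \<and> length (singular_values av T) = CARD('n) \<and>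
    (\<forall>i j. i \<le> j \<longrightarrow> j < CARD('n) \<longrightarrow> singular_values av T ! j \<le> singular_values av T ! i)"

lemma svdD:
  fixes T :: "'a^'n^'n"
  assumes "svd T P Q d"
  shows "P \<in> In_group av" "Q \<in> In_group av" "\<And>i. d i \<noteq> 0"
    "\<And>x. T *v x = P *v (\<chi> i. d i * (Q *v x) $ i)"
    "\<And>g :: real \<Rightarrow> real. (\<Prod>i\<in>UNIV. g (av (d i))) = (\<Prod>i<CARD('n). g (singular_values av T ! i))"
    "set (singular_values av T) = range (\<lambda>i. av (d i))"
    "length (singular_values av T) = CARD('n)"
    "\<And>i j. i \<le> j \<Longrightarrow> j < CARD('n) \<Longrightarrow> singular_values av T ! j \<le> singular_values av T ! i"
  using assms unfolding svd_def by auto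

text \<open>The list picked by \<open>SOME\<close> comes with some factorisation that yields it, and
  that factorisation is the one returned.\<close>

lemma svd_exists:
  fixes T :: "'a^'n^'n"
  assumes "det T \<noteq> 0"
  obtains P Q d where "svd T P Q d"
proof -
  let ?ms = "\<lambda>D :: 'a^'n^'n. image_mset (\<lambda>i. av (D $ i $ i)) (mset_set UNIV)"
  obtain P0 D0 Q0 where "P0 \<in> In_group av" "Q0 \<in> In_group av" "is_diag D0" "T = P0 ** D0 ** Q0"
    using smith_form[of T] .
  then have "\<exists>xs. \<exists>P D Q. P \<in> In_group av \<and> Q \<in> In_group av \<and> is_diag D \<and> T = P ** D ** Q \<and>
      xs = rev (sorted_list_of_multiset (?ms D))"
    by blast
  from someI_ex[OF this] obtain P D Q where PQ: "P \<in> In_group av" "Q \<in> In_group av" "is_diag D"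
    "T = P ** D ** Q" and xs: "singular_values av T = rev (sorted_list_of_multiset (?ms D))"
    unfolding singular_values_def by blast
  let ?xs = "singular_values av T"
  have mset: "mset ?xs = ?ms D" unfolding xs by simp
  have "det T = det P * det D * det Q" using PQ(4) by (simp add: det_mul)
  moreover have "det D = (\<Prod>i\<in>UNIV. D $ i $ i)"
    using PQ(3) unfolding is_diag_def by (intro det_diagonal) auto
  ultimately have "(\<Prod>i\<in>UNIV. D $ i $ i) \<noteq> 0" using assms by auto
  then have nz: "D $ i $ i \<noteq> 0" for i by simp
  have Dv: "D *v y = (\<chi> i. D $ i $ i * y $ i)" for y
  proof -
    have "(D *v y) $ i = (\<Sum>j\<in>UNIV. if j = i then D $ i $ j * y $ j else 0)" for i
      unfolding matrix_vector_mult_def vec_lambda_beta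
      using PQ(3) unfolding is_diag_def by (intro sum.cong) auto
    then show ?thesis by (simp add: vec_eq_iff)
  qed
  have len: "length ?xs = CARD('n)"
    using mset by (metis size_image_mset size_mset size_mset_set)
  have "set ?xs = set_mset (?ms D)" using mset by (metis set_mset_mset)
  then have set: "set ?xs = range (\<lambda>i. av (D $ i $ i))" by simp
  have prod: "(\<Prod>i\<in>UNIV. g (av (D $ i $ i))) = (\<Prod>i<CARD('n). g (?xs ! i))" for g :: "real \<Rightarrow> real"
  proof -
    have "(\<Prod>i<CARD('n). g (?xs ! i)) = prod_list (map g ?xs)"
      using len by (simp add: prod.list_conv_set_nth atLeast0LessThan)
    also have "\<dots> = prod_mset (image_mset g (mset ?xs))"
      by (simp add: prod_mset_prod_list[symmetric])
    also have "\<dots> = (\<Prod>i\<in>UNIV. g (av (D $ i $ i)))"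
      unfolding mset by (simp add: prod_unfold_prod_mset multiset.map_comp o_def)
    finally show ?thesis by simp
  qed
  have dec: "?xs ! j \<le> ?xs ! i" if "i \<le> j" "j < CARD('n)" for i j
    using sorted_rev_nth_mono[of ?xs i j] that len xs by simp
  have "T *v x = P *v (\<chi> i. D $ i $ i * (Q *v x) $ i)" for x
    unfolding PQ(4) Dv[symmetric] by (simp add: matrix_vector_mul_assoc matrix_mul_assoc)
  then show ?thesis
    using PQ nz set len prod dec by (intro that[of P Q "\<lambda>i. D $ i $ i"]) (simp add: svd_def)
qed

abbreviation sval :: "'a^'n^'n \<Rightarrow> nat \<Rightarrow> real" where
  "sval T i \<equiv> singular_values av T ! i"

lemma sval_vgrp:
  assumes "det (T :: 'a^'n^'n) \<noteq> 0" "i < CARD('n)" shows "sval T i \<in> vgrp"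
proof -
  obtain P Q d where "svd T P Q d" using svd_exists[OF assms(1)] .
  note * = svdD[OF this]
  show ?thesis using *(3,6,7) assms(2) nth_mem[of i "singular_values av T"] av_in_vgrp by auto
qed

lemma sval_pos:
  assumes "det (T :: 'a^'n^'n) \<noteq> 0" "i < CARD('n)" shows "0 < sval T i"
  using vgrp_pos sval_vgrp[OF assms] by blast

lemma sval_antimono:
  assumes "det (T :: 'a^'n^'n) \<noteq> 0" "i \<le> j" "j < CARD('n)" shows "sval T j \<le> sval T i"
  by (rule svd_exists[OF assms(1)]) (use assms(2,3) in \<open>auto dest: svdD(8)\<close>)

text \<open>Each singular value is the factor by which \<open>T\<close> stretches a certain unit
  vector, one that \<open>Q\<close> sends to a basis vector.\<close>

lemma sval_between:
  fixes T :: "'a^'n^'n"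
  assumes "det T \<noteq> 0" "i < CARD('n)"
    and c: "\<And>x. c * vnorm av x \<le> vnorm av (T *v x)" and l: "\<And>x. vnorm av (T *v x) \<le> l * vnorm av x"
  shows "c \<le> sval T i" "sval T i \<le> l"
proof -
  obtain P Q d where "svd T P Q d" using svd_exists[OF assms(1)] .
  note * = svdD[OF this]
  have "sval T i \<in> range (\<lambda>i::'n. av (d i))"
    using *(6,7) assms(2) nth_mem[of i "singular_values av T"] by auto
  then obtain k where k: "sval T i = av (d k)" by auto
  obtain x where x: "Q *v x = axis k 1" using In_group_surj[OF *(2)] by blast
  have 1: "vnorm av x = 1" using In_group_isometry[OF *(2), of x] x by simp
  have "(\<chi> i. d i * (Q *v x) $ i) = axis k (d k)"
    by (simp add: x vec_eq_iff axis_def)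
  then have "vnorm av (T *v x) = av (d k)"
    using *(4)[of x] In_group_isometry[OF *(1)] by simp
  then show "c \<le> sval T i" "sval T i \<le> l"
    using c[of x] l[of x] 1 k by simp_all
qed

text \<open>Up to the isometries \<open>P\<close> and \<open>Q\<close>, the image of a ball is a box
  with side lengths \<open>\<sigma> * av (d i)\<close>, for which \<open>net_box\<close> counts
  exactly.\<close>

lemma net_image:
  fixes T :: "'a^'n^'n"
  assumes "det T \<noteq> 0" "\<sigma> \<in> vgrp" "\<rho> \<in> vgrp"
  obtains R where "net \<rho> ((*v) T ` {x. vnorm av x \<le> \<sigma>}) R"
    "real (card R) = (\<Prod>i<CARD('n). max 1 (\<sigma> * sval T i / \<rho>))"
proof -
  obtain P Q d where "svd T P Q d" using svd_exists[OF assms(1)] .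
  note * = svdD[OF this]
  obtain R where R: "net \<rho> {x :: 'a^'n. \<forall>i. av (x $ i) \<le> \<sigma> * av (d i)} R"
    "real (card R) = (\<Prod>i\<in>UNIV. max 1 (\<sigma> * av (d i) / \<rho>))"
    using net_box[of "\<lambda>i. \<sigma> * av (d i)" \<rho>, OF vgrp_mult[OF assms(2) av_in_vgrp[OF *(3)]] assms(3)] by blast
  have "(*v) T ` {x. vnorm av x \<le> \<sigma>} = (*v) P ` {x. \<forall>i. av (x $ i) \<le> \<sigma> * av (d i)}"
  proof (intro equalityI subsetI)
    fix y assume "y \<in> (*v) T ` {x. vnorm av x \<le> \<sigma>}"
    then obtain x where x: "y = T *v x" "vnorm av x \<le> \<sigma>" by auto
    have "vnorm av (Q *v x) \<le> \<sigma>" using x In_group_isometry[OF *(2)] by simp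
    then have "av (d i * (Q *v x) $ i) \<le> \<sigma> * av (d i)" for i
      by (auto simp: av_mult vnorm_le_iff mult.commute[of \<sigma>] intro!: mult_left_mono)
    then show "y \<in> (*v) P ` {x. \<forall>i. av (x $ i) \<le> \<sigma> * av (d i)}"
      unfolding x(1) *(4) by (intro imageI) simp
  next
    fix y assume "y \<in> (*v) P ` {x. \<forall>i. av (x $ i) \<le> \<sigma> * av (d i)}"
    then obtain z where z: "y = P *v z" "\<And>i. av (z $ i) \<le> \<sigma> * av (d i)" by auto
    obtain x where x: "Q *v x = (\<chi> i. z $ i / d i)" using In_group_surj[OF *(2)] by blast
    have "vnorm av (Q *v x) \<le> \<sigma>"
      unfolding x vnorm_le_iff using z(2) *(3) by (simp add: av_divide divide_le_eq)
    then have "vnorm av x \<le> \<sigma>" using In_group_isometry[OF *(2)] by simp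
    moreover have "T *v x = y" unfolding *(4) x z(1) using *(3) by simp
    ultimately show "y \<in> (*v) T ` {x. vnorm av x \<le> \<sigma>}" by blast
  qed
  then have "net \<rho> ((*v) T ` {x. vnorm av x \<le> \<sigma>}) ((*v) P ` R)"
    using net_isometry_image(1)[OF R(1) *(1)] by simp
  moreover have "real (card ((*v) P ` R)) = (\<Prod>i<CARD('n). max 1 (\<sigma> * sval T i / \<rho>))"
    using net_isometry_image(2)[OF R(1) *(1)] R(2) *(5)[of "\<lambda>t. max 1 (\<sigma> * t / \<rho>)"] by simp
  ultimately show ?thesis using that by blast
qed

lemma sv_fun_eq:
  fixes T :: "'a^'n^'n"
  assumes "det T \<noteq> 0" "0 \<le> s"
  shows "sv_fun av s T = (\<Prod>i<CARD('n). sval T i powr sexp CARD('n) s i)"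
proof -
  let ?n = "CARD('n)"
  have pos: "0 < sval T i" if "i < ?n" for i using sval_pos[OF assms(1) that] .
  consider "s = 0" | "0 < s" "s \<le> real ?n" | "s > real ?n" using assms by linarith
  then show ?thesis
  proof cases
    case 1
    \<comment> \<open>\<open>x powr 0\<close> is 1 only for nonzero \<open>x\<close>, so the
      positivity of the singular values enters.\<close>
    have "(\<Prod>i<?n. sval T i powr sexp ?n s i) = 1"
      by (rule prod.neutral) (use 1 pos in \<open>auto simp: sexp_def less_imp_neq[symmetric]\<close>)
    then show ?thesis using 1 by (simp add: sv_fun_def)
  next
    case 2
    define m where "m = nat \<lceil>s\<rceil>"
    have m: "0 < m" "real m - 1 < s" "s \<le> real m" "m \<le> ?n"
      using 2 unfolding m_def by linarith+
    then obtain k where k: "m = Suc k" by (cases m) auto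
    \<comment> \<open>Exponent 1 below \<open>k\<close>, the fractional one at
      \<open>k = m - 1\<close>, exponent 0 from \<open>m\<close> on.\<close>
    have "{..<?n} = {..<k} \<union> ({k} \<union> {m..<?n})" using m k by auto
    then have "(\<Prod>i<?n. sval T i powr sexp ?n s i) =
       (\<Prod>i\<in>{..<k} \<union> ({k} \<union> {m..<?n}). sval T i powr sexp ?n s i)" by simp
    also have "\<dots> = (\<Prod>i<k. sval T i powr sexp ?n s i) *
       (sval T k powr sexp ?n s k * (\<Prod>i=m..<?n. sval T i powr sexp ?n s i))"
      using k by (subst prod.union_disjoint, auto)+
    also have "(\<Prod>i<k. sval T i powr sexp ?n s i) = (\<Prod>i<k. sval T i)"
    proof (rule prod.cong)
      fix i assume "i \<in> {..<k}"
      then have "sexp ?n s i = 1" "i < ?n" using m k 2 by (auto simp: sexp_def)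
      then show "sval T i powr sexp ?n s i = sval T i" using pos by (simp add: less_imp_le)
    qed simp
    also have "sexp ?n s k = s - real k" using m k 2 by (auto simp: sexp_def)
    also have "(\<Prod>i=m..<?n. sval T i powr sexp ?n s i) = 1"
    proof (rule prod.neutral, rule ballI)
      fix i assume "i \<in> {m..<?n}"
      then have "sexp ?n s i = 0" "i < ?n" using m 2 by (auto simp: sexp_def)
      then show "sval T i powr sexp ?n s i = 1" using pos[of i] by simp
    qed
    finally show ?thesis
      using 2 k unfolding sv_fun_def Let_def m_def[symmetric] by simp
  next
    case 3
    have "(\<Prod>i<?n. sval T i) powr (s / ?n) = (\<Prod>i<?n. sval T i powr (s / ?n))"
      using pos by (intro prod_powr_distrib)
    then show ?thesis using 3 assms by (auto simp: sv_fun_def Let_def sexp_def)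
  qed
qed

lemma sv_fun_pos:
  assumes "det (T :: 'a^'n^'n) \<noteq> 0" "0 \<le> s" shows "0 < sv_fun av s T"
  unfolding sv_fun_eq[OF assms] using sval_pos[OF assms(1)] by (intro prod_pos) (auto simp: less_imp_neq[symmetric])

lemma powr_sexp_prod:
  assumes "0 \<le> s" "0 < \<rho>"
  shows "(\<Prod>i<CARD('n::finite). \<rho> powr sexp CARD('n) s i) = \<rho> powr s"
  using assms sum_sexp[of s "CARD('n)", OF _ zero_less_card_finite] by (simp add: powr_sum[symmetric])

text \<open>The image of the unit ball under \<open>T\<close> is covered by \<open>\<Prod>i. max 1 (sval T i / \<rho>)\<close> balls of
  radius \<open>\<rho>\<close>, so the next two lemmas say that the singular value function is a minimum of
  \<open>\<rho> powr s\<close> times a covering number. Submultiplicativity follows from this without minors.\<close>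

lemma sv_fun_le_cover:
  fixes T :: "'a^'n^'n"
  assumes "det T \<noteq> 0" "0 \<le> s" "s \<le> real CARD('n)" "0 < \<rho>"
  shows "sv_fun av s T \<le> \<rho> powr s * (\<Prod>i<CARD('n). max 1 (sval T i / \<rho>))"
proof -
  let ?n = "CARD('n)"
  have "sv_fun av s T = (\<Prod>i<?n. \<rho> powr sexp ?n s i * (sval T i / \<rho>) powr sexp ?n s i)"
    unfolding sv_fun_eq[OF assms(1,2)]
  proof (rule prod.cong)
    fix i assume "i \<in> {..<?n}"
    then have "0 < sval T i" using sval_pos[of T] assms by simp
    then show "sval T i powr sexp ?n s i = \<rho> powr sexp ?n s i * (sval T i / \<rho>) powr sexp ?n s i"
      using assms(4) by (simp add: powr_divide)
  qed simp
  also have "\<dots> \<le> (\<Prod>i<?n. \<rho> powr sexp ?n s i * max 1 (sval T i / \<rho>))"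
  proof (intro prod_mono conjI mult_left_mono)
    fix i assume "i \<in> {..<?n}"
    then have pos: "0 < sval T i / \<rho>" using sval_pos[of T] assms by simp
    have e: "0 \<le> sexp ?n s i" "sexp ?n s i \<le> 1" using sexp_nonneg sexp_le_1 assms by auto
    show "(sval T i / \<rho>) powr sexp ?n s i \<le> max 1 (sval T i / \<rho>)"
    proof (cases "sval T i / \<rho> \<le> 1")
      case True
      then have "(sval T i / \<rho>) powr sexp ?n s i \<le> 1" using pos e by (intro powr_le1) auto
      then show ?thesis by simp
    next
      case False
      then have "(sval T i / \<rho>) powr sexp ?n s i \<le> (sval T i / \<rho>) powr 1"
        using e by (intro powr_mono) auto
      then show ?thesis using pos by simp
    qed
  qed auto
  also have "\<dots> = \<rho> powr s * (\<Prod>i<?n. max 1 (sval T i / \<rho>))"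
    using powr_sexp_prod[OF assms(2,4), where 'n = 'n] by (simp add: prod.distrib)
  finally show ?thesis .
qed

lemma sv_fun_eq_cover:
  fixes T :: "'a^'n^'n"
  assumes "det T \<noteq> 0" "0 < s" "s \<le> real CARD('n)"
  obtains k where "k < CARD('n)"
    "sv_fun av s T = sval T k powr s * (\<Prod>i<CARD('n). max 1 (sval T i / sval T k))"
proof -
  let ?n = "CARD('n)"
  \<comment> \<open>The index, counted from 0, of the fractional exponent. At radius
    \<open>sval T k\<close> the earlier ratios are at least 1 with exponent 1 and the later ones at
    most 1 with exponent 0, so the estimate becomes an equality.\<close>
  define k where "k = nat \<lceil>s\<rceil> - 1"
  have k: "k < ?n" "real k < s" "s \<le> real k + 1"
    using assms unfolding k_def by linarith+
  have pos: "0 < sval T i" if "i < ?n" for i using sval_pos[OF assms(1) that] .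
  have "sv_fun av s T = (\<Prod>i<?n. sval T k powr sexp ?n s i * max 1 (sval T i / sval T k))"
    unfolding sv_fun_eq[OF assms(1) less_imp_le[OF assms(2)]]
  proof (rule prod.cong)
    fix i assume "i \<in> {..<?n}"
    then have i: "i < ?n" by simp
    note p = pos[OF i] pos[OF k(1)]
    consider "i < k" | "i = k" | "k < i" by linarith
    then show "sval T i powr sexp ?n s i = sval T k powr sexp ?n s i * max 1 (sval T i / sval T k)"
    proof cases
      case 1
      then have "sexp ?n s i = 1" using k assms by (auto simp: sexp_def)
      moreover have "sval T k \<le> sval T i" using 1 k sval_antimono[OF assms(1)] by simp
      ultimately show ?thesis using p by (simp add: max_def le_divide_eq)
    next
      case 2
      then show ?thesis using p by simp
    next
      case 3
      then have "sexp ?n s i = 0" using k assms by (auto simp: sexp_def)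
      moreover have "sval T i \<le> sval T k" using 3 i sval_antimono[OF assms(1)] by simp
      ultimately show ?thesis using p by (simp add: max_def divide_le_eq)
    qed
  qed simp
  also have "\<dots> = sval T k powr s * (\<Prod>i<?n. max 1 (sval T i / sval T k))"
    using powr_sexp_prod[OF _ pos[OF k(1)], of s, where 'n = 'n] assms by (simp add: prod.distrib)
  finally show ?thesis using that k by blast
qed

text \<open>From \<open>min 1 y \<le> y powr e\<close> for exponents \<open>e\<close> between 0 and
  1. This is the volume counterpart of the covering estimates: it produces the quotient that bounds
  the probability of two points being close.\<close>

lemma prod_min_le_sv_fun:
  fixes T :: "'a^'n^'n"
  assumes "det T \<noteq> 0" "0 \<le> s" "s \<le> real CARD('n)" "0 < \<rho>"
  shows "(\<Prod>i<CARD('n). min 1 (\<rho> / sval T i)) \<le> \<rho> powr s / sv_fun av s T"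
proof -
  let ?n = "CARD('n)"
  have pos: "0 < sval T i" if "i < ?n" for i using sval_pos[OF assms(1) that] .
  have "(\<Prod>i<?n. min 1 (\<rho> / sval T i)) \<le> (\<Prod>i<?n. \<rho> powr sexp ?n s i / sval T i powr sexp ?n s i)"
  proof (intro prod_mono conjI)
    fix i assume "i \<in> {..<?n}"
    then have p: "0 < \<rho> / sval T i" "0 < sval T i" using pos assms by auto
    then show "0 \<le> min 1 (\<rho> / sval T i)" by simp
    have e: "0 \<le> sexp ?n s i" "sexp ?n s i \<le> 1" using sexp_nonneg sexp_le_1 assms by auto
    have "min 1 (\<rho> / sval T i) \<le> (\<rho> / sval T i) powr sexp ?n s i"
    proof (cases "\<rho> / sval T i \<le> 1")
      case True
      then have "(\<rho> / sval T i) powr 1 \<le> (\<rho> / sval T i) powr sexp ?n s i"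
        using p e by (intro powr_mono') auto
      then show ?thesis using p(1) by (simp only: powr_one min_le_iff_disj) simp
    next
      case False
      then have "1 \<le> (\<rho> / sval T i) powr sexp ?n s i" using e by (intro ge_one_powr_ge_zero) auto
      then show ?thesis by simp
    qed
    then show "min 1 (\<rho> / sval T i) \<le> \<rho> powr sexp ?n s i / sval T i powr sexp ?n s i"
      using p assms(4) by (simp add: powr_divide)
  qed
  also have "\<dots> = \<rho> powr s / sv_fun av s T"
    unfolding sv_fun_eq[OF assms(1,2)]
    using powr_sexp_prod[OF assms(2,4), where 'n = 'n] by (simp add: prod_dividef)
  finally show ?thesis .
qed

text \<open>Cover the \<open>U\<close>-image of the unit ball at the best radius
  \<open>\<sigma>\<close> for \<open>U\<close>, then the \<open>T\<close>-image of each piece at the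
  best ratio \<open>\<rho>\<close> for \<open>T\<close>. This covers the image under
  \<open>T ** U\<close> at radius \<open>\<rho> * \<sigma>\<close>, where
  \<open>sv_fun_le_cover\<close> applies; for the two factors the covering formula is an
  equality.\<close>

lemma sv_fun_mult_le_aux:
  fixes T U :: "'a^'n^'n"
  assumes T: "det T \<noteq> 0" and U: "det U \<noteq> 0" and s: "0 < s" "s \<le> real CARD('n)"
  shows "sv_fun av s (T ** U) \<le> sv_fun av s T * sv_fun av s U"
proof -
  let ?n = "CARD('n)"
  have TU: "det (T ** U) \<noteq> 0" using T U by (simp add: det_mul)
  obtain k where k: "k < ?n" "sv_fun av s T = sval T k powr s * (\<Prod>i<?n. max 1 (sval T i / sval T k))"
    using sv_fun_eq_cover[OF T s] by blast
  obtain l where l: "l < ?n" "sv_fun av s U = sval U l powr s * (\<Prod>i<?n. max 1 (sval U i / sval U l))"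
    using sv_fun_eq_cover[OF U s] by blast
  define \<rho> \<sigma> where "\<rho> = sval T k" and "\<sigma> = sval U l"
  have v: "\<rho> \<in> vgrp" "\<sigma> \<in> vgrp" unfolding \<rho>_def \<sigma>_def using sval_vgrp T U k l by auto
  have pos: "\<rho> > 0" "\<sigma> > 0" using v vgrp_pos by auto
  obtain R1 where R1: "net \<sigma> ((*v) U ` {x. vnorm av x \<le> 1}) R1"
    "real (card R1) = (\<Prod>i<?n. max 1 (1 * sval U i / \<sigma>))"
    using net_image[OF U vgrp_1 v(2)] by blast
  obtain R2 where R2: "net (\<rho> * \<sigma>) ((*v) T ` {x. vnorm av x \<le> \<sigma>}) R2"
    "real (card R2) = (\<Prod>i<?n. max 1 (\<sigma> * sval T i / (\<rho> * \<sigma>)))"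
    using net_image[OF T v(2) vgrp_mult[OF v]] by blast
  obtain R3 where R3: "net (\<rho> * \<sigma>) ((*v) (T ** U) ` {x. vnorm av x \<le> 1}) R3"
    "real (card R3) = (\<Prod>i<?n. max 1 (1 * sval (T ** U) i / (\<rho> * \<sigma>)))"
    using net_image[OF TU vgrp_1 vgrp_mult[OF v]] by blast
  let ?R = "(\<lambda>(y, z). T *v y + z) ` (R1 \<times> R2)"
  have fin: "finite R1" "finite R2" using R1 R2 unfolding net_def by auto
  have "card R3 \<le> card ?R"
  proof (rule separated_card_le)
    show "\<rho> * \<sigma> < vnorm av (x - y)" if "x \<in> R3" "y \<in> R3" "x \<noteq> y" for x y
      using R3(1) that unfolding net_def by blast
    show "\<exists>y\<in>?R. vnorm av (x - y) \<le> \<rho> * \<sigma>" if "x \<in> R3" for x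
    proof -
      have "x \<in> (*v) (T ** U) ` {x. vnorm av x \<le> 1}" using R3(1) that unfolding net_def by blast
      then obtain x' where x': "x = T *v (U *v x')" "vnorm av x' \<le> 1"
        by (auto simp: matrix_vector_mul_assoc)
      then obtain y where y: "y \<in> R1" "vnorm av (U *v x' - y) \<le> \<sigma>"
        using R1(1) unfolding net_def by blast
      then obtain z where z: "z \<in> R2" "vnorm av (T *v (U *v x' - y) - z) \<le> \<rho> * \<sigma>"
        using R2(1) unfolding net_def by blast
      then have "vnorm av (x - (T *v y + z)) \<le> \<rho> * \<sigma>"
        unfolding x' by (simp add: matrix_vector_mult_diff_distrib algebra_simps)
      then show ?thesis using y z by force
    qed
  qed (use fin in auto)
  also have "\<dots> \<le> card R1 * card R2"
    using card_image_le[of "R1 \<times> R2" "\<lambda>(y, z). T *v y + z"] fin by (simp add: card_cartesian_product)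
  finally have "real (card R3) \<le> real (card R1) * real (card R2)"
    by (metis of_nat_le_iff of_nat_mult)
  then have le: "(\<Prod>i<?n. max 1 (sval (T ** U) i / (\<rho> * \<sigma>))) \<le>
     (\<Prod>i<?n. max 1 (sval U i / \<sigma>)) * (\<Prod>i<?n. max 1 (sval T i / \<rho>))"
    unfolding R1(2) R2(2) R3(2) using pos by simp
  have "sv_fun av s (T ** U) \<le> (\<rho> * \<sigma>) powr s * (\<Prod>i<?n. max 1 (sval (T ** U) i / (\<rho> * \<sigma>)))"
    using TU s pos by (intro sv_fun_le_cover) auto
  also have "\<dots> \<le> (\<rho> * \<sigma>) powr s * ((\<Prod>i<?n. max 1 (sval U i / \<sigma>)) * (\<Prod>i<?n. max 1 (sval T i / \<rho>)))"
    using le by (intro mult_left_mono) auto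
  also have "\<dots> = sv_fun av s T * sv_fun av s U"
    unfolding k(2) l(2) \<rho>_def[symmetric] \<sigma>_def[symmetric] using pos by (simp add: powr_mult algebra_simps)
  finally show ?thesis .
qed

text \<open>For \<open>s > n\<close> the function is a power of its value at \<open>n\<close>, which
  the covering argument handles.\<close>

lemma sv_fun_mult_le:
  fixes T U :: "'a^'n^'n"
  assumes T: "det T \<noteq> 0" and U: "det U \<noteq> 0" and s: "0 \<le> s"
  shows "sv_fun av s (T ** U) \<le> sv_fun av s T * sv_fun av s U"
proof -
  let ?n = "CARD('n)"
  have TU: "det (T ** U) \<noteq> 0" using T U by (simp add: det_mul)
  consider "s = 0" | "0 < s" "s \<le> real ?n" | "s > real ?n" using s by linarith
  then show ?thesis
  proof cases
    case 1
    then show ?thesis by (simp add: sv_fun_def)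
  next
    case 2
    then show ?thesis using sv_fun_mult_le_aux[OF T U] by blast
  next
    case 3
    have *: "sv_fun av s A = sv_fun av (real ?n) A powr (s / ?n)" if "det A \<noteq> 0" for A :: "'a^'n^'n"
    proof -
      have "sv_fun av (real ?n) A = (\<Prod>i<?n. sval A i)"
        unfolding sv_fun_eq[OF that of_nat_0_le_iff]
        by (rule prod.cong) (use sval_pos[OF that] in \<open>auto simp: sexp_def less_imp_le\<close>)
      then show ?thesis using 3 s by (simp add: sv_fun_def Let_def)
    qed
    have "sv_fun av (real ?n) (T ** U) \<le> sv_fun av (real ?n) T * sv_fun av (real ?n) U"
      using sv_fun_mult_le_aux[OF T U] by simp
    then have "sv_fun av (real ?n) (T ** U) powr (s / ?n) \<le> (sv_fun av (real ?n) T * sv_fun av (real ?n) U) powr (s / ?n)"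
      using sv_fun_pos[OF TU, of "real ?n"] s by (intro powr_mono2) auto
    then show ?thesis
      unfolding *[OF TU] *[OF T] *[OF U]
      using sv_fun_pos[OF T, of "real ?n"] sv_fun_pos[OF U, of "real ?n"] by (simp add: powr_mult)
  qed
qed

text \<open>Raising the exponent by \<open>h\<close> raises the individual exponents by nonnegative
  amounts of total \<open>h\<close>. Applied to words, this makes the pressure strictly decreasing
  and Lipschitz.\<close>

lemma sv_fun_ratio:
  fixes T :: "'a^'n^'n"
  assumes T: "det T \<noteq> 0" and s: "0 \<le> s" "0 \<le> h" and c: "0 < c"
    and bounds: "\<And>i. i < CARD('n) \<Longrightarrow> c \<le> sval T i" "\<And>i. i < CARD('n) \<Longrightarrow> sval T i \<le> l"
  shows "c powr h * sv_fun av s T \<le> sv_fun av (s + h) T" "sv_fun av (s + h) T \<le> l powr h * sv_fun av s T"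
proof -
  let ?n = "CARD('n)"
  let ?e = "\<lambda>i. sexp ?n (s + h) i - sexp ?n s i"
  have e: "0 \<le> ?e i" for i using sexp_mono[of s "s + h" ?n i] s by simp
  have sum: "(\<Sum>i<?n. ?e i) = h" using sum_sexp[of s ?n] sum_sexp[of "s + h" ?n] s by (simp add: sum_subtractf)
  have l: "0 < l" using bounds[of 0] c zero_less_card_finite[where 'a = 'n] by linarith
  have pw: "(\<Prod>i<?n. x powr ?e i) = x powr h" if "x > 0" for x
    using that sum by (simp add: powr_sum[symmetric])
  have pos: "0 < sval T i" if "i < ?n" for i using sval_pos[OF T that] .
  have split: "sv_fun av (s + h) T = (\<Prod>i<?n. sval T i powr ?e i) * sv_fun av s T"
    unfolding sv_fun_eq[OF T s(1)] sv_fun_eq[OF T add_nonneg_nonneg[OF s]] prod.distrib[symmetric]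
    by (simp add: powr_add[symmetric])
  have "(\<Prod>i<?n. c powr ?e i) \<le> (\<Prod>i<?n. sval T i powr ?e i)"
    using c e bounds by (intro prod_mono) (auto intro: powr_mono2)
  then show "c powr h * sv_fun av s T \<le> sv_fun av (s + h) T"
    unfolding split pw[OF c] using sv_fun_pos[OF T s(1)] by (intro mult_right_mono) auto
  have "(\<Prod>i<?n. sval T i powr ?e i) \<le> (\<Prod>i<?n. l powr ?e i)"
    using e bounds pos by (intro prod_mono) (auto intro!: powr_mono2 simp: less_imp_le)
  then show "sv_fun av (s + h) T \<le> l powr h * sv_fun av s T"
    unfolding split pw[OF l] using sv_fun_pos[OF T s(1)] by (intro mult_right_mono) auto
qed

end

section \<open>Subadditive sequences and sums over words\<close>

text \<open>The linear lower bound makes the infimum of the quotients finite, and division with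
  remainder by an almost optimal \<open>m\<close> shows that it is the limit.\<close>

lemma fekete:
  fixes f :: "nat \<Rightarrow> real"
  assumes sub: "\<And>m n. f (m + n) \<le> f m + f n" and low: "\<And>n. B * real n \<le> f n"
  obtains L where "(\<lambda>n. f n / real n) \<longlonglongrightarrow> L" "\<And>n. 0 < n \<Longrightarrow> L \<le> f n / real n"
proof -
  define L where "L = (INF n\<in>{0<..}. f n / real n)"
  have bdd: "bdd_below ((\<lambda>n. f n / real n) ` {0<..})"
    by (rule bdd_belowI2[where m = B]) (use low in \<open>auto simp: le_divide_eq mult.commute\<close>)
  have L_le: "L \<le> f n / real n" if "0 < n" for n
    unfolding L_def using bdd that by (intro cINF_lower) auto
  have "(\<lambda>n. f n / real n) \<longlonglongrightarrow> L"
  proof (rule LIMSEQ_I)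
    fix e :: real assume e: "0 < e"
    have "\<exists>m\<in>{0<..}. f m / real m < L + e / 2"
      using e bdd unfolding L_def by (intro iffD1[OF cINF_less_iff]) (auto simp: L_def[symmetric])
    then obtain m where m: "0 < m" "f m / real m < L + e / 2" by auto
    \<comment> \<open>The remainder \<open>n mod m\<close> contributes one of finitely many values,
      and replacing \<open>n div m\<close> by \<open>n / m\<close> costs at most
      \<open>\<bar>f m\<bar>\<close>.\<close>
    define C where "C = Max ((\<lambda>r. \<bar>f r\<bar>) ` {..<m}) + \<bar>f m\<bar>"
    have C: "f r + \<bar>f m\<bar> \<le> C" if "r < m" for r
    proof -
      have "\<bar>f r\<bar> \<le> Max ((\<lambda>r. \<bar>f r\<bar>) ` {..<m})" using that by (intro Max_ge) auto
      then show ?thesis unfolding C_def by linarith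
    qed
    have mult: "f (k * m + r) \<le> real k * f m + f r" for k r
    proof (induction k)
      case (Suc k)
      have "f (Suc k * m + r) \<le> f m + f (k * m + r)"
        using sub[of m "k * m + r"] by (simp add: algebra_simps)
      then show ?case using Suc by (simp add: algebra_simps)
    qed simp
    have upper: "f n \<le> real n * (f m / real m) + C" for n
    proof -
      let ?k = "n div m" and ?r = "n mod m"
      have "f n \<le> real ?k * f m + f ?r" using mult[of ?k ?r] by simp
      also have "real ?k * f m = (real n - real ?r) * (f m / real m)"
      proof -
        have "real n = real ?k * real m + real ?r" by (metis of_nat_add of_nat_mult div_mult_mod_eq)
        then show ?thesis using m(1) by simp
      qed
      also have "\<dots> \<le> real n * (f m / real m) + \<bar>f m\<bar>"
      proof -
        have "\<bar>real ?r * (f m / real m)\<bar> \<le> real m * (\<bar>f m\<bar> / real m)"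
          unfolding abs_mult abs_divide using m(1) by (intro mult_mono) (auto simp: less_imp_le)
        then have "\<bar>real ?r * (f m / real m)\<bar> \<le> \<bar>f m\<bar>" using m(1) by simp
        then show ?thesis unfolding left_diff_distrib by linarith
      qed
      finally show ?thesis using C[of ?r] m(1) by simp
    qed
    obtain N :: nat where N: "2 * (\<bar>C\<bar> + 1) / e < real N" using reals_Archimedean2 by blast
    show "\<exists>N0. \<forall>n\<ge>N0. norm (f n / real n - L) < e"
    proof (intro exI allI impI)
      fix n assume n: "n \<ge> Suc N"
      then have n0: "0 < n" "real N < real n" by auto
      have "f n / real n \<le> f m / real m + C / real n"
        using upper[of n] n0 by (simp add: field_simps)
      moreover have "C / real n < e / 2"
      proof -
        have "2 * (\<bar>C\<bar> + 1) < e * real n" using N n0 e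
          by (metis N divide_less_eq mult.commute order_less_trans e)
        then show ?thesis using n0 by (simp add: field_simps)
      qed
      ultimately have "f n / real n < L + e" using m(2) by linarith
      then show "norm (f n / real n - L) < e" using L_le[OF n0(1)] by simp
    qed
  qed
  then show ?thesis using that L_le by blast
qed

lemma finite_words [simp]: "finite (words M r)"
  unfolding words_def using finite_lists_length_eq[of "{..<M}" r] by (simp add: conj_commute)

lemma card_words: "card (words M r) = M ^ r"
  unfolding words_def using card_lists_length_eq[of "{..<M}" r] by (simp add: conj_commute)

lemma words_0 [simp]: "words M 0 = {[]}"
  by (auto simp: words_def)

lemma sum_words_append:
  "(\<Sum>w\<in>words M (m + n). f w) = (\<Sum>u\<in>words M m. \<Sum>v\<in>words M n. f (u @ v))"
proof -
  have "bij_betw (\<lambda>(u, v). u @ v) (words M m \<times> words M n) (words M (m + n))"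
  proof (rule bij_betwI[where g = "\<lambda>w. (take m w, drop m w)"])
    show "(\<lambda>w. (take m w, drop m w)) \<in> words M (m + n) \<rightarrow> words M m \<times> words M n"
      by (auto simp: words_def dest: in_set_takeD in_set_dropD)
  qed (auto simp: words_def)
  from sum.reindex_bij_betw[OF this, of f] show ?thesis
    by (simp add: sum.cartesian_product case_prod_unfold)
qed

lemma words_1: "words M (Suc 0) = (\<lambda>i. [i]) ` {..<M}"
  by (auto simp: words_def length_Suc_conv)

lemma sum_words_1: "(\<Sum>w\<in>words M (Suc 0). f w) = (\<Sum>i<M. f [i])"
  unfolding words_1 by (subst sum.reindex) (auto simp: inj_on_def)

lemma sum_words_snoc: "(\<Sum>w\<in>words M (Suc n). f w) = (\<Sum>u\<in>words M n. \<Sum>i<M. f (u @ [i]))"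
  using sum_words_append[of f M n "Suc 0"] by (simp add: sum_words_1)

lemma sum_words_Cons: "(\<Sum>w\<in>words M (Suc n). f w) = (\<Sum>i<M. \<Sum>u\<in>words M n. f (i # u))"
  using sum_words_append[of f M "Suc 0" n] by (simp add: sum_words_1)

lemma word_map_Nil [simp]: "word_map T [] = mat 1"
  and word_map_Cons [simp]: "word_map T (i # w) = T i ** word_map T w"
  by (simp_all add: word_map_def)

lemma word_map_append: "word_map T (u @ v) = word_map T u ** word_map T v"
  by (induction u) (auto simp: matrix_mul_assoc)

section \<open>Products along words, pressure and affinity dimension\<close>

locale affine_system = nonarch av for av :: "'a::{field,metric_space} \<Rightarrow> real" +
  fixes T :: "nat \<Rightarrow> 'a^'n^'n" and M :: nat
  assumes M_ge_2: "M \<ge> 2"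
    and nonsing: "\<And>i. i < M \<Longrightarrow> det (T i) \<noteq> 0"
    and contr: "\<And>i. i < M \<Longrightarrow> opnorm av (T i) < 1"
begin

lemma det_word_map: "set w \<subseteq> {..<M} \<Longrightarrow> det (word_map T w) \<noteq> 0"
  by (induction w) (auto simp: det_mul nonsing)

lemma det_words: "w \<in> words M r \<Longrightarrow> det (word_map T w) \<noteq> 0"
  using det_word_map unfolding words_def by auto

definition lam :: real where
  "lam = Max ((\<lambda>i. opnorm av (T i)) ` {..<M})"

lemma opnorm_le_lam: "i < M \<Longrightarrow> opnorm av (T i) \<le> lam"
  unfolding lam_def by (intro Max_ge) auto

lemma lam_less_1: "lam < 1"
proof -
  have "lam \<in> (\<lambda>i. opnorm av (T i)) ` {..<M}"
    unfolding lam_def using M_ge_2 by (intro Max_in) (auto simp: lessThan_empty_iff)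
  then show ?thesis using contr by auto
qed

lemma lam_pos: "0 < lam"
proof -
  have 0: "0 < M" using M_ge_2 by simp
  have "T 0 \<noteq> 0"
  proof
    assume "T 0 = 0"
    then have "T 0 = mat 0" by (simp add: vec_eq_iff mat_def)
    then show False using nonsing[OF 0] by (metis det_0)
  qed
  then obtain i j where "T 0 $ i $ j \<noteq> 0" by (auto simp: vec_eq_iff)
  then have "0 < av (T 0 $ i $ j)" by simp
  also have "\<dots> \<le> lam" using entries_le_opnorm opnorm_le_lam[OF 0] order_trans by blast
  finally show ?thesis .
qed

lemma vnorm_T_le: "i < M \<Longrightarrow> vnorm av (T i *v x) \<le> lam * vnorm av x"
  by (rule order_trans[OF opnorm_bound mult_right_mono[OF opnorm_le_lam vnorm_nonneg]])

lemma vnorm_T_le_self: "i < M \<Longrightarrow> vnorm av (T i *v x) \<le> vnorm av x"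
  by (rule order_trans[OF vnorm_T_le mult_left_le_one_le]) (use lam_less_1 lam_pos in auto)

lemma vnorm_word_le: "set w \<subseteq> {..<M} \<Longrightarrow> vnorm av (word_map T w *v x) \<le> lam ^ length w * vnorm av x"
proof (induction w)
  case (Cons i w)
  have "vnorm av (word_map T (i # w) *v x) \<le> lam * vnorm av (word_map T w *v x)"
    using vnorm_T_le[of i "word_map T w *v x"] Cons.prems by (simp add: matrix_vector_mul_assoc)
  also have "\<dots> \<le> lam * (lam ^ length w * vnorm av x)"
    using Cons lam_pos by (intro mult_left_mono) auto
  finally show ?case by simp
qed simp

lemma lower_contraction:
  obtains c where "0 < c" "\<And>i x. i < M \<Longrightarrow> c * vnorm av x \<le> vnorm av (T i *v x)"
proof -
  have "\<exists>c>0. \<forall>x. c * vnorm av x \<le> vnorm av (T i *v x)" if i: "i < M" for i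
  proof -
    obtain B where B: "B ** T i = mat 1"
      using nonsing[OF i] unfolding invertible_det_nz[symmetric] invertible_def by blast
    have inv: "vnorm av x \<le> opnorm av B * vnorm av (T i *v x)" for x
      using opnorm_bound[of B "T i *v x"] B by (simp add: matrix_vector_mul_assoc)
    have "0 < opnorm av B"
      using inv[of "axis undefined 1"] by (metis mult_eq_0_iff mult_zero_left not_less vnorm_axis av_1 opnorm_nonneg order_less_le zero_less_one)
    then show ?thesis
      using inv by (intro exI[of _ "1 / opnorm av B"]) (auto simp: divide_le_eq mult.commute)
  qed
  then obtain c where c: "\<And>i. i < M \<Longrightarrow> 0 < c i" "\<And>i x. i < M \<Longrightarrow> c i * vnorm av x \<le> vnorm av (T i *v x)"
    by metis
  have ne: "c ` {..<M} \<noteq> {}" using M_ge_2 by (auto simp: lessThan_empty_iff)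
  show ?thesis
  proof (rule that[of "Min (c ` {..<M})"])
    show "0 < Min (c ` {..<M})" using c(1) ne by (subst Min_gr_iff) auto
    show "Min (c ` {..<M}) * vnorm av x \<le> vnorm av (T i *v x)" if "i < M" for i x
    proof -
      have "Min (c ` {..<M}) \<le> c i" using that by (intro Min_le) auto
      then show ?thesis using c(2)[OF that, of x] mult_right_mono[OF _ vnorm_nonneg] order_trans by blast
    qed
  qed
qed

text \<open>A common positive lower bound for the stretching by the \<open>T i\<close>. Its powers
  bound singular values from below, which keeps the pressure finite and continuous.\<close>

definition low :: real where
  "low = (SOME c. 0 < c \<and> (\<forall>i<M. \<forall>x. c * vnorm av x \<le> vnorm av (T i *v x)))"

lemma low_pos: "0 < low" and low_T: "i < M \<Longrightarrow> low * vnorm av x \<le> vnorm av (T i *v x)"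
proof -
  obtain c where "0 < c" "\<And>i x. i < M \<Longrightarrow> c * vnorm av x \<le> vnorm av (T i *v x)"
    by (rule lower_contraction) (rule that)
  then have "\<exists>c. 0 < c \<and> (\<forall>i<M. \<forall>x. c * vnorm av x \<le> vnorm av (T i *v x))"
    by blast
  from someI_ex[OF this, folded low_def]
  show "0 < low" "i < M \<Longrightarrow> low * vnorm av x \<le> vnorm av (T i *v x)" by blast+
qed

lemma vnorm_word_ge: "set w \<subseteq> {..<M} \<Longrightarrow> low ^ length w * vnorm av x \<le> vnorm av (word_map T w *v x)"
proof (induction w)
  case (Cons i w)
  have "low * (low ^ length w * vnorm av x) \<le> low * vnorm av (word_map T w *v x)"
    using Cons low_pos by (intro mult_left_mono) auto
  also have "\<dots> \<le> vnorm av (word_map T (i # w) *v x)"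
    using low_T[of i "word_map T w *v x"] Cons.prems by (simp add: matrix_vector_mul_assoc)
  finally show ?case by simp
qed simp

lemma sval_word_bounds:
  assumes "w \<in> words M r" "i < CARD('n)"
  shows "low ^ r \<le> sval (word_map T w) i" "sval (word_map T w) i \<le> lam ^ r"
proof -
  have w: "set w \<subseteq> {..<M}" "length w = r" using assms(1) unfolding words_def by auto
  note b = vnorm_word_ge[OF w(1), unfolded w(2)] vnorm_word_le[OF w(1), unfolded w(2)]
  show "low ^ r \<le> sval (word_map T w) i" "sval (word_map T w) i \<le> lam ^ r"
    using sval_between[OF det_words[OF assms(1)] assms(2) b] by blast+
qed

definition sv_sum :: "real \<Rightarrow> nat \<Rightarrow> real" where
  "sv_sum s r = (\<Sum>w\<in>words M r. sv_fun av s (word_map T w))"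

lemma sv_word_pos: "w \<in> words M r \<Longrightarrow> 0 \<le> s \<Longrightarrow> 0 < sv_fun av s (word_map T w)"
  using sv_fun_pos det_words by blast

lemma words_ne: "words M r \<noteq> {}"
proof
  assume "words M r = {}"
  then show False using card_words[of M r] M_ge_2 by simp
qed

lemma sv_sum_pos: "0 \<le> s \<Longrightarrow> 0 < sv_sum s r"
  unfolding sv_sum_def using words_ne by (intro sum_pos) (auto intro: sv_word_pos)

lemma sv_sum_submult: assumes "0 \<le> s" shows "sv_sum s (m + n) \<le> sv_sum s m * sv_sum s n"
  unfolding sv_sum_def sum_words_append sum_product
  unfolding word_map_append by (intro sum_mono sv_fun_mult_le[OF det_words det_words assms])

lemma sv_sum_0: "sv_sum 0 r = real M ^ r"
  by (simp add: sv_sum_def sv_fun_def card_words)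

lemma sv_sum_ratio:
  assumes "0 \<le> s" "0 \<le> h"
  shows "(low ^ r) powr h * sv_sum s r \<le> sv_sum (s + h) r" "sv_sum (s + h) r \<le> (lam ^ r) powr h * sv_sum s r"
proof -
  have "(low ^ r) powr h * sv_fun av s (word_map T w) \<le> sv_fun av (s + h) (word_map T w) \<and>
    sv_fun av (s + h) (word_map T w) \<le> (lam ^ r) powr h * sv_fun av s (word_map T w)"
    if w: "w \<in> words M r" for w
    using sv_fun_ratio[OF det_words[OF w] assms, of "low ^ r" "lam ^ r"] sval_word_bounds[OF w] low_pos by simp
  then show "(low ^ r) powr h * sv_sum s r \<le> sv_sum (s + h) r" "sv_sum (s + h) r \<le> (lam ^ r) powr h * sv_sum s r"
    unfolding sv_sum_def sum_distrib_left by (auto intro: sum_mono)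
qed

lemma ln_sv_sum_ratio:
  assumes "0 \<le> s" "0 \<le> h"
  shows "real r * (h * ln low) + ln (sv_sum s r) \<le> ln (sv_sum (s + h) r)"
    "ln (sv_sum (s + h) r) \<le> real r * (h * ln lam) + ln (sv_sum s r)"
proof -
  have p: "0 < sv_sum s r" "0 < sv_sum (s + h) r" using sv_sum_pos assms by auto
  have "ln ((low ^ r) powr h * sv_sum s r) \<le> ln (sv_sum (s + h) r)"
    using sv_sum_ratio(1)[OF assms] p low_pos by (intro ln_mono) auto
  then show "real r * (h * ln low) + ln (sv_sum s r) \<le> ln (sv_sum (s + h) r)"
    using p low_pos by (simp add: ln_mult ln_powr ln_realpow algebra_simps)
  have "ln (sv_sum (s + h) r) \<le> ln ((lam ^ r) powr h * sv_sum s r)"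
    using sv_sum_ratio(2)[OF assms] p lam_pos by (intro ln_mono) auto
  then show "ln (sv_sum (s + h) r) \<le> real r * (h * ln lam) + ln (sv_sum s r)"
    using p lam_pos by (simp add: ln_mult ln_powr ln_realpow algebra_simps)
qed

definition pressure :: "real \<Rightarrow> real" where
  "pressure s = lim (\<lambda>r. ln (sv_sum s r) / real r)"

text \<open>Fekete's lemma for the logarithms of the sums. That the limit is also a lower bound at
  every single level is what forces unbounded sums below the affinity dimension.\<close>

lemma pressure_limit:
  assumes s: "0 \<le> s"
  shows "(\<lambda>r. ln (sv_sum s r) / real r) \<longlonglongrightarrow> pressure s" "0 < r \<Longrightarrow> pressure s \<le> ln (sv_sum s r) / real r"
proof -
  have sub: "ln (sv_sum s (m + n)) \<le> ln (sv_sum s m) + ln (sv_sum s n)" for m n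
  proof -
    have "ln (sv_sum s (m + n)) \<le> ln (sv_sum s m * sv_sum s n)" using sv_sum_submult[OF s] sv_sum_pos[OF s] by (intro ln_mono) auto
    then show ?thesis using sv_sum_pos[OF s] by (simp add: ln_mult less_imp_neq[symmetric])
  qed
  \<comment> \<open>At exponent 0 the sum counts words and is at least 1; the ratio bound carries
    this to \<open>s\<close>.\<close>
  have low': "(s * ln low) * real n \<le> ln (sv_sum s n)" for n
  proof -
    have "1 \<le> real M ^ n" using M_ge_2 by (intro one_le_power) auto
    then have "0 \<le> ln (sv_sum 0 n)" unfolding sv_sum_0 by (rule ln_ge_zero)
    then show ?thesis using ln_sv_sum_ratio(1)[OF order_refl s, of n] by (simp add: algebra_simps)
  qed
  obtain L where L: "(\<lambda>n. ln (sv_sum s n) / real n) \<longlonglongrightarrow> L" "\<And>n. 0 < n \<Longrightarrow> L \<le> ln (sv_sum s n) / real n"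
    using fekete[of "\<lambda>n. ln (sv_sum s n)", OF sub low'] by blast
  then have "pressure s = L" unfolding pressure_def by (simp add: limI)
  with L show "(\<lambda>r. ln (sv_sum s r) / real r) \<longlonglongrightarrow> pressure s" "0 < r \<Longrightarrow> pressure s \<le> ln (sv_sum s r) / real r" by auto
qed

lemma pressure_0: "pressure 0 = ln (real M)"
proof -
  have "ln (sv_sum 0 r) / real r = ln (real M)" if "0 < r" for r
    using that M_ge_2 by (simp add: sv_sum_0 ln_realpow)
  then have "(\<lambda>r. ln (sv_sum 0 r) / real r) \<longlonglongrightarrow> ln (real M)"
    by (intro tendsto_eventually eventually_sequentiallyI[of 1]) simp
  then show ?thesis using pressure_limit(1)[of 0] LIMSEQ_unique by blast
qed

lemma pressure_ratio:
  assumes "0 \<le> s" "0 \<le> h"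
  shows "pressure s + h * ln low \<le> pressure (s + h)" "pressure (s + h) \<le> pressure s + h * ln lam"
proof -
  have sh: "0 \<le> s + h" using assms by simp
  have 1: "ln (sv_sum s r) / real r + h * ln low \<le> ln (sv_sum (s + h) r) / real r" if "r \<ge> 1" for r
    using divide_right_mono[OF ln_sv_sum_ratio(1)[OF assms, of r], of "real r"] that
    by (simp add: add_divide_distrib algebra_simps)
  have 2: "ln (sv_sum (s + h) r) / real r \<le> ln (sv_sum s r) / real r + h * ln lam" if "r \<ge> 1" for r
    using divide_right_mono[OF ln_sv_sum_ratio(2)[OF assms, of r], of "real r"] that
    by (simp add: add_divide_distrib algebra_simps)
  show "pressure s + h * ln low \<le> pressure (s + h)"
    using 1 by (intro LIMSEQ_le[OF tendsto_add[OF pressure_limit(1)[OF assms(1)] tendsto_const] pressure_limit(1)[OF sh]]) auto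
  show "pressure (s + h) \<le> pressure s + h * ln lam"
    using 2 by (intro LIMSEQ_le[OF pressure_limit(1)[OF sh] tendsto_add[OF pressure_limit(1)[OF assms(1)] tendsto_const]]) auto
qed

lemma ln_lam_neg: "ln lam < 0"
  using lam_pos lam_less_1 by simp

lemma pressure_less: assumes "0 \<le> s" "s < t" shows "pressure t < pressure s"
proof -
  have "(t - s) * ln lam < 0" using assms ln_lam_neg by (simp add: mult_pos_neg)
  then show ?thesis using pressure_ratio(2)[of s "t - s"] assms by simp
qed

lemma pressure_continuous: "continuous_on {0..} pressure"
proof -
  have *: "\<bar>pressure t - pressure s\<bar> \<le> (\<bar>ln low\<bar> + \<bar>ln lam\<bar>) * \<bar>t - s\<bar>" if "0 \<le> s" "s \<le> t" for s t
  proof -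
    have 1: "pressure s + (t - s) * ln low \<le> pressure t" "pressure t \<le> pressure s"
      using pressure_ratio(1)[of s "t - s"] pressure_less[of s t] that by (auto simp: le_less)
    have "(t - s) * (- \<bar>ln low\<bar>) \<le> (t - s) * ln low" using that by (intro mult_left_mono) auto
    moreover have "0 \<le> \<bar>ln lam\<bar> * (t - s)" using that by simp
    ultimately show ?thesis using 1 that by (simp add: algebra_simps)
  qed
  have "(\<bar>ln low\<bar> + \<bar>ln lam\<bar>)-lipschitz_on {0..} pressure"
  proof (rule lipschitz_onI)
    fix s t :: real assume "s \<in> {0..}" "t \<in> {0..}"
    then show "dist (pressure s) (pressure t) \<le> (\<bar>ln low\<bar> + \<bar>ln lam\<bar>) * dist s t"
      using *[of s t] *[of t s] by (cases "s \<le> t") (auto simp: dist_real_def abs_minus_commute)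
  qed simp
  then show ?thesis by (rule lipschitz_on_continuous_on)
qed

abbreviation d :: real where "d \<equiv> affinity_dim av T M"

text \<open>Existence and uniqueness behind the \<open>THE\<close> in \<open>affinity_dim\<close>:
  the pressure runs continuously from \<open>ln M > 0\<close> to negative values and is strictly
  decreasing.\<close>

lemma affinity_dim_root: "0 < d" "pressure d = 0"
proof -
  have lnM: "0 < ln (real M)" using M_ge_2 by simp
  \<comment> \<open>Chosen so that \<open>ln M + S * ln lam\<close> equals \<open>ln lam\<close>,
    which is negative.\<close>
  define S where "S = ln (real M) / (- ln lam) + 1"
  have S: "0 \<le> S" unfolding S_def using lnM ln_lam_neg by (auto intro!: add_nonneg_nonneg divide_nonneg_nonneg)
  have "pressure S \<le> pressure 0 + S * ln lam" using pressure_ratio(2)[of 0 S] S by simp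
  also have "S * ln lam = - ln (real M) + ln lam" unfolding S_def using ln_lam_neg by (simp add: field_simps)
  finally have "pressure S < 0" using ln_lam_neg by (simp add: pressure_0)
  then obtain x where x: "0 \<le> x" "x \<le> S" "pressure x = 0"
    using IVT2'[of pressure S 0 0] pressure_0 lnM S continuous_on_subset[OF pressure_continuous, of "{0..S}"] by auto
  have "d = x"
    unfolding affinity_dim_def
  proof (rule the_equality)
    show "0 \<le> x \<and> (\<lambda>r. ln (\<Sum>w\<in>words M r. sv_fun av x (word_map T w)) / real r) \<longlonglongrightarrow> 0"
      using pressure_limit(1)[OF x(1)] x unfolding sv_sum_def by simp
    fix s assume s: "0 \<le> s \<and> (\<lambda>r. ln (\<Sum>w\<in>words M r. sv_fun av s (word_map T w)) / real r) \<longlonglongrightarrow> 0"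
    then have "pressure s = 0"
      using pressure_limit(1)[of s] LIMSEQ_unique unfolding sv_sum_def by blast
    then show "s = x" using pressure_less[of s x] pressure_less[of x s] s x by linarith
  qed
  moreover have "x \<noteq> 0" using x pressure_0 lnM by auto
  ultimately show "pressure d = 0" "0 < d" using x by simp_all
qed

lemma sv_sum_unbounded:
  assumes "0 \<le> s" "s < d" shows "\<exists>r. B < sv_sum s r"
proof -
  have Ps: "0 < pressure s" using pressure_less[OF assms] affinity_dim_root by simp
  \<comment> \<open>\<open>\<bar>B\<bar> + 1\<close> is at least 1, so the quotient is nonnegative
    and \<open>r\<close> is positive.\<close>
  obtain r :: nat where r: "ln (\<bar>B\<bar> + 1) / pressure s < real r" using reals_Archimedean2 by blast
  have r0: "0 < r"
  proof -
    have "0 \<le> ln (\<bar>B\<bar> + 1) / pressure s" using Ps by (intro divide_nonneg_nonneg) auto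
    then show ?thesis using r by simp
  qed
  have "ln (\<bar>B\<bar> + 1) < pressure s * real r" using r Ps by (simp add: divide_less_eq mult.commute)
  also have "\<dots> \<le> ln (sv_sum s r)" using pressure_limit(2)[OF assms(1) r0] r0 by (simp add: le_divide_eq)
  finally have "\<bar>B\<bar> + 1 < sv_sum s r" using sv_sum_pos[OF assms(1)] by (subst (asm) ln_less_cancel_iff) auto
  then show ?thesis by (intro exI[of _ r]) linarith
qed

lemma sv_sum_le_1:
  assumes "d < s" shows "\<exists>r>0. sv_sum s r \<le> 1"
proof -
  have s: "0 \<le> s" using affinity_dim_root assms by simp
  have "pressure s < 0" using pressure_less[of d s] affinity_dim_root assms by simp
  then have "\<forall>\<^sub>F r in sequentially. ln (sv_sum s r) / real r < 0"
    using order_tendstoD(2)[OF pressure_limit(1)[OF s]] by blast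
  then obtain N where N: "\<And>r. r \<ge> N \<Longrightarrow> ln (sv_sum s r) / real r < 0"
    by (auto simp: eventually_sequentially)
  let ?r = "Suc N"
  have "ln (sv_sum s ?r) < 0" using N[of ?r] by (simp add: divide_less_0_iff)
  then have "sv_sum s ?r \<le> 1" using sv_sum_pos[OF s, of ?r] by (simp add: ln_less_zero_iff)
  then show ?thesis by blast
qed

end

context nonarch
begin

subsection \<open>Topology\<close>

text \<open>The vector type carries the Euclidean combination of the coordinate distances, the
  theorem the maximum norm. This and the next lemma make them equivalent, so that compactness can be
  used for both.\<close>

lemma vnorm_le_dist: "vnorm av (x - y :: 'a^'n) \<le> dist x y"
  unfolding vnorm_le_iff using dist_vec_nth_le[of x _ y] by (simp add: dist_av)

lemma dist_le_vnorm: "dist x y \<le> real CARD('n) * vnorm av (x - y :: 'a^'n)"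
proof -
  have "dist x y \<le> (\<Sum>i\<in>UNIV. dist (x $ i) (y $ i))"
    unfolding dist_vec_def by (rule L2_set_le_sum) simp
  also have "\<dots> \<le> (\<Sum>i\<in>(UNIV :: 'n set). vnorm av (x - y))"
    using av_le_vnorm[of "x - y"] by (intro sum_mono) (simp add: dist_av)
  finally show ?thesis by simp
qed

text \<open>Local compactness provides one small compact ball at 0; multiplication by a scalar
  carries a ball inside it onto the ball of the given radius.\<close>

lemma compact_av_ball: "compact {x :: 'a. av x \<le> a}"
proof (cases "a > 0")
  case True
  have "\<forall>x :: 'a. \<exists>r>0. compact (cball x r)"
    using lc_field unfolding nonarch_lc_field_def by (elim conjE)
  then obtain r where r: "r > 0" "compact (cball (0 :: 'a) r)" by (elim allE exE conjE)
  obtain v where v: "v \<in> vgrp" "v \<le> r / a" using vgrp_below[of "r / a"] r True by auto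
  obtain c where c: "c \<noteq> 0" "av c = v" using vgrp_av[OF v(1)] by blast
  have ball: "{x. av x \<le> b} = cball 0 b" for b by (auto simp: dist_av)
  have "cball 0 (v * a) = cball 0 r \<inter> cball (0 :: 'a) (v * a)"
  proof -
    have "v * a \<le> r" using v True by (simp add: le_divide_eq)
    then show ?thesis by auto
  qed
  also have "compact \<dots>" using r by (intro compact_Int_closed) auto
  finally have comp: "compact (cball (0 :: 'a) (v * a))" .
  have "(av (inverse c))-lipschitz_on UNIV (\<lambda>y. inverse c * y)"
    by (rule lipschitz_onI) (auto simp: dist_av av_mult[symmetric] right_diff_distrib)
  then have "continuous_on (cball 0 (v * a)) (\<lambda>y. inverse c * y)"
    using lipschitz_on_continuous_on continuous_on_subset by blast
  then have "compact ((\<lambda>y. inverse c * y) ` cball 0 (v * a))"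
    using comp compact_continuous_image by blast
  moreover have "(\<lambda>y. inverse c * y) ` cball 0 (v * a) = {x. av x \<le> a}"
  proof (intro equalityI subsetI)
    fix x assume "x \<in> (\<lambda>y. inverse c * y) ` cball 0 (v * a)"
    then obtain y where "x = inverse c * y" "y \<in> cball 0 (v * a)" by blast
    then have "x = inverse c * y" "av y \<le> v * a" by (simp_all add: dist_av)
    then have "av x = inverse v * av y" "inverse v * av y \<le> inverse v * (v * a)"
      using c vgrp_pos[OF v(1)] by (auto simp: av_mult av_inverse intro!: mult_left_mono)
    moreover have "inverse v * (v * a) = a" using vgrp_pos[OF v(1)] by simp
    ultimately show "x \<in> {x. av x \<le> a}" by simp
  next
    fix x assume "x \<in> {x. av x \<le> a}"
    then have "c * x \<in> cball 0 (v * a)" using c vgrp_pos[OF v(1)] by (simp add: dist_av av_mult)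
    moreover have "x = inverse c * (c * x)" using c by simp
    ultimately show "x \<in> (\<lambda>y. inverse c * y) ` cball 0 (v * a)" by blast
  qed
  ultimately show ?thesis by simp
next
  case False
  have "{x. av x \<le> a} \<subseteq> {0}"
  proof
    fix x assume "x \<in> {x. av x \<le> a}"
    then have "av x = 0" using False av_nonneg[of x] unfolding mem_Collect_eq by linarith
    then show "x \<in> {0}" by simp
  qed
  then show ?thesis using finite_subset finite_imp_compact by blast
qed

lemma compact_vnorm_ball: "compact {x :: 'a^'n. vnorm av x \<le> a}"
proof -
  have "compactin (product_topology (\<lambda>_ :: 'n. euclidean) UNIV) (Pi\<^sub>E UNIV (\<lambda>_. {x :: 'a. av x \<le> a}))"
    using compact_av_ball by (simp add: compactin_PiE)
  then have "compact (Pi\<^sub>E (UNIV :: 'n set) (\<lambda>_. {x :: 'a. av x \<le> a}))"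
    by (simp only: euclidean_product_topology compactin_euclidean_iff)
  moreover have "continuous_on A (vec_lambda :: ('n \<Rightarrow> 'a) \<Rightarrow> 'a^'n)" for A
    by (rule continuous_on_vec_lambda[of A "\<lambda>i f. f i", simplified])
       (rule continuous_on_subset[OF continuous_on_product_coordinates subset_UNIV])
  ultimately have "compact (vec_lambda ` (Pi\<^sub>E (UNIV :: 'n set) (\<lambda>_. {x :: 'a. av x \<le> a})))"
    using compact_continuous_image by blast
  moreover have "vec_lambda ` (Pi\<^sub>E (UNIV :: 'n set) (\<lambda>_. {x :: 'a. av x \<le> a})) = {x. vnorm av x \<le> a}"
  proof (intro equalityI subsetI)
    fix x :: "'a^'n" assume "x \<in> {x. vnorm av x \<le> a}"
    then have "x = vec_lambda (($) x)" "($) x \<in> Pi\<^sub>E UNIV (\<lambda>_. {x :: 'a. av x \<le> a})"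
      by (auto simp: vnorm_le_iff)
    then show "x \<in> vec_lambda ` (Pi\<^sub>E (UNIV :: 'n set) (\<lambda>_. {x :: 'a. av x \<le> a}))" by blast
  qed (auto simp: vnorm_le_iff PiE_iff)
  ultimately show ?thesis by simp
qed

lemma compact_imp_vnorm_bounded:
  assumes "compact (K :: ('a^'n) set)"
  obtains a where "0 < a" "\<And>x. x \<in> K \<Longrightarrow> vnorm av x \<le> a"
proof -
  obtain e where "\<forall>x\<in>K. dist 0 x \<le> e"
    using compact_imp_bounded[OF assms] bounded_any_center[of K 0] by blast
  then have "vnorm av x \<le> max e 1" if "x \<in> K" for x
    using vnorm_le_dist[of 0 x] that by (auto simp: vnorm_minus intro: order_trans)
  then show ?thesis using that[of "max e 1"] by simp
qed

lemma closed_vnorm_approachable: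
  assumes "closed (K :: ('a^'n) set)" "\<And>e. e > 0 \<Longrightarrow> \<exists>y\<in>K. vnorm av (x - y) \<le> e"
  shows "x \<in> K"
proof -
  have "\<exists>y\<in>K. dist y x < e" if "e > 0" for e
  proof -
    let ?n = "real CARD('n)"
    have n: "?n > 0" by simp
    obtain y where y: "y \<in> K" "vnorm av (x - y) \<le> e / (2 * ?n)"
      using assms(2)[of "e / (2 * ?n)"] \<open>e > 0\<close> n by auto
    have "dist y x \<le> ?n * (e / (2 * ?n))"
      using dist_le_vnorm[of x y] mult_left_mono[OF y(2), of ?n] by (simp add: dist_commute)
    also have "\<dots> < e" using \<open>e > 0\<close> n by simp
    finally show ?thesis using y by blast
  qed
  then have "x \<in> closure K" unfolding closure_approachable by blast
  then show ?thesis using assms(1) by simp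
qed

subsection \<open>Covering numbers and dimensions\<close>

text \<open>An ultrametric ball has diameter at most its radius, so covers by sets of diameter
  \<open>r\<close> and covers by balls of radius \<open>r\<close> are interchangeable.\<close>

lemma vdist_ball: "vnorm av (x - z :: 'a^'n) \<le> r \<Longrightarrow> vnorm av (y - z) \<le> r \<Longrightarrow> vdist av x y \<le> r"
  unfolding vdist_def using vnorm_diff_trans[of x z r y] by (simp add: vnorm_minus_commute)

lemma finite_cover_sets:
  assumes "finite R" "\<And>x. x \<in> E \<Longrightarrow> \<exists>y\<in>R. vnorm av (x - y :: 'a^'n) \<le> r"
  shows "\<exists>U :: nat \<Rightarrow> ('a^'n) set. (\<forall>i<card R. \<forall>x\<in>U i. \<forall>y\<in>U i. vdist av x y \<le> r) \<and> E \<subseteq> (\<Union>i<card R. U i)"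
proof -
  obtain h where h: "bij_betw h {0..<card R} R" using ex_bij_betw_nat_finite[OF assms(1)] by blast
  show ?thesis
  proof (intro exI conjI allI impI ballI subsetI)
    fix i x y assume "x \<in> {x. vnorm av (x - h i) \<le> r}" "y \<in> {x. vnorm av (x - h i) \<le> r}"
    then show "vdist av x y \<le> r" using vdist_ball by blast
  next
    fix x assume "x \<in> E"
    then obtain y where y: "y \<in> R" "vnorm av (x - y) \<le> r" using assms(2) by blast
    then obtain i where "i < card R" "h i = y"
      using h unfolding bij_betw_def by (metis atLeastLessThan_iff imageE)
    then show "x \<in> (\<Union>i<card R. {x. vnorm av (x - h i) \<le> r})" using y by auto
  qed
qed

lemma cover_number_le:
  assumes "finite R" "\<And>x. x \<in> E \<Longrightarrow> \<exists>y\<in>R. vnorm av (x - y :: 'a^'n) \<le> r"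
  shows "cover_number (vdist av) r E \<le> card R"
  unfolding cover_number_def by (rule Least_le) (rule finite_cover_sets[OF assms])

lemma finite_net:
  assumes "\<And>x. x \<in> E \<Longrightarrow> vnorm av (x :: 'a^'n) \<le> a" "a \<in> vgrp" "r \<in> vgrp"
  obtains R where "finite R" "\<And>x. x \<in> E \<Longrightarrow> \<exists>y\<in>R. vnorm av (x - y) \<le> r"
    "real (card R) = max 1 (a / r) ^ CARD('n)"
proof -
  obtain R where R: "net r {x :: 'a^'n. \<forall>i. av (x $ i) \<le> a} R" "real (card R) = (\<Prod>i\<in>(UNIV :: 'n set). max 1 (a / r))"
    using net_box[of "\<lambda>_. a" r] assms(2,3) by metis
  have fin: "finite R" using R(1) unfolding net_def by blast
  have cov: "\<exists>y\<in>R. vnorm av (x - y) \<le> r" if "x \<in> E" for x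
    using R(1) assms(1)[OF that] unfolding net_def vnorm_le_iff[of x a] by blast
  show ?thesis by (rule that[OF fin cov]) (use R(2) in auto)
qed

lemma vgrp_above: assumes "0 < x" obtains a where "a \<in> vgrp" "x \<le> a"
proof -
  obtain b where "b \<in> vgrp" "b \<le> x" "x < q * b" using vgrp_below[OF assms] .
  moreover have "q \<in> vgrp" using vgrpI[of 1] by simp
  ultimately show ?thesis using that[of "q * b"] vgrp_mult by auto
qed

definition vbounded :: "('a^'n) set \<Rightarrow> bool" where
  "vbounded E \<longleftrightarrow> (\<exists>a. \<forall>x\<in>E. vnorm av x \<le> a)"

lemma vboundedE:
  assumes "vbounded E" obtains a where "a \<in> vgrp" "1 \<le> a" "\<And>x. x \<in> E \<Longrightarrow> vnorm av x \<le> a"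
proof -
  obtain a where a: "\<And>x. x \<in> E \<Longrightarrow> vnorm av x \<le> a" using assms unfolding vbounded_def by blast
  obtain b where b: "b \<in> vgrp" "max a 1 \<le> b" using vgrp_above[of "max a 1"] by (metis less_max_iff_disj zero_less_one)
  show ?thesis by (rule that[OF b(1)]) (use a b(2) in force)+
qed

text \<open>Boundedness makes finite covers exist, so the \<open>LEAST\<close> in
  \<open>cover_number\<close> is attained.\<close>

lemma cover_number_sets:
  assumes "vbounded E" "0 < r"
  shows "\<exists>U :: nat \<Rightarrow> ('a^'n) set. (\<forall>i<cover_number (vdist av) r E. \<forall>x\<in>U i. \<forall>y\<in>U i. vdist av x y \<le> r) \<and>
    E \<subseteq> (\<Union>i<cover_number (vdist av) r E. U i)"
proof -
  obtain a where a: "a \<in> vgrp" "1 \<le> a" "\<And>x. x \<in> E \<Longrightarrow> vnorm av x \<le> a"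
    by (rule vboundedE[OF assms(1)]) (rule that)
  obtain v where v: "v \<in> vgrp" "v \<le> r" "r < q * v" using vgrp_below[OF assms(2)] .
  obtain R where R: "finite R" "\<And>x. x \<in> E \<Longrightarrow> \<exists>y\<in>R. vnorm av (x - y) \<le> v"
    "real (card R) = max 1 (a / v) ^ CARD('n)"
    by (rule finite_net[OF a(3) a(1) v(1), of E]) (assumption, rule that)
  have "\<exists>y\<in>R. vnorm av (x - y) \<le> r" if "x \<in> E" for x
    using R(2)[OF that] v(2) order_trans by blast
  then have "\<exists>k. \<exists>U :: nat \<Rightarrow> ('a^'n) set. (\<forall>i<k. \<forall>x\<in>U i. \<forall>y\<in>U i. vdist av x y \<le> r) \<and> E \<subseteq> (\<Union>i<k. U i)"
    using finite_cover_sets[OF R(1), of E r] by blast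
  then show ?thesis unfolding cover_number_def by (rule LeastI_ex)
qed

lemma cover_number_net:
  assumes "vbounded E" "0 < r"
  obtains R where "finite R" "card R \<le> cover_number (vdist av) r E"
    "\<And>x. x \<in> E \<Longrightarrow> \<exists>y\<in>R. vnorm av (x - y :: 'a^'n) \<le> r"
proof -
  let ?k = "cover_number (vdist av) r E"
  obtain U where U: "\<And>i x y. i < ?k \<Longrightarrow> x \<in> U i \<Longrightarrow> y \<in> U i \<Longrightarrow> vdist av x y \<le> r" "E \<subseteq> (\<Union>i<?k. U i)"
    using cover_number_sets[OF assms] by metis
  \<comment> \<open>For an empty \<open>U i\<close> the choice is an arbitrary point, which affects
    neither the covering nor the count.\<close>
  let ?R = "(\<lambda>i. SOME y. y \<in> U i) ` {..<?k}"
  show ?thesis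
  proof (rule that[of ?R])
    show "card ?R \<le> ?k" using card_image_le[of "{..<?k}" "\<lambda>i. SOME y. y \<in> U i"] by simp
    show "\<exists>y\<in>?R. vnorm av (x - y) \<le> r" if x: "x \<in> E" for x
    proof -
      obtain i where i: "i < ?k" "x \<in> U i" using U(2) x by blast
      then have "(SOME y. y \<in> U i) \<in> U i" by (meson someI_ex)
      then have "vnorm av (x - (SOME y. y \<in> U i)) \<le> r" using U(1)[OF i] by (simp add: vdist_def)
      then show ?thesis using i by blast
    qed
  qed simp
qed

lemma cover_number_antimono:
  assumes "vbounded E" "0 < r" "r \<le> s"
  shows "cover_number (vdist av) s E \<le> cover_number (vdist av) r (E :: ('a^'n) set)"
proof -
  obtain R where R: "finite R" "card R \<le> cover_number (vdist av) r E"
    "\<And>x. x \<in> E \<Longrightarrow> \<exists>y\<in>R. vnorm av (x - y) \<le> r"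
    by (rule cover_number_net[OF assms(1,2)]) (rule that)
  have "cover_number (vdist av) s E \<le> card R"
    by (rule cover_number_le[OF R(1)]) (use R(3) assms(3) order_trans in blast)
  then show ?thesis using R(2) by simp
qed

lemma cover_number_pos:
  assumes "vbounded E" "0 < r" "E \<noteq> {}"
  shows "0 < cover_number (vdist av) r (E :: ('a^'n) set)"
  using cover_number_sets[OF assms(1,2)] assms(3) by (cases "cover_number (vdist av) r E") auto

text \<open>Other radii are rounded down to the value group; the resulting factor
  \<open>q powr s\<close>, like \<open>C\<close>, disappears after division by
  \<open>- ln r\<close>.\<close>

lemma upper_box_dim_le:
  assumes E: "vbounded E" "E \<noteq> {}" and s: "0 \<le> s" and C: "0 < C"
    and N: "\<And>v. v \<in> vgrp \<Longrightarrow> v \<le> 1 \<Longrightarrow> real (cover_number (vdist av) v E) \<le> C * v powr (- s)"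
  shows "upper_box_dim (vdist av) (E :: ('a^'n) set) \<le> ereal s"
proof -
  let ?N = "\<lambda>r. real (cover_number (vdist av) r E)"
  let ?g = "\<lambda>r::real. s + (- \<bar>ln (C * q powr s)\<bar>) / ln r"
  have le: "ln (?N r) / - ln r \<le> ?g r" if r: "0 < r" "r < 1" for r
  proof -
    obtain v where v: "v \<in> vgrp" "v \<le> r" "r < q * v" using vgrp_below[OF r(1)] .
    have v0: "0 < v" using vgrp_pos v by blast
    have 1: "1 \<le> ?N r" using cover_number_pos[OF E(1) r(1) E(2)] by linarith
    have "?N r \<le> ?N v" using cover_number_antimono[OF E(1) v0 v(2)] by simp
    also have "\<dots> \<le> C * v powr (- s)" using N v r by simp
    also have "\<dots> \<le> C * (r / q) powr (- s)"
      using v r s C v0 by (intro mult_left_mono powr_mono2') (auto simp: divide_le_eq mult.commute)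
    also have "\<dots> = (C * q powr s) * r powr (- s)"
      using r by (simp add: powr_divide powr_minus_divide)
    finally have "ln (?N r) \<le> ln ((C * q powr s) * r powr (- s))" using 1 by (intro ln_mono) auto
    also have "\<dots> = ln (C * q powr s) - s * ln r" using r C by (simp add: ln_mult ln_powr)
    finally have "ln (?N r) \<le> \<bar>ln (C * q powr s)\<bar> - s * ln r" by linarith
    moreover have "0 < - ln r" using r by simp
    ultimately have "ln (?N r) / - ln r \<le> (\<bar>ln (C * q powr s)\<bar> - s * ln r) / - ln r"
      by (intro divide_right_mono) auto
    also have "\<dots> = ?g r" using r by (simp add: field_simps)
    finally show ?thesis .
  qed
  have "filterlim ln at_infinity (at_right (0::real))"
    using ln_at_0 filterlim_at_bot_imp_at_infinity by blast
  then have "(?g \<longlongrightarrow> s + 0) (at_right 0)"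
    by (intro tendsto_add tendsto_const tendsto_divide_0[OF tendsto_const])
  then have lim: "((\<lambda>r. ereal (?g r)) \<longlongrightarrow> ereal s) (at_right 0)" by simp
  have "upper_box_dim (vdist av) E \<le> Limsup (at_right 0) (\<lambda>r. ereal (?g r))"
    unfolding upper_box_dim_def
    by (rule Limsup_mono) (use le in \<open>auto simp: eventually_at_right_field intro!: exI[of _ 1]\<close>)
  also have "\<dots> = ereal s" using lim by (intro lim_imp_Limsup) auto
  finally show ?thesis .
qed

lemma gdiam_bounds:
  assumes "\<And>x y. x \<in> U \<Longrightarrow> y \<in> U \<Longrightarrow> vdist av x y \<le> r" "0 \<le> r"
  shows "0 \<le> gdiam (vdist av) (U :: ('a^'n) set)" "gdiam (vdist av) U \<le> r"
    "x \<in> U \<Longrightarrow> y \<in> U \<Longrightarrow> vdist av x y \<le> gdiam (vdist av) U"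
proof -
  have bdd: "bdd_above ((\<lambda>p. vdist av (fst p) (snd p)) ` (U \<times> U))"
    by (rule bdd_aboveI2[where M = r]) (use assms in auto)
  show le: "vdist av x y \<le> gdiam (vdist av) U" if "x \<in> U" "y \<in> U" for x y
    unfolding gdiam_def using that cSUP_upper[OF _ bdd, of "(x, y)"] by auto
  show "0 \<le> gdiam (vdist av) U"
  proof (cases "U = {}")
    case False
    then obtain x where "x \<in> U" by blast
    then show ?thesis using le[of x x] by (simp add: vdist_def)
  qed (simp add: gdiam_def)
  show "gdiam (vdist av) U \<le> r"
  proof (cases "U = {}")
    case False
    then show ?thesis unfolding gdiam_def using assms by (auto intro!: cSUP_least)
  qed (simp add: gdiam_def assms)
qed

lemma hausdorff_pre_le:
  assumes "vbounded E" "0 < r" "r \<le> \<delta>" "0 < s"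
  shows "hausdorff_pre (vdist av) s \<delta> (E :: ('a^'n) set) \<le> ennreal (real (cover_number (vdist av) r E) * r powr s)"
proof -
  let ?k = "cover_number (vdist av) r E"
  obtain U where U: "\<And>i x y. i < ?k \<Longrightarrow> x \<in> U i \<Longrightarrow> y \<in> U i \<Longrightarrow> vdist av x y \<le> r" "E \<subseteq> (\<Union>i<?k. U i)"
    using cover_number_sets[OF assms(1,2)] by metis
  \<comment> \<open>Padding with empty sets: their diameter is 0 and \<open>0 powr s = 0\<close>, so
    the series is a finite sum.\<close>
  define V where "V i = (if i < ?k then U i else {})" for i
  have V: "vdist av x y \<le> r" if "x \<in> V i" "y \<in> V i" for i x y
    using that U(1) by (auto simp: V_def split: if_splits)
  have diam: "gdiam (vdist av) (V i) powr s \<le> r powr s" for i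
    using gdiam_bounds(1,2)[of "V i" r, OF V] assms by (intro powr_mono2) auto
  have "hausdorff_pre (vdist av) s \<delta> E \<le> (\<Sum>i. ennreal (gdiam (vdist av) (V i) powr s))"
    unfolding hausdorff_pre_def
  proof (rule INF_lower)
    have "E \<subseteq> (\<Union>i. V i)" using U(2) by (fastforce simp: V_def)
    then show "V \<in> {U. (\<forall>i. \<forall>x\<in>U i. \<forall>y\<in>U i. vdist av x y \<le> \<delta>) \<and> E \<subseteq> (\<Union>i. U i)}"
      using V assms(3) order_trans by blast
  qed
  also have "\<dots> = (\<Sum>i<?k. ennreal (gdiam (vdist av) (V i) powr s))"
    by (rule suminf_finite) (use assms(4) in \<open>auto simp: V_def gdiam_def\<close>)
  also have "\<dots> \<le> (\<Sum>i<?k. ennreal (r powr s))"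
    by (intro sum_mono ennreal_leI diam)
  also have "\<dots> = ennreal (real ?k * r powr s)"
    by (simp add: ennreal_mult ennreal_of_nat_eq_real_of_nat)
  finally show ?thesis .
qed

lemma lower_box_dim_nonneg:
  assumes "vbounded E" "E \<noteq> {}" shows "0 \<le> lower_box_dim (vdist av) (E :: ('a^'n) set)"
  unfolding lower_box_dim_def
proof (rule Liminf_bounded)
  have "0 \<le> ln (real (cover_number (vdist av) r E)) / - ln r" if "0 < r" "r < 1" for r
  proof -
    have "1 \<le> real (cover_number (vdist av) r E)"
      using cover_number_pos[OF assms(1) that(1) assms(2)] by linarith
    then show ?thesis using that by (intro divide_nonneg_nonneg) auto
  qed
  then show "\<forall>\<^sub>F r in at_right 0. 0 \<le> ereal (ln (real (cover_number (vdist av) r E)) / - ln r)"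
    by (auto simp: eventually_at_right_field simp del: divide_minus_right intro!: exI[of _ 1])
qed

text \<open>Arbitrarily small radii \<open>r\<close> have covering numbers below
  \<open>r powr (- t)\<close> for some \<open>t < s\<close>; such a cover contributes at most
  \<open>r powr (s - t)\<close>, which tends to 0.\<close>

lemma hausdorff_measure_eq_0:
  assumes E: "vbounded E" "E \<noteq> {}" and less: "lower_box_dim (vdist av) (E :: ('a^'n) set) < ereal s"
  shows "0 < s" "hausdorff_measure (vdist av) s E = 0"
proof -
  let ?N = "\<lambda>r. real (cover_number (vdist av) r E)"
  show s: "0 < s"
    using le_less_trans[OF lower_box_dim_nonneg[OF E] less] by simp
  obtain t where t: "lower_box_dim (vdist av) E < ereal t" "t < s"
    using ereal_dense2[OF less] by auto
  have "hausdorff_pre (vdist av) s \<delta> E = 0" if \<delta>: "0 < \<delta>" for \<delta>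
  proof (rule ccontr)
    assume "hausdorff_pre (vdist av) s \<delta> E \<noteq> 0"
    then have "0 < hausdorff_pre (vdist av) s \<delta> E" by (simp add: zero_less_iff_neq_zero)
    then obtain y where y: "0 < y" "y < hausdorff_pre (vdist av) s \<delta> E" using dense by blast
    then obtain e where e: "0 < e" "ennreal e < hausdorff_pre (vdist av) s \<delta> E"
      by (cases y) auto
    \<comment> \<open>Below \<open>b\<close> the logarithm is negative, the cover is admissible for
      \<open>\<delta>\<close>, and \<open>r powr (s - t) \<le> e\<close>.\<close>
    define b where "b = Min {1, \<delta>, e powr (1 / (s - t))}"
    have b: "0 < b" "b \<le> 1" "b \<le> \<delta>" "b \<le> e powr (1 / (s - t))" unfolding b_def using \<delta> e by auto
    have "\<not> (\<forall>\<^sub>F r in at_right 0. ereal t \<le> ereal (ln (?N r) / - ln r))"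
      using Liminf_bounded[of "ereal t" "\<lambda>r. ereal (ln (?N r) / - ln r)" "at_right 0"] t(1)
      unfolding lower_box_dim_def by force
    then have "\<not> (\<forall>r>0. r < b \<longrightarrow> t \<le> ln (?N r) / - ln r)"
      using b(1) unfolding eventually_at_right_field by auto
    then obtain r where r: "0 < r" "r < b" "ln (?N r) / - ln r < t" by (meson not_le)
    have pos: "0 < ?N r" using cover_number_pos[OF E(1) r(1) E(2)] by simp
    have "0 < - ln r" using r b by simp
    then have "ln (?N r) < - t * ln r" using r(3) by (simp add: divide_less_eq pos_divide_less_eq field_simps)
    then have "ln (?N r) < ln (r powr (- t))" using r by (simp add: ln_powr)
    then have "?N r < r powr (- t)" using pos r(1) by (subst (asm) ln_less_cancel_iff) auto
    then have "?N r * r powr s \<le> r powr (- t) * r powr s" by (intro mult_right_mono) auto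
    also have "\<dots> = r powr (s - t)" by (simp add: powr_add[symmetric])
    also have "\<dots> \<le> (e powr (1 / (s - t))) powr (s - t)" using r b t by (intro powr_mono2) auto
    also have "\<dots> = e" using t e by (simp add: powr_powr)
    finally have "ennreal (?N r * r powr s) \<le> ennreal e" by (rule ennreal_leI)
    then have "hausdorff_pre (vdist av) s \<delta> E \<le> ennreal e"
      using hausdorff_pre_le[OF E(1) r(1) _ s, of \<delta>] r b by force
    then show False using e by simp
  qed
  then show "hausdorff_measure (vdist av) s E = 0"
    unfolding hausdorff_measure_def by (simp add: SUP_eq_const greaterThan_non_empty)
qed

lemma hausdorff_dim_le_lower_box_dim:
  assumes E: "vbounded E" "E \<noteq> {}"
  shows "ereal (hausdorff_dim (vdist av) E) \<le> lower_box_dim (vdist av) (E :: ('a^'n) set)"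
proof (rule ccontr)
  assume "\<not> ?thesis"
  then obtain s where s: "lower_box_dim (vdist av) E < ereal s" "ereal s < ereal (hausdorff_dim (vdist av) E)"
    using ereal_dense2 by (metis not_le)
  have "hausdorff_dim (vdist av) E \<le> s"
    unfolding hausdorff_dim_def
  proof (rule cInf_lower)
    show "s \<in> {s. 0 < s \<and> hausdorff_measure (vdist av) s E = 0}"
      using hausdorff_measure_eq_0[OF E s(1)] by simp
    show "bdd_below {s. 0 < s \<and> hausdorff_measure (vdist av) s E = 0}"
      by (rule bdd_belowI[where m = 0]) auto
  qed
  then show False using s(2) by simp
qed

lemma lower_le_upper_box_dim: "lower_box_dim D E \<le> upper_box_dim D E"
  unfolding lower_box_dim_def upper_box_dim_def by (rule Liminf_le_Limsup) simp

lemma upper_box_dim_le_dimension: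
  assumes E: "vbounded E" "E \<noteq> {}"
  shows "upper_box_dim (vdist av) (E :: ('a^'n) set) \<le> ereal (real CARD('n))"
proof -
  obtain a where a: "a \<in> vgrp" "1 \<le> a" "\<And>x. x \<in> E \<Longrightarrow> vnorm av x \<le> a"
    by (rule vboundedE[OF E(1)]) (rule that)
  show ?thesis
  proof (rule upper_box_dim_le[OF E, where C = "a ^ CARD('n)"])
    fix v assume v: "v \<in> vgrp" "v \<le> 1"
    have v0: "0 < v" using vgrp_pos v by blast
    obtain R where R: "finite R" "\<And>x. x \<in> E \<Longrightarrow> \<exists>y\<in>R. vnorm av (x - y) \<le> v"
      "real (card R) = max 1 (a / v) ^ CARD('n)"
      by (rule finite_net[OF a(3) a(1) v(1), of E]) (assumption, rule that)
    have "real (cover_number (vdist av) v E) \<le> real (card R)"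
      using cover_number_le[OF R(1), of E v] R(2) by simp
    also have "\<dots> = (a / v) ^ CARD('n)" unfolding R(3) using v a v0 by (simp add: max_def le_divide_eq)
    also have "\<dots> = a ^ CARD('n) * v powr (- real CARD('n))"
      using v0 by (simp add: power_divide powr_minus_divide powr_realpow)
    finally show "real (cover_number (vdist av) v E) \<le> a ^ CARD('n) * v powr (- real CARD('n))" .
  qed (use a in auto)
qed

end

context affine_system
begin

subsection \<open>The attractor\<close>

primrec S :: "(nat \<Rightarrow> 'a^'n) \<Rightarrow> nat list \<Rightarrow> 'a^'n \<Rightarrow> 'a^'n" where
  "S b [] x = x"
| "S b (i # w) x = T i *v S b w x + b i"

lemma S_eq: "S b w x = word_map T w *v x + S b w 0"
  by (induction w) (auto simp: matrix_vector_right_distrib matrix_vector_mul_assoc)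

lemma S_diff: "S b w x - S b w y = word_map T w *v (x - y)"
  using S_eq[of b w x] S_eq[of b w y] by (simp add: matrix_vector_mult_diff_distrib)

lemma vnorm_S_diff: "w \<in> words M r \<Longrightarrow> vnorm av (S b w x - S b w y) \<le> lam ^ r * vnorm av (x - y)"
  unfolding S_diff using vnorm_word_le[of w] by (auto simp: words_def)

text \<open>The Hutchinson operator, whose nonempty compact fixed point is the self-affine
  set.\<close>

definition hut :: "(nat \<Rightarrow> 'a^'n) \<Rightarrow> ('a^'n) set \<Rightarrow> ('a^'n) set" where
  "hut b K = (\<Union>i<M. (\<lambda>x. T i *v x + b i) ` K)"

lemma hut_mono: "K \<subseteq> L \<Longrightarrow> hut b K \<subseteq> hut b L"
  unfolding hut_def by blast

lemma hut_compact: assumes "compact K" shows "compact (hut b K)"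
  unfolding hut_def
proof (rule compact_UN)
  fix i assume "i \<in> {..<M}"
  then have i: "i < M" by simp
  have "(real CARD('n))-lipschitz_on K (\<lambda>x. T i *v x + b i)"
  proof (rule lipschitz_onI)
    fix x y
    have "dist (T i *v x + b i) (T i *v y + b i) \<le> real CARD('n) * vnorm av (T i *v (x - y))"
      using dist_le_vnorm[of "T i *v x + b i" "T i *v y + b i"] by (simp add: matrix_vector_mult_diff_distrib)
    also have "\<dots> \<le> real CARD('n) * dist x y"
      using order_trans[OF vnorm_T_le_self[OF i] vnorm_le_dist] by (intro mult_left_mono) auto
    finally show "dist (T i *v x + b i) (T i *v y + b i) \<le> real CARD('n) * dist x y" .
  qed simp
  then have "continuous_on K (\<lambda>x. T i *v x + b i)" by (rule lipschitz_on_continuous_on)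
  then show "compact ((\<lambda>x. T i *v x + b i) ` K)" using assms by (rule compact_continuous_image)
qed simp

lemma hut_iterate: assumes "K = hut b K" shows "K = (\<Union>w\<in>words M r. S b w ` K)"
proof (induction r)
  case (Suc r)
  have "words M (Suc r) = (\<Union>i<M. (#) i ` words M r)"
    by (auto simp: words_def length_Suc_conv)
  then have "(\<Union>w\<in>words M (Suc r). S b w ` K) = hut b (\<Union>w\<in>words M r. S b w ` K)"
    unfolding hut_def by auto
  also have "\<dots> = K" using Suc.IH assms by simp
  finally show ?case by simp
qed simp

text \<open>In both directions this gives uniqueness. A point of \<open>K\<close> is
  \<open>S b w y\<close> for a long word \<open>w\<close>; replacing \<open>y\<close> by a point of
  \<open>L\<close> gives a point of \<open>L\<close> within \<open>lam ^ r\<close> times a fixed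
  constant.\<close>

lemma attractor_subset:
  assumes K: "K = hut b K" "compact K" and L: "L = hut b L" "compact L" "L \<noteq> {}"
  shows "K \<subseteq> L"
proof
  fix x assume x: "x \<in> K"
  obtain a where a: "0 < a" "\<And>y. y \<in> K \<Longrightarrow> vnorm av y \<le> a" by (rule compact_imp_vnorm_bounded[OF K(2)]) (rule that)
  obtain c where c: "0 < c" "\<And>y. y \<in> L \<Longrightarrow> vnorm av y \<le> c" by (rule compact_imp_vnorm_bounded[OF L(2)]) (rule that)
  obtain z where z: "z \<in> L" using L(3) by blast
  show "x \<in> L"
  proof (rule closed_vnorm_approachable[OF compact_imp_closed[OF L(2)]])
    fix e :: real assume e: "e > 0"
    obtain r where r: "lam ^ r < e / max a c"
      using real_arch_pow_inv[of "e / max a c" lam] e a lam_less_1 by auto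
    obtain w y where w: "w \<in> words M r" "y \<in> K" "x = S b w y"
      using x hut_iterate[OF K(1), of r] by blast
    have "S b w z \<in> L" using hut_iterate[OF L(1), of r] w z by blast
    moreover have "vnorm av (x - S b w z) \<le> lam ^ r * max a c"
    proof -
      have "vnorm av (y - z) \<le> max a c" using a(2)[OF w(2)] c(2)[OF z] by (intro vnorm_diff_le) auto
      then show ?thesis
        unfolding w(3) using vnorm_S_diff[OF w(1), of b y z] lam_pos
        by (meson mult_left_mono order_trans zero_le_power less_imp_le)
    qed
    moreover have "lam ^ r * max a c \<le> e" using r a by (simp add: less_divide_eq less_imp_le)
    ultimately show "\<exists>y\<in>L. vnorm av (x - y) \<le> e" by (meson order_trans)
  qed
qed

text \<open>By the ultrametric inequality the ball of radius \<open>a\<close> is mapped into itself,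
  since the linear image and \<open>b i\<close> both lie in it. The attractor is the intersection of
  the iterates of this ball and so inherits the bound \<open>a\<close>.\<close>

lemma attractor_exists:
  assumes a: "\<And>i. i < M \<Longrightarrow> vnorm av (b i) \<le> a"
  obtains K where "K \<noteq> {}" "compact K" "K = hut b K" "\<And>x. x \<in> K \<Longrightarrow> vnorm av x \<le> a"
proof -
  define F where "F r = (hut b ^^ r) {x. vnorm av x \<le> a}" for r
  have a0: "0 \<le> a" using a[of 0] M_ge_2 vnorm_nonneg order_trans by (metis less_le_trans zero_less_numeral)
  have F0: "F 0 = {x. vnorm av x \<le> a}" and FS: "F (Suc r) = hut b (F r)" for r
    by (simp_all add: F_def)
  have comp: "compact (F r)" for r
    by (induction r) (auto simp: F0 FS compact_vnorm_ball hut_compact)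
  have ne: "F r \<noteq> {}" for r
  proof (induction r)
    case 0
    have "0 \<in> F 0" using a0 by (simp add: F0)
    then show ?case by blast
  next
    case (Suc r)
    moreover have "0 \<in> {..<M}" using M_ge_2 by simp
    ultimately show ?case unfolding FS hut_def by blast
  qed
  have dec: "F (Suc r) \<subseteq> F r" for r
  proof (induction r)
    case 0
    show ?case unfolding FS F0 hut_def
      using a vnorm_T_le_self by (auto intro!: vnorm_add_le intro: order_trans)
  next
    case (Suc r)
    then show ?case using hut_mono FS by metis
  qed
  have anti: "F n \<subseteq> F m" if "m \<le> n" for m n
    using lift_Suc_antimono_le[of F, OF dec that] .
  define K where "K = (\<Inter>r. F r)"
  have "F 0 \<inter> (\<Inter>r\<in>UNIV. F r) \<noteq> {}"
  proof (rule compact_imp_fip_image[OF comp])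
    show "closed (F r)" for r using comp compact_imp_closed by blast
    fix I :: "nat set" assume "finite I"
    then obtain k where "\<And>i. i \<in> I \<Longrightarrow> i \<le> k" using finite_nat_set_iff_bounded_le by auto
    then have "F k \<subseteq> F 0 \<inter> (\<Inter>i\<in>I. F i)" using anti by blast
    then show "F 0 \<inter> (\<Inter>i\<in>I. F i) \<noteq> {}" using ne by blast
  qed
  then have "K \<noteq> {}" unfolding K_def by blast
  moreover have "compact K"
  proof -
    have "K = F 0 \<inter> K" unfolding K_def by blast
    moreover have "closed K" unfolding K_def using comp compact_imp_closed by blast
    ultimately show ?thesis using compact_Int_closed[OF comp, of K 0] by simp
  qed
  moreover have "K = hut b K"
  proof
    have "hut b K \<subseteq> F (Suc r)" for r unfolding FS by (rule hut_mono) (auto simp: K_def)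
    then have "hut b K \<subseteq> F r" for r using dec by blast
    then show "hut b K \<subseteq> K" unfolding K_def by blast
    show "K \<subseteq> hut b K"
    proof
      fix x assume x: "x \<in> K"
      \<comment> \<open>Finitely many maps and a decreasing sequence of sets: if each
        \<open>i\<close> failed at some \<open>R i\<close>, all would fail at the largest of these
        stages.\<close>
      have "\<exists>i<M. \<forall>r. \<exists>y\<in>F r. x = T i *v y + b i"
      proof (rule ccontr)
        assume "\<not> ?thesis"
        then obtain R where R: "\<And>i. i < M \<Longrightarrow> \<not> (\<exists>y\<in>F (R i). x = T i *v y + b i)" by metis
        define r where "r = Max (R ` {..<M})"
        have "x \<in> hut b (F r)" using x unfolding K_def FS[symmetric] by blast
        then obtain i y where i: "i < M" "y \<in> F r" "x = T i *v y + b i" unfolding hut_def by blast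
        have "R i \<le> r" unfolding r_def using i by (intro Max_ge) auto
        then show False using R[OF i(1)] i anti by blast
      qed
      then obtain i f where i: "i < M" "\<And>r. f r \<in> F r" "\<And>r. x = T i *v f r + b i" by metis
      \<comment> \<open>\<open>T i\<close> is injective, so the preimages at all stages are one
        point, which then lies in the intersection.\<close>
      have inj: "f r = f 0" for r
      proof -
        have "T i *v f r + b i = T i *v f 0 + b i" using i(3) by metis
        then have "T i *v (f r - f 0) = 0" by (simp add: matrix_vector_mult_diff_distrib)
        then have "vnorm av (f r - f 0) \<le> 0"
          using low_T[OF i(1), of "f r - f 0"] low_pos by (simp add: mult_le_0_iff)
        then show ?thesis using vnorm_nonneg[of "f r - f 0"] vnorm_eq_0_iff[of "f r - f 0"] by (metis antisym eq_iff_diff_eq_0)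
      qed
      have "f 0 \<in> F r" for r using i(2)[of r] inj[of r] by simp
      then have "f 0 \<in> K" unfolding K_def by blast
      then show "x \<in> hut b K" unfolding hut_def using i(1) i(3)[of 0] by blast
    qed
  qed
  moreover have "vnorm av x \<le> a" if "x \<in> K" for x
  proof -
    have "x \<in> F 0" using that unfolding K_def by blast
    then show ?thesis by (simp add: F0)
  qed
  ultimately show ?thesis using that by blast
qed

abbreviation K :: "(nat \<Rightarrow> 'a^'n) \<Rightarrow> ('a^'n) set" where "K b \<equiv> self_affine_set T M b"

lemma attractor_unique: assumes "L \<noteq> {}" "compact L" "L = hut b L" shows "K b = L"
  unfolding self_affine_set_def
proof (rule the_equality, unfold hut_def[symmetric])
  show "L \<noteq> {} \<and> compact L \<and> L = hut b L" using assms by blast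
  fix L' assume "L' \<noteq> {} \<and> compact L' \<and> L' = hut b L'"
  then have "L' \<subseteq> L" "L \<subseteq> L'"
    using attractor_subset[of L' b L] attractor_subset[of L b L'] assms by blast+
  then show "L' = L" by blast
qed

lemma attractor: "K b \<noteq> {}" "compact (K b)" "K b = hut b (K b)"
proof -
  have "vnorm av (b i) \<le> Max ((\<lambda>i. vnorm av (b i)) ` {..<M})" if "i < M" for i
    using that by (intro Max_ge) auto
  then obtain L where "L \<noteq> {}" "compact L" "L = hut b L" using attractor_exists[of b] by metis
  moreover then have "K b = L" by (rule attractor_unique)
  ultimately show "K b \<noteq> {}" "compact (K b)" "K b = hut b (K b)" by simp_all
qed

lemma attractor_bound:
  assumes "\<And>i. i < M \<Longrightarrow> vnorm av (b i) \<le> a" "x \<in> K b"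
  shows "vnorm av x \<le> a"
proof -
  obtain L where L: "L \<noteq> {}" "compact L" "L = hut b L" "\<And>x. x \<in> L \<Longrightarrow> vnorm av x \<le> a"
    by (rule attractor_exists[of b a, OF assms(1)]) (assumption, rule that)
  then show ?thesis using attractor_unique[OF L(1-3)] assms(2) by simp
qed

lemma vbounded_K: "vbounded (K b)"
  by (rule compact_imp_vnorm_bounded[OF attractor(2)[of b]]) (auto simp: vbounded_def)

subsection \<open>The upper bound\<close>

text \<open>The attractor is the union of its images under words of length \<open>r\<close>. Under
  \<open>word_map T w\<close> a ball of radius \<open>v / \<alpha> w\<close> becomes a set that the
  product counts in balls of radius \<open>v\<close>; the scale \<open>\<alpha> w\<close> is free
  for each word.\<close>

lemma cover_number_K_step:
  assumes v: "v \<in> vgrp" and \<alpha>: "\<And>w. w \<in> words M r \<Longrightarrow> \<alpha> w \<in> vgrp"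
  shows "real (cover_number (vdist av) v (K b)) \<le>
    (\<Sum>w\<in>words M r. real (cover_number (vdist av) (v / \<alpha> w) (K b)) * (\<Prod>i<CARD('n). max 1 (sval (word_map T w) i / \<alpha> w)))"
proof -
  let ?N = "\<lambda>v. cover_number (vdist av) v (K b)"
  have v0: "0 < v" using vgrp_pos v by blast
  have "\<exists>R. finite R \<and> (\<forall>x\<in>K b. \<exists>y\<in>R. vnorm av (S b w x - y) \<le> v) \<and>
     real (card R) \<le> real (?N (v / \<alpha> w)) * (\<Prod>i<CARD('n). max 1 (sval (word_map T w) i / \<alpha> w))"
    if w: "w \<in> words M r" for w
  proof -
    have \<alpha>0: "0 < \<alpha> w" and v\<alpha>: "v / \<alpha> w \<in> vgrp" "0 < v / \<alpha> w"
      using vgrp_pos \<alpha>[OF w] v vgrp_divide v0 by auto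
    obtain R1 where R1: "finite R1" "card R1 \<le> ?N (v / \<alpha> w)" "\<And>x. x \<in> K b \<Longrightarrow> \<exists>y\<in>R1. vnorm av (x - y) \<le> v / \<alpha> w"
      by (rule cover_number_net[OF vbounded_K v\<alpha>(2)]) (rule that)
    obtain R2 where R2: "net v ((*v) (word_map T w) ` {x. vnorm av x \<le> v / \<alpha> w}) R2"
      "real (card R2) = (\<Prod>i<CARD('n). max 1 (v / \<alpha> w * sval (word_map T w) i / v))"
      using net_image[OF det_words[OF w] v\<alpha>(1) v] .
    have f2: "finite R2" using R2(1) unfolding net_def by blast
    let ?R = "(\<lambda>(y, z). S b w y + z) ` (R1 \<times> R2)"
    have "\<exists>y\<in>?R. vnorm av (S b w x - y) \<le> v" if x: "x \<in> K b" for x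
    proof -
      obtain y where y: "y \<in> R1" "vnorm av (x - y) \<le> v / \<alpha> w" using R1(3)[OF x] by blast
      then obtain z where z: "z \<in> R2" "vnorm av (word_map T w *v (x - y) - z) \<le> v"
        using R2(1) unfolding net_def by blast
      have "vnorm av (S b w x - (S b w y + z)) \<le> v"
        using z(2) unfolding S_diff[of b w x y, symmetric] by (simp add: algebra_simps)
      then show ?thesis using y z by force
    qed
    moreover have "real (card ?R) \<le> real (?N (v / \<alpha> w)) * (\<Prod>i<CARD('n). max 1 (sval (word_map T w) i / \<alpha> w))"
    proof -
      have "card ?R \<le> card R1 * card R2"
        using card_image_le[of "R1 \<times> R2" "\<lambda>(y, z). S b w y + z"] R1(1) f2 by (simp add: card_cartesian_product)
      then have "real (card ?R) \<le> real (card R1) * real (card R2)" by (metis of_nat_le_iff of_nat_mult)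
      also have "\<dots> \<le> real (?N (v / \<alpha> w)) * real (card R2)" using R1(2) by (intro mult_right_mono) auto
      finally show ?thesis unfolding R2(2) using v0 by simp
    qed
    ultimately show ?thesis using R1(1) f2 by (intro exI[of _ ?R]) auto
  qed
  then obtain R where R: "\<And>w. w \<in> words M r \<Longrightarrow> finite (R w)"
    "\<And>w x. w \<in> words M r \<Longrightarrow> x \<in> K b \<Longrightarrow> \<exists>y\<in>R w. vnorm av (S b w x - y) \<le> v"
    "\<And>w. w \<in> words M r \<Longrightarrow> real (card (R w)) \<le> real (?N (v / \<alpha> w)) * (\<Prod>i<CARD('n). max 1 (sval (word_map T w) i / \<alpha> w))"
    by metis
  have "?N v \<le> card (\<Union>w\<in>words M r. R w)"
  proof (rule cover_number_le)
    show "finite (\<Union>w\<in>words M r. R w)" using R(1) by simp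
    fix x assume "x \<in> K b"
    then obtain w y where "w \<in> words M r" "y \<in> K b" "x = S b w y"
      using hut_iterate[OF attractor(3), of b r] by blast
    then show "\<exists>y\<in>(\<Union>w\<in>words M r. R w). vnorm av (x - y) \<le> v" using R(2) by blast
  qed
  also have "\<dots> \<le> (\<Sum>w\<in>words M r. card (R w))" by (rule card_UN_le) simp
  finally have "real (?N v) \<le> (\<Sum>w\<in>words M r. real (card (R w)))" by (metis of_nat_le_iff of_nat_sum)
  also have "\<dots> \<le> (\<Sum>w\<in>words M r. real (?N (v / \<alpha> w)) * (\<Prod>i<CARD('n). max 1 (sval (word_map T w) i / \<alpha> w)))"
    by (intro sum_mono R(3))
  finally show ?thesis .
qed

text \<open>With \<open>\<alpha> w\<close> the radius at which the covering formula for
  \<open>sv_fun\<close> is an equality, one pass of \<open>cover_number_K_step\<close> multiplies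
  the bound by \<open>sv_sum s r \<le> 1\<close>, so the constant never grows.\<close>

lemma upper_box_dim_K_le_aux:
  assumes s: "d < s" "s \<le> real CARD('n)"
  shows "upper_box_dim (vdist av) (K b) \<le> ereal s"
proof -
  let ?N = "\<lambda>v. real (cover_number (vdist av) v (K b))"
  have s0: "0 < s" using affinity_dim_root s by simp
  obtain r where r: "0 < r" "sv_sum s r \<le> 1" using sv_sum_le_1[OF s(1)] by blast
  have "\<exists>k<CARD('n). sv_fun av s (word_map T w) = sval (word_map T w) k powr s *
      (\<Prod>i<CARD('n). max 1 (sval (word_map T w) i / sval (word_map T w) k))" if "w \<in> words M r" for w
    using sv_fun_eq_cover[OF det_words[OF that] s0 s(2)] by metis
  then obtain k where k: "\<And>w. w \<in> words M r \<Longrightarrow> k w < CARD('n)"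
    "\<And>w. w \<in> words M r \<Longrightarrow> sv_fun av s (word_map T w) = sval (word_map T w) (k w) powr s *
      (\<Prod>i<CARD('n). max 1 (sval (word_map T w) i / sval (word_map T w) (k w)))"
    by metis
  define \<alpha> where "\<alpha> w = sval (word_map T w) (k w)" for w
  have \<alpha>: "\<alpha> w \<in> vgrp" "low ^ r \<le> \<alpha> w" "\<alpha> w \<le> lam ^ r" if "w \<in> words M r" for w
    unfolding \<alpha>_def using sval_vgrp[OF det_words[OF that] k(1)[OF that]] sval_word_bounds[OF that k(1)[OF that]] by auto
  \<comment> \<open>For \<open>v < 1\<close> the quotient \<open>v / \<alpha> w\<close> may exceed
    1, but not \<open>1 / low ^ r\<close>; the induction therefore has to include radii up to
    \<open>\<Delta>\<close>.\<close>
  define \<Delta> where "\<Delta> = 1 / low ^ r"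
  have \<Delta>: "0 < \<Delta>" unfolding \<Delta>_def using low_pos by simp
  \<comment> \<open>Makes the bound true for \<open>1 \<le> v \<le> \<Delta>\<close>, where the
    covering number is at most that of radius 1.\<close>
  define C where "C = ?N 1 * \<Delta> powr s"
  have N1: "1 \<le> ?N 1" using cover_number_pos[OF vbounded_K _ attractor(1), of 1] by (simp add: Suc_leI)
  have C: "0 < C" unfolding C_def using N1 \<Delta> by simp
  have big: "?N v \<le> C * v powr (- s)" if v: "1 \<le> v" "v \<le> \<Delta>" for v
  proof -
    have "?N v \<le> ?N 1 * 1" using cover_number_antimono[OF vbounded_K _ v(1)] by simp
    also have "\<dots> \<le> ?N 1 * (\<Delta> powr s * v powr (- s))"
    proof (rule mult_left_mono)
      have "v powr s \<le> \<Delta> powr s" using v s0 by (intro powr_mono2) auto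
      then show "1 \<le> \<Delta> powr s * v powr (- s)" using v by (simp add: powr_minus_divide le_divide_eq)
    qed simp
    finally show ?thesis unfolding C_def by (simp add: mult.assoc)
  qed
  \<comment> \<open>Each step descends by a factor \<open>lam ^ r\<close>: division by
    \<open>\<alpha> w \<le> lam ^ r\<close> takes \<open>v\<close> back to the range already
    treated.\<close>
  have "?N v \<le> C * v powr (- s)" if "v \<in> vgrp" "(lam ^ r) ^ j \<le> v" "v \<le> \<Delta>" for j v
    using that
  proof (induction j arbitrary: v)
    case 0
    then show ?case using big by simp
  next
    case (Suc j)
    show ?case
    proof (cases "1 \<le> v")
      case True
      then show ?thesis using big Suc.prems by simp
    next
      case False
      have v0: "0 < v" using vgrp_pos Suc.prems by blast
      have IH: "?N (v / \<alpha> w) \<le> C * (v / \<alpha> w) powr (- s)" if w: "w \<in> words M r" for w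
      proof (rule Suc.IH)
        have \<alpha>0: "0 < \<alpha> w" using vgrp_pos \<alpha>(1)[OF w] by blast
        show "v / \<alpha> w \<in> vgrp" using vgrp_divide Suc.prems(1) \<alpha>(1)[OF w] by blast
        have "(lam ^ r) ^ j * \<alpha> w \<le> (lam ^ r) ^ j * lam ^ r"
          using \<alpha>(3)[OF w] lam_pos by (intro mult_left_mono) auto
        also have "\<dots> \<le> v" using Suc.prems(2) by (simp add: mult.commute)
        finally show "(lam ^ r) ^ j \<le> v / \<alpha> w" using \<alpha>0 by (simp add: le_divide_eq)
        have "v / \<alpha> w \<le> 1 / low ^ r"
          using False \<alpha>(2)[OF w] low_pos v0 by (intro frac_le) auto
        then show "v / \<alpha> w \<le> \<Delta>" unfolding \<Delta>_def .
      qed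
      have "?N v \<le> (\<Sum>w\<in>words M r. ?N (v / \<alpha> w) * (\<Prod>i<CARD('n). max 1 (sval (word_map T w) i / \<alpha> w)))"
        using cover_number_K_step[of v r \<alpha> b] Suc.prems(1) \<alpha>(1) by blast
      also have "\<dots> \<le> (\<Sum>w\<in>words M r. C * v powr (- s) * sv_fun av s (word_map T w))"
      proof (rule sum_mono)
        fix w assume w: "w \<in> words M r"
        have \<alpha>0: "0 < \<alpha> w" using vgrp_pos \<alpha>(1)[OF w] by blast
        have "?N (v / \<alpha> w) * (\<Prod>i<CARD('n). max 1 (sval (word_map T w) i / \<alpha> w)) \<le>
          C * (v / \<alpha> w) powr (- s) * (\<Prod>i<CARD('n). max 1 (sval (word_map T w) i / \<alpha> w))"
          by (intro mult_right_mono IH[OF w] prod_nonneg) auto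
        also have "(v / \<alpha> w) powr (- s) = v powr (- s) * \<alpha> w powr s"
          using v0 \<alpha>0 by (simp add: powr_divide powr_minus_divide)
        finally show "?N (v / \<alpha> w) * (\<Prod>i<CARD('n). max 1 (sval (word_map T w) i / \<alpha> w)) \<le>
          C * v powr (- s) * sv_fun av s (word_map T w)"
          unfolding k(2)[OF w] \<alpha>_def[symmetric] by (simp add: mult.assoc)
      qed
      also have "\<dots> = C * v powr (- s) * sv_sum s r" unfolding sv_sum_def sum_distrib_left ..
      also have "\<dots> \<le> C * v powr (- s)" using r(2) C by (intro mult_left_le) auto
      finally show ?thesis .
    qed
  qed
  moreover have "\<exists>j. (lam ^ r) ^ j \<le> v" if "0 < v" for v
  proof -
    have "lam ^ r < 1" using lam_pos lam_less_1 r(1) by (simp add: power_less_one_iff)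
    then show ?thesis using real_arch_pow_inv[OF that, of "lam ^ r"] less_imp_le by blast
  qed
  moreover have "1 \<le> \<Delta>"
  proof -
    obtain w where w: "w \<in> words M r" using words_ne by blast
    have "low ^ r \<le> lam ^ r" using \<alpha>[OF w] by simp
    also have "\<dots> \<le> 1" using lam_pos lam_less_1 by (simp add: power_le_one)
    finally show ?thesis unfolding \<Delta>_def using low_pos by simp
  qed
  ultimately have "?N v \<le> C * v powr (- s)" if "v \<in> vgrp" "v \<le> 1" for v
    using that vgrp_pos by (meson order_trans)
  then show ?thesis
    using upper_box_dim_le[OF vbounded_K attractor(1) less_imp_le[OF s0] C] by blast
qed

lemma upper_box_dim_K_le: "upper_box_dim (vdist av) (K b) \<le> ereal (min (real CARD('n)) d)"
proof -
  note n = upper_box_dim_le_dimension[OF vbounded_K attractor(1), of b]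
  show ?thesis
  proof (cases "d < real CARD('n)")
    case True
    have "upper_box_dim (vdist av) (K b) \<le> ereal d"
    proof (rule ccontr)
      assume "\<not> ?thesis"
      then obtain s where s: "ereal d < ereal s" "ereal s < upper_box_dim (vdist av) (K b)"
        using ereal_dense2 by (metis not_le)
      \<comment> \<open>The trivial bound by the dimension of the space keeps \<open>s\<close> in
        the range of the covering description.\<close>
      then have "s \<le> real CARD('n)" using n by (metis ereal_less_eq(3) less_imp_le order_trans)
      then show False using upper_box_dim_K_le_aux[of s b] s by auto
    qed
    then show ?thesis using True by (simp add: min_def)
  qed (use n in \<open>simp add: min_def\<close>)
qed

end

subsection \<open>Flows on the tree of words\<close>

text \<open>The capacity of a minimal cut of depth at most \<open>k\<close> below \<open>p\<close>.\<close>

primrec cut_value :: "nat \<Rightarrow> (nat list \<Rightarrow> real) \<Rightarrow> nat \<Rightarrow> nat list \<Rightarrow> real" where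
  "cut_value M \<phi> 0 p = \<phi> p"
| "cut_value M \<phi> (Suc k) p = min (\<phi> p) (\<Sum>i<M. cut_value M \<phi> k (p @ [i]))"

text \<open>The cut values \<open>?G k p\<close> decrease to \<open>F p\<close>, which is at most
  the sum over the children; splitting the mass at each word in proportion to \<open>F\<close>
  therefore keeps \<open>\<nu> \<le> F \<le> \<phi>\<close>. The crux is that no cut below the root
  has capacity less than 1.\<close>

lemma flow_exists:
  fixes \<phi> :: "nat list \<Rightarrow> real"
  assumes nonneg: "\<And>w. set w \<subseteq> {..<M} \<Longrightarrow> 0 \<le> \<phi> w"
    and submult: "\<And>u v. set u \<subseteq> {..<M} \<Longrightarrow> set v \<subseteq> {..<M} \<Longrightarrow> \<phi> (u @ v) \<le> \<phi> u * \<phi> v"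
    and unbounded: "\<And>B. \<exists>r. B < (\<Sum>w\<in>words M r. \<phi> w)"
  obtains \<nu> :: "nat list \<Rightarrow> real" where "\<nu> [] = 1" "\<And>w. set w \<subseteq> {..<M} \<Longrightarrow> 0 \<le> \<nu> w"
    "\<And>w. set w \<subseteq> {..<M} \<Longrightarrow> \<nu> w \<le> \<phi> w" "\<And>w. set w \<subseteq> {..<M} \<Longrightarrow> (\<Sum>i<M. \<nu> (w @ [i])) = \<nu> w"
proof -
  let ?G = "cut_value M \<phi>"
  let ?Z = "\<lambda>r. \<Sum>w\<in>words M r. \<phi> w"
  have G_nonneg: "0 \<le> ?G k p" if "set p \<subseteq> {..<M}" for k p
    using that by (induction k arbitrary: p) (auto simp: nonneg intro!: sum_nonneg)
  have G_le: "?G k p \<le> \<phi> p" for k p by (cases k) auto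
  have G_dec: "?G (Suc k) p \<le> ?G k p" for k p
  proof (induction k arbitrary: p)
    case (Suc k)
    have "(\<Sum>i<M. ?G (Suc k) (p @ [i])) \<le> (\<Sum>i<M. ?G k (p @ [i]))" by (intro sum_mono Suc)
    then show ?case by (subst (1 2) cut_value.simps(2)) (rule min.mono, simp_all del: cut_value.simps)
  qed simp
  \<comment> \<open>Every word of length \<open>N\<close> below \<open>p\<close> passes through a
    minimal cut of depth at most \<open>k\<close>, and below a cut word \<open>u\<close> the level
    sum is at most \<open>\<phi> u * B\<close> by submultiplicativity.\<close>
  have key: "(\<Sum>w\<in>words M N. \<phi> (p @ w)) \<le> ?G k p * B"
    if "set p \<subseteq> {..<M}" "k \<le> N" "\<And>j. j \<le> N \<Longrightarrow> ?Z j \<le> B" for k N p B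
    using that
  proof (induction k arbitrary: N p)
    case 0
    have "(\<Sum>w\<in>words M N. \<phi> (p @ w)) \<le> (\<Sum>w\<in>words M N. \<phi> p * \<phi> w)"
      using 0 by (intro sum_mono submult) (auto simp: words_def)
    also have "\<dots> = \<phi> p * ?Z N" by (simp add: sum_distrib_left)
    also have "\<dots> \<le> \<phi> p * B" using 0 nonneg by (intro mult_left_mono) auto
    finally show ?case by simp
  next
    case (Suc k)
    then obtain N' where N': "N = Suc N'" by (cases N) auto
    have "(\<Sum>w\<in>words M N. \<phi> (p @ w)) \<le> (\<Sum>w\<in>words M N. \<phi> p * \<phi> w)"
      using Suc by (intro sum_mono submult) (auto simp: words_def)
    also have "\<dots> = \<phi> p * ?Z N" by (simp add: sum_distrib_left)
    also have "\<dots> \<le> \<phi> p * B" using Suc nonneg by (intro mult_left_mono) auto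
    finally have 1: "(\<Sum>w\<in>words M N. \<phi> (p @ w)) \<le> \<phi> p * B" .
    have "(\<Sum>w\<in>words M N. \<phi> (p @ w)) = (\<Sum>i<M. \<Sum>w\<in>words M N'. \<phi> ((p @ [i]) @ w))"
      unfolding N' by (subst sum_words_Cons) simp
    also have "\<dots> \<le> (\<Sum>i<M. ?G k (p @ [i]) * B)"
      using Suc.prems N' by (intro sum_mono Suc.IH) auto
    also have "\<dots> = (\<Sum>i<M. ?G k (p @ [i])) * B" by (simp add: sum_distrib_right)
    finally show ?case using 1 by (simp add: min_def)
  qed
  have G_root: "1 \<le> ?G k []" for k
  proof -
    \<comment> \<open>\<open>N\<close> is the first level whose sum exceeds the total of those up to
      \<open>k\<close>. So \<open>k < N\<close>, and its sum exceeds all earlier level sums, which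
      allows \<open>?Z N\<close> as the bound \<open>B\<close> in \<open>key\<close>.\<close>
    let ?B = "\<Sum>j\<le>k. \<bar>?Z j\<bar>"
    define N where "N = (LEAST r. ?B < ?Z r)"
    have N: "?B < ?Z N" unfolding N_def using unbounded[of ?B] by (rule LeastI_ex)
    have less: "?Z j \<le> ?B" if "j < N" for j
      using not_less_Least[of j "\<lambda>r. ?B < ?Z r"] that unfolding N_def[symmetric] by simp
    have small: "?Z j \<le> ?B" if "j \<le> k" for j
      using member_le_sum[of j "{..k}" "\<lambda>j. \<bar>?Z j\<bar>"] that by auto
    have "k < N" using small N by (meson not_le)
    have "?Z N \<le> ?G k [] * ?Z N"
    proof (rule order_trans[OF _ key[of "[]" k N "?Z N"]])
      show "?Z j \<le> ?Z N" if "j \<le> N" for j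
        using less[of j] N that by (cases "j = N") auto
    qed (use \<open>k < N\<close> in auto)
    moreover have "0 \<le> ?B" by (intro sum_nonneg) auto
    then have "0 < ?Z N" using N by linarith
    ultimately show ?thesis by simp
  qed
  define F where "F p = (INF k. ?G k p)" for p
  have bdd: "bdd_below (range (\<lambda>k. ?G k p))" if "set p \<subseteq> {..<M}" for p
    by (rule bdd_belowI2[where m = 0]) (rule G_nonneg[OF that])
  have lim: "(\<lambda>k. ?G k p) \<longlonglongrightarrow> F p" if "set p \<subseteq> {..<M}" for p
    unfolding F_def using bdd[OF that] G_dec by (intro LIMSEQ_decseq_INF decseq_SucI) auto
  have F_nonneg: "0 \<le> F p" if "set p \<subseteq> {..<M}" for p
    using LIMSEQ_le_const[OF lim[OF that], of 0] G_nonneg[OF that] by blast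
  have F_le: "F p \<le> \<phi> p" if "set p \<subseteq> {..<M}" for p
    using LIMSEQ_le_const2[OF lim[OF that], of "\<phi> p"] G_le by blast
  have F_root: "1 \<le> F []"
    using LIMSEQ_le_const[OF lim[of "[]"], of 1] G_root by auto
  have F_sum: "F p \<le> (\<Sum>i<M. F (p @ [i]))" if "set p \<subseteq> {..<M}" for p
  proof (rule LIMSEQ_le[OF LIMSEQ_Suc[OF lim[OF that]]])
    show "(\<lambda>k. \<Sum>i<M. ?G k (p @ [i])) \<longlonglongrightarrow> (\<Sum>i<M. F (p @ [i]))"
      using that by (intro tendsto_sum lim) auto
  qed auto
  \<comment> \<open>Mass 1 starts at the root. If \<open>F\<close> vanishes on all children of
    \<open>w\<close>, the quotient is 0 by convention, and then \<open>\<nu> w = 0\<close> as well,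
    because \<open>\<nu> w \<le> F w\<close> and by \<open>F_sum\<close>.\<close>
  define \<nu> where "\<nu> w = (\<Prod>j<length w. F (take (Suc j) w) / (\<Sum>i<M. F (take j w @ [i])))" for w
  have nu_snoc: "\<nu> (w @ [i]) = \<nu> w * (F (w @ [i]) / (\<Sum>i<M. F (w @ [i])))" for w i
    unfolding \<nu>_def by simp
  have bounds: "0 \<le> \<nu> w \<and> \<nu> w \<le> F w" if "set w \<subseteq> {..<M}" for w
    using that
  proof (induction w rule: rev_induct)
    case Nil
    then show ?case using F_root by (simp add: \<nu>_def)
  next
    case (snoc i w)
    let ?S = "\<Sum>i<M. F (w @ [i])"
    have w: "set w \<subseteq> {..<M}" and IH: "0 \<le> \<nu> w" "\<nu> w \<le> ?S" using snoc F_sum[of w] by auto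
    have F0: "0 \<le> F (w @ [i])" using F_nonneg snoc by blast
    have "\<nu> w / ?S \<le> 1" using IH by (cases "?S = 0") (auto simp: divide_le_eq_1)
    then have "\<nu> w / ?S * F (w @ [i]) \<le> F (w @ [i])" using F0 IH by (intro mult_left_le_one_le) auto
    moreover have "0 \<le> \<nu> w / ?S * F (w @ [i])" using F0 IH by simp
    ultimately show ?case unfolding nu_snoc by simp
  qed
  have add: "(\<Sum>i<M. \<nu> (w @ [i])) = \<nu> w" if "set w \<subseteq> {..<M}" for w
  proof -
    let ?S = "\<Sum>i<M. F (w @ [i])"
    have "(\<Sum>i<M. \<nu> (w @ [i])) = \<nu> w * (?S / ?S)"
      unfolding nu_snoc sum_distrib_left[symmetric] sum_divide_distrib[symmetric] ..
    moreover have "\<nu> w = 0" if "?S = 0"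
      using bounds[OF \<open>set w \<subseteq> {..<M}\<close>] F_sum[OF \<open>set w \<subseteq> {..<M}\<close>] that by simp
    ultimately show ?thesis by (cases "?S = 0") auto
  qed
  show ?thesis
  proof (rule that[of \<nu>])
    show "\<nu> w \<le> \<phi> w" if "set w \<subseteq> {..<M}" for w
      using bounds[OF that] F_le[OF that] by linarith
  qed (use bounds add in \<open>auto simp: \<nu>_def[of "[]"]\<close>)
qed

context nonarch
begin

section \<open>Balls whose radii are negative powers of \<open>q\<close>\<close>

definition rad :: "nat \<Rightarrow> real" where
  "rad k = (1 / q) ^ k"

lemma rad_powi: "rad k = q powi (- int k)"
  by (simp add: rad_def power_int_minus power_one_over inverse_eq_divide)

lemma rad_vgrp [simp]: "rad k \<in> vgrp"
  by (simp add: rad_powi)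

lemma rad_pos [simp]: "0 < rad k"
  by (simp add: rad_def)

lemma rad_nonneg [simp]: "0 \<le> rad k"
  by (simp add: rad_def)

lemma rad_0 [simp]: "rad 0 = 1"
  by (simp add: rad_def)

lemma rad_le_1: "rad k \<le> 1"
  unfolding rad_def using q_ge_2 by (intro power_le_one) auto

lemma vgrp_le_1_rad: assumes "v \<in> vgrp" "v \<le> 1" obtains k where "v = rad k"
proof -
  obtain j where j: "v = q powi j" using assms unfolding vgrp_def by auto
  have "j \<le> 0"
  proof (rule ccontr)
    assume "\<not> j \<le> 0"
    then have "q powi 1 \<le> q powi j" using q_ge_2 by (intro power_int_increasing) auto
    then show False using assms j q_ge_2 by simp
  qed
  then have "j = - int (nat (- j))" by simp
  then show ?thesis using that[of "nat (- j)"] j rad_powi by metis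
qed

lemma rad_small: assumes "0 < e" "0 < t" obtains k where "rad k powr t \<le> e"
proof -
  obtain v where v: "v \<in> vgrp" "v \<le> min 1 (e powr (1 / t))" "min 1 (e powr (1 / t)) < q * v"
    by (rule vgrp_below[of "min 1 (e powr (1 / t))"]) (use assms in auto)
  obtain k where k: "v = rad k" using vgrp_le_1_rad[OF v(1)] v(2) by auto
  have "rad k powr t \<le> (e powr (1 / t)) powr t" using v(2) k assms by (intro powr_mono2) auto
  then show ?thesis using that assms by (simp add: powr_powr)
qed

text \<open>Discreteness turns the diameter into a radius: norms below \<open>q * v\<close> are at
  most \<open>v\<close>. A set of diameter 0 takes a tiny ball, which accounts for \<open>e\<close>;
  the exponent drops from \<open>t\<close> to \<open>s\<close> because radii are at most 1.\<close>

lemma covered_by_ball: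
  assumes "\<And>x y. x \<in> U \<Longrightarrow> y \<in> U \<Longrightarrow> vdist av x y \<le> (1::real)" "0 < s" "s \<le> t" "0 < e"
  obtains k c where "\<And>x. x \<in> U \<Longrightarrow> vnorm av (x - c :: 'a^'n) \<le> rad k" "rad k powr t \<le> gdiam (vdist av) U powr s + e"
proof -
  let ?g = "gdiam (vdist av) U"
  note g = gdiam_bounds[of U 1, OF assms(1), simplified]
  show ?thesis
  proof (cases "?g = 0")
    case True
    obtain k where k: "rad k powr t \<le> e" using rad_small[of e t] assms by auto
    have "vnorm av (x - (SOME y. y \<in> U)) \<le> rad k" if "x \<in> U" for x
    proof -
      have "(SOME y. y \<in> U) \<in> U" using that by (meson someI_ex)
      then have "vnorm av (x - (SOME y. y \<in> U)) \<le> 0" using g(3)[OF that] True by (simp add: vdist_def)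
      then show ?thesis using rad_pos[of k] by linarith
    qed
    then show ?thesis using that[of "SOME y. y \<in> U" k] k True assms by simp
  next
    case False
    then have g0: "0 < ?g" using g(1) by simp
    obtain v where v: "v \<in> vgrp" "v \<le> ?g" "?g < q * v" using vgrp_below[OF g0] .
    obtain k where k: "v = rad k" by (rule vgrp_le_1_rad[OF v(1)]) (use v(2) g(2) in auto)
    have "vnorm av (x - (SOME y. y \<in> U)) \<le> rad k" if "x \<in> U" for x
    proof (rule ccontr)
      let ?d = "x - (SOME y. y \<in> U)"
      assume *: "\<not> vnorm av ?d \<le> rad k"
      have "(SOME y. y \<in> U) \<in> U" using that by (meson someI_ex)
      then have le: "vnorm av ?d \<le> ?g" using g(3)[OF that] by (simp add: vdist_def)
      have "?d \<noteq> 0" using * rad_pos[of k] by (metis less_imp_le vnorm_0)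
      then have "q * v \<le> vnorm av ?d" using * k by (intro vgrp_gap vnorm_in_vgrp v) auto
      then show False using le v by simp
    qed
    moreover have "rad k powr t \<le> ?g powr s + e"
    proof -
      have "rad k powr t \<le> rad k powr s" using rad_pos[of k] rad_le_1[of k] assms by (intro powr_mono') auto
      also have "\<dots> \<le> ?g powr s" using k v assms by (intro powr_mono2) (auto simp: less_imp_le)
      finally show ?thesis using assms by simp
    qed
    ultimately show ?thesis using that by blast
  qed
qed

definition vball :: "nat \<Rightarrow> 'a^'n \<Rightarrow> ('a^'n) set" where
  "vball k c = {x. vnorm av (x - c) \<le> rad k}"

text \<open>Every point of an ultrametric ball is a centre of it, so balls of equal radius coincide
  or are disjoint.\<close>

lemma vball_eq: assumes "x \<in> vball k c" "x \<in> vball k c'" shows "vball k c = vball k c'"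
proof -
  have *: "vball k c \<subseteq> vball k c'" if "x \<in> vball k c" "x \<in> vball k c'" for c c'
  proof
    fix y assume "y \<in> vball k c"
    then have "vnorm av (y - x) \<le> rad k"
      using that(1) vnorm_diff_trans[of y c "rad k" x] by (simp add: vball_def vnorm_minus_commute)
    then show "y \<in> vball k c'"
      using that(2) vnorm_diff_trans[of y x "rad k" c'] by (simp add: vball_def)
  qed
  show ?thesis using *[OF assms] *[OF assms(2,1)] by blast
qed

lemma vball_close: assumes "x \<in> vball k c" "y \<in> vball k c" shows "vnorm av (x - y) \<le> rad k"
  using vdist_ball[of x c "rad k" y] assms by (simp add: vball_def vdist_def)

lemma open_vball: "open (vball k c)"
  unfolding open_dist
proof (intro ballI exI conjI allI impI)
  fix x y assume x: "x \<in> vball k c" and y: "dist y x < rad k"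
  have "vnorm av (y - x) \<le> rad k" using vnorm_le_dist[of y x] y by linarith
  then show "y \<in> vball k c" using x vnorm_diff_trans[of y x "rad k" c] by (simp add: vball_def)
qed simp

end

context affine_system
begin

subsection \<open>Energy and Hausdorff measure\<close>

lemma sum_words_flow:
  fixes \<nu> :: "nat list \<Rightarrow> real"
  assumes add: "\<And>w. set w \<subseteq> {..<M} \<Longrightarrow> (\<Sum>i<M. \<nu> (w @ [i])) = \<nu> w" and u: "set u \<subseteq> {..<M}"
  shows "(\<Sum>v\<in>words M m. \<nu> (u @ v)) = \<nu> u"
proof (induction m)
  case (Suc m)
  have "(\<Sum>v\<in>words M (Suc m). \<nu> (u @ v)) = (\<Sum>v\<in>words M m. \<Sum>i<M. \<nu> ((u @ v) @ [i]))"
    by (subst sum_words_snoc) simp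
  also have "\<dots> = (\<Sum>v\<in>words M m. \<nu> (u @ v))"
    using u by (intro sum.cong add) (auto simp: words_def)
  finally show ?case using Suc by simp
qed simp

text \<open>The values of \<open>\<nu>\<close> behave like the masses of cylinders of a measure on
  infinite words, so a function of the first \<open>l\<close> letters has the same integral at every
  level from \<open>l\<close> on.\<close>

lemma sum_words_flow_take:
  fixes \<nu> :: "nat list \<Rightarrow> real"
  assumes add: "\<And>w. set w \<subseteq> {..<M} \<Longrightarrow> (\<Sum>i<M. \<nu> (w @ [i])) = \<nu> w" and "l \<le> L"
  shows "(\<Sum>w\<in>words M L. \<nu> w * g (take l w)) = (\<Sum>u\<in>words M l. \<nu> u * g u)"
proof -
  have "(\<Sum>w\<in>words M (l + (L - l)). \<nu> w * g (take l w)) =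
    (\<Sum>u\<in>words M l. \<Sum>v\<in>words M (L - l). \<nu> (u @ v) * g (take l (u @ v)))"
    by (rule sum_words_append)
  also have "\<dots> = (\<Sum>u\<in>words M l. \<Sum>v\<in>words M (L - l). \<nu> (u @ v) * g u)"
    by (intro sum.cong) (auto simp: words_def)
  also have "\<dots> = (\<Sum>u\<in>words M l. \<nu> u * g u)"
  proof (rule sum.cong[OF refl])
    fix u assume "u \<in> words M l"
    then have "set u \<subseteq> {..<M}" by (simp add: words_def)
    then show "(\<Sum>v\<in>words M (L - l). \<nu> (u @ v) * g u) = \<nu> u * g u"
      unfolding sum_distrib_right[symmetric] by (subst sum_words_flow[OF add]) auto
  qed
  finally show ?thesis using assms(2) by simp
qed

text \<open>Weighted by \<open>rad k powr (- t)\<close> and summed over \<open>k\<close>, this is a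
  discrete form of the \<open>t\<close>-energy of the image of \<open>\<nu>\<close> on the
  attractor.\<close>

definition pair_mass :: "(nat list \<Rightarrow> real) \<Rightarrow> (nat \<Rightarrow> 'a^'n) \<Rightarrow> nat \<Rightarrow> nat \<Rightarrow> real" where
  "pair_mass \<nu> b L k = (\<Sum>w\<in>words M L. \<Sum>w'\<in>words M L. \<nu> w * \<nu> w' * of_bool (vnorm av (S b w 0 - S b w' 0) \<le> rad k))"

lemma S_append: "S b (u @ v) x = S b u (S b v x)"
  by (induction u) auto

text \<open>By Cauchy-Schwarz, finite energy bounds the size of every cover by balls from below: no
  Frostman-type density estimate is needed.\<close>

lemma hausdorff_pre_lower_bound:
  fixes \<nu> :: "nat list \<Rightarrow> real"
  assumes nu: "\<nu> [] = 1" "\<And>w. set w \<subseteq> {..<M} \<Longrightarrow> 0 \<le> \<nu> w"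
    and add: "\<And>w. set w \<subseteq> {..<M} \<Longrightarrow> (\<Sum>i<M. \<nu> (w @ [i])) = \<nu> w"
    and b: "\<And>i. i < M \<Longrightarrow> vnorm av (b i) \<le> \<rho>"
    and len: "\<And>k. lam ^ len k * \<rho> \<le> rad k"
    and energy: "\<And>J. finite J \<Longrightarrow> (\<Sum>k\<in>J. rad k powr (- t) * pair_mass \<nu> b (len k) k) \<le> C"
    and C: "0 < C" and st: "0 < s" "s \<le> t"
  shows "ennreal (1 / (2 * C)) \<le> hausdorff_pre (vdist av) s 1 (K b)"
  unfolding hausdorff_pre_def
proof (rule INF_greatest)
  fix U :: "nat \<Rightarrow> ('a^'n) set"
  assume "U \<in> {U. (\<forall>i. \<forall>x\<in>U i. \<forall>y\<in>U i. vdist av x y \<le> 1) \<and> K b \<subseteq> (\<Union>i. U i)}"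
  then have U: "\<And>i x y. x \<in> U i \<Longrightarrow> y \<in> U i \<Longrightarrow> vdist av x y \<le> 1" "K b \<subseteq> (\<Union>i. U i)" by auto
  let ?g = "\<lambda>i. gdiam (vdist av) (U i)"
  \<comment> \<open>The errors allowed to the balls sum to at most \<open>1 / (2 * C)\<close>, half
    of the lower bound \<open>1 / C\<close> that Cauchy-Schwarz yields.\<close>
  let ?e = "\<lambda>i. (1 / (2 * C)) * (1 / 2) ^ Suc i"
  have "\<exists>k c. (\<forall>x\<in>U i. vnorm av (x - c) \<le> rad k) \<and> rad k powr t \<le> ?g i powr s + ?e i" for i
  proof -
    obtain k c where "\<And>x. x \<in> U i \<Longrightarrow> vnorm av (x - c) \<le> rad k" "rad k powr t \<le> ?g i powr s + ?e i"
      by (rule covered_by_ball[of "U i" s t "?e i", OF U(1) st]) (use C in auto)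
    then show ?thesis by blast
  qed
  then obtain k c where kc: "\<And>i x. x \<in> U i \<Longrightarrow> vnorm av (x - c i) \<le> rad (k i)"
    "\<And>i. rad (k i) powr t \<le> ?g i powr s + ?e i" by metis
  have "K b \<subseteq> (\<Union>i. vball (k i) (c i))"
    using U(2) kc(1) by (force simp: vball_def)
  \<comment> \<open>Ultrametric balls are open, so compactness leaves finitely many of them, and one
    word length \<open>L\<close> can serve them all.\<close>
  then obtain J where J: "finite J" "K b \<subseteq> (\<Union>i\<in>J. vball (k i) (c i))"
    using compactE_image[OF attractor(2)[of b], of UNIV "\<lambda>i. vball (k i) (c i)"] open_vball by (metis UNIV_I)
  \<comment> \<open>A set of pairs instead of an indexed family: repeated balls collapse, so those
    of one radius are pairwise disjoint.\<close>
  define \<B> where "\<B> = (\<lambda>i. (k i, vball (k i) (c i))) ` J"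
  have fin: "finite \<B>" unfolding \<B>_def using J by simp
  define m where "m = (\<lambda>(k, B). \<Sum>w\<in>words M (len k). \<nu> w * of_bool (S b w 0 \<in> B))"
  have nuw: "0 \<le> \<nu> w" if "w \<in> words M L" for w L using nu(2) that by (auto simp: words_def)
  have m_nonneg: "0 \<le> m p" for p
    unfolding m_def by (auto simp: case_prod_unfold intro!: sum_nonneg mult_nonneg_nonneg nuw)
  have mass: "1 \<le> (\<Sum>p\<in>\<B>. m p)"
  proof -
    define L where "L = Max (len ` fst ` \<B>)"
    have L: "len l \<le> L" if "(l, B) \<in> \<B>" for l B
      unfolding L_def using fin that by (intro Max_ge) force+
    obtain x where x: "x \<in> K b" using attractor(1) by blast
    have "1 = (\<Sum>w\<in>words M L. \<nu> w)" using sum_words_flow[OF add, of "[]" L] nu(1) by simp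
    also have "\<dots> \<le> (\<Sum>w\<in>words M L. \<Sum>(l, B)\<in>\<B>. \<nu> w * of_bool (S b (take (len l) w) 0 \<in> B))"
    proof (rule sum_mono)
      fix w assume w: "w \<in> words M L"
      \<comment> \<open>The image of the fixed point \<open>x\<close> of the attractor lies in one
        of the balls. Replacing its tail \<open>S b ?v x\<close> by 0 moves it by at most the
        radius, so the point of the prefix \<open>?u\<close> lies in the same ball.\<close>
      have "S b w x \<in> K b" using hut_iterate[OF attractor(3), of b L] w x by blast
      then obtain i where i: "i \<in> J" "S b w x \<in> vball (k i) (c i)" using J by blast
      let ?l = "len (k i)"
      have i': "(k i, vball (k i) (c i)) \<in> \<B>" unfolding \<B>_def using i by blast
      let ?u = "take ?l w" and ?v = "drop ?l w"
      have u: "?u \<in> words M ?l" and v: "?v \<in> words M (L - ?l)"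
        using w L[OF i'] by (auto simp: words_def dest: in_set_takeD in_set_dropD)
      have "S b ?v x \<in> K b" using hut_iterate[OF attractor(3), of b "L - ?l"] v x by blast
      then have "vnorm av (S b ?v x) \<le> \<rho>" using attractor_bound b by blast
      then have "vnorm av (S b ?u (S b ?v x) - S b ?u 0) \<le> lam ^ ?l * \<rho>"
        using vnorm_S_diff[OF u, of b "S b ?v x" 0] lam_pos
        by (simp add: order_trans[OF _ mult_left_mono])
      then have "vnorm av (S b w x - S b ?u 0) \<le> rad (k i)"
        using len[of "k i"] by (simp add: S_append[symmetric])
      then have "S b ?u 0 \<in> vball (k i) (c i)"
        using i(2) vnorm_diff_trans[of "S b ?u 0" "S b w x" "rad (k i)" "c i"]
        by (simp add: vball_def vnorm_minus_commute)
      then have "\<nu> w = (\<lambda>(l, B). \<nu> w * of_bool (S b (take (len l) w) 0 \<in> B)) (k i, vball (k i) (c i))" by simp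
      also have "\<dots> \<le> (\<Sum>(l, B)\<in>\<B>. \<nu> w * of_bool (S b (take (len l) w) 0 \<in> B))"
        by (rule member_le_sum[OF i']) (use nuw[OF w] fin in auto)
      finally show "\<nu> w \<le> (\<Sum>(l, B)\<in>\<B>. \<nu> w * of_bool (S b (take (len l) w) 0 \<in> B))" .
    qed
    also have "\<dots> = (\<Sum>(l, B)\<in>\<B>. \<Sum>w\<in>words M L. \<nu> w * of_bool (S b (take (len l) w) 0 \<in> B))"
      by (subst sum.swap) (simp add: case_prod_unfold)
    also have "\<dots> = (\<Sum>p\<in>\<B>. m p)"
    proof (rule sum.cong)
      fix p assume p: "p \<in> \<B>"
      obtain l B where lB: "p = (l, B)" by (meson surj_pair)
      show "(case p of (l, B) \<Rightarrow> \<Sum>w\<in>words M L. \<nu> w * of_bool (S b (take (len l) w) 0 \<in> B)) = m p"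
        unfolding lB m_def using sum_words_flow_take[OF add L, of l B "\<lambda>u. of_bool (S b u 0 \<in> B)"] p lB by simp
    qed simp
    finally show ?thesis .
  qed
  have squares: "(\<Sum>p\<in>\<B>. rad (fst p) powr (- t) * (m p)\<^sup>2) \<le> C"
  proof -
    \<comment> \<open>Two points in one ball are within its radius, and by disjointness each pair of
      words counts for at most one ball.\<close>
    have level: "(\<Sum>p\<in>{p \<in> \<B>. fst p = l}. (m p)\<^sup>2) \<le> pair_mass \<nu> b (len l) l" for l
    proof -
      let ?B = "{p \<in> \<B>. fst p = l}" and ?W = "words M (len l)"
      have "(\<Sum>p\<in>?B. (m p)\<^sup>2) =
        (\<Sum>p\<in>?B. \<Sum>w\<in>?W. \<Sum>w'\<in>?W. \<nu> w * \<nu> w' * (of_bool (S b w 0 \<in> snd p) * of_bool (S b w' 0 \<in> snd p)))"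
      proof (rule sum.cong[OF refl])
        fix p assume "p \<in> ?B"
        then have "m p = (\<Sum>w\<in>?W. \<nu> w * of_bool (S b w 0 \<in> snd p))" unfolding m_def by (auto simp: case_prod_unfold)
        then show "(m p)\<^sup>2 = (\<Sum>w\<in>?W. \<Sum>w'\<in>?W. \<nu> w * \<nu> w' * (of_bool (S b w 0 \<in> snd p) * of_bool (S b w' 0 \<in> snd p)))"
          by (simp only: power2_eq_square sum_product mult.assoc mult.left_commute)
      qed
      also have "\<dots> = (\<Sum>w\<in>?W. \<Sum>w'\<in>?W. \<nu> w * \<nu> w' *
          (\<Sum>p\<in>?B. of_bool (S b w 0 \<in> snd p) * of_bool (S b w' 0 \<in> snd p)))"
        by (subst sum.swap, intro sum.cong refl, subst sum.swap) (simp add: sum_distrib_left)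
      also have "\<dots> \<le> pair_mass \<nu> b (len l) l"
        unfolding pair_mass_def
      proof (intro sum_mono mult_left_mono)
        fix w w' assume w: "w \<in> ?W" "w' \<in> ?W"
        then show "0 \<le> \<nu> w * \<nu> w'" using nuw by simp
        let ?h = "\<lambda>p. of_bool (S b w 0 \<in> snd p) * of_bool (S b w' 0 \<in> snd p) :: real"
        show "(\<Sum>p\<in>?B. ?h p) \<le> of_bool (vnorm av (S b w 0 - S b w' 0) \<le> rad l)"
        proof (cases "\<exists>p\<in>?B. S b w 0 \<in> snd p \<and> S b w' 0 \<in> snd p")
          case True
          then obtain p where p: "p \<in> ?B" "S b w 0 \<in> snd p" "S b w' 0 \<in> snd p" by blast
          then obtain i where i: "i \<in> J" "p = (l, vball l (c i))" unfolding \<B>_def by auto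
          have uniq: "p' = p" if p': "p' \<in> ?B" "S b w 0 \<in> snd p'" for p'
          proof -
            obtain i' where i': "p' = (l, vball l (c i'))" using p'(1) unfolding \<B>_def by auto
            show ?thesis using vball_eq[of "S b w 0" l "c i'" "c i"] p(2) p'(2) i(2) i' by simp
          qed
          have "(\<Sum>p\<in>?B. ?h p) = (\<Sum>p\<in>{p}. ?h p)"
          proof (rule sum.mono_neutral_right)
            show "\<forall>p'\<in>?B - {p}. ?h p' = 0"
            proof
              fix p' assume "p' \<in> ?B - {p}"
              then have "S b w 0 \<notin> snd p'" using uniq by blast
              then show "?h p' = 0" by simp
            qed
            show "finite ?B" using fin by simp
            show "{p} \<subseteq> ?B" using p(1) by blast
          qed
          also have "\<dots> \<le> 1" by (subst sum.insert) auto
          finally have "(\<Sum>p\<in>?B. ?h p) \<le> 1" .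
          moreover have "vnorm av (S b w 0 - S b w' 0) \<le> rad l"
            using vball_close[of "S b w 0" l "c i" "S b w' 0"] p i by simp
          ultimately show ?thesis by simp
        next
          case False
          then have "(\<Sum>p\<in>?B. ?h p) = 0" by (intro sum.neutral) auto
          then show ?thesis by simp
        qed
      qed
      finally show ?thesis .
    qed
    have "(\<Sum>p\<in>\<B>. rad (fst p) powr (- t) * (m p)\<^sup>2) =
      (\<Sum>l\<in>fst ` \<B>. \<Sum>p\<in>{p \<in> \<B>. fst p = l}. rad (fst p) powr (- t) * (m p)\<^sup>2)"
      using fin by (intro sum.group[symmetric]) auto
    also have "\<dots> = (\<Sum>l\<in>fst ` \<B>. rad l powr (- t) * (\<Sum>p\<in>{p \<in> \<B>. fst p = l}. (m p)\<^sup>2))"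
      by (intro sum.cong refl) (simp add: sum_distrib_left)
    also have "\<dots> \<le> (\<Sum>l\<in>fst ` \<B>. rad l powr (- t) * pair_mass \<nu> b (len l) l)"
      by (intro sum_mono mult_left_mono level) auto
    also have "\<dots> \<le> C" using fin by (intro energy) auto
    finally show ?thesis .
  qed
  have "1 \<le> (\<Sum>p\<in>\<B>. m p)\<^sup>2" using mass by (simp add: one_le_power)
  \<comment> \<open>The weights are inserted so that Cauchy-Schwarz separates the energy from the
    sum of \<open>rad (fst p) powr t\<close>, which the cover controls.\<close>
  also have "\<dots> = (\<Sum>p\<in>\<B>. (rad (fst p) powr (- t / 2) * m p) * rad (fst p) powr (t / 2))\<^sup>2"
  proof -
    have "rad j powr (- t / 2) * rad j powr (t / 2) = 1" for j
      by (simp add: powr_add[symmetric] less_imp_neq[OF rad_pos, symmetric])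
    then have "(rad (fst p) powr (- t / 2) * m p) * rad (fst p) powr (t / 2) = m p" for p
      by (metis mult.assoc mult.commute mult_1)
    then show ?thesis by (simp only:)
  qed
  also have "\<dots> \<le> (\<Sum>p\<in>\<B>. (rad (fst p) powr (- t / 2) * m p)\<^sup>2) * (\<Sum>p\<in>\<B>. (rad (fst p) powr (t / 2))\<^sup>2)"
    by (rule Cauchy_Schwarz_ineq_sum)
  also have "\<dots> = (\<Sum>p\<in>\<B>. rad (fst p) powr (- t) * (m p)\<^sup>2) * (\<Sum>p\<in>\<B>. rad (fst p) powr t)"
    by (simp add: power_mult_distrib power2_eq_square[of "_ powr _"] powr_add[symmetric])
  also have "\<dots> \<le> C * (\<Sum>p\<in>\<B>. rad (fst p) powr t)"
    using squares by (intro mult_right_mono sum_nonneg) auto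
  also have "\<dots> \<le> C * (\<Sum>i\<in>J. rad (k i) powr t)"
    using sum_image_le[OF J(1), of "\<lambda>p. rad (fst p) powr t" "\<lambda>i. (k i, vball (k i) (c i))"] C
    unfolding \<B>_def by (intro mult_left_mono) (auto simp: o_def)
  also have "\<dots> \<le> C * (\<Sum>i\<in>J. ?g i powr s + ?e i)"
    using C by (intro mult_left_mono sum_mono kc) auto
  also have "\<dots> \<le> C * ((\<Sum>i\<in>J. ?g i powr s) + 1 / (2 * C))"
  proof -
    have half: "(\<lambda>i. (1 / 2 :: real) ^ Suc i) sums 1"
      using power_half_series by simp
    have "(\<Sum>i\<in>J. (1 / 2 :: real) ^ Suc i) \<le> 1"
      using sum_le_suminf[OF sums_summable[OF half] J(1)] sums_unique[OF half] by simp
    then have "(\<Sum>i\<in>J. ?e i) \<le> 1 / (2 * C) * 1"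
      unfolding sum_distrib_left[symmetric] using C by (intro mult_left_mono) auto
    then show ?thesis using C by (simp add: sum.distrib)
  qed
  finally have "1 / (2 * C) \<le> (\<Sum>i\<in>J. ?g i powr s)" using C by (simp add: field_simps)
  then have "ennreal (1 / (2 * C)) \<le> ennreal (\<Sum>i\<in>J. ?g i powr s)" by (rule ennreal_leI)
  also have "\<dots> = (\<Sum>i\<in>J. ennreal (?g i powr s))" by (simp add: sum_ennreal)
  also have "\<dots> \<le> (\<Sum>i. ennreal (?g i powr s))" using J(1) by (intro sum_le_suminf) auto
  finally show "ennreal (1 / (2 * C)) \<le> (\<Sum>i. ennreal (?g i powr s))" .
qed

lemma hausdorff_dim_lower_bound:
  assumes "\<And>s. 0 < s \<Longrightarrow> s \<le> t \<Longrightarrow> 0 < hausdorff_pre (vdist av) s 1 (K b)"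
  shows "t \<le> hausdorff_dim (vdist av) (K b)"
  unfolding hausdorff_dim_def
proof (rule cInf_greatest)
  \<comment> \<open>The infimum needs a nonempty set: \<open>real CARD('n) + 1\<close> exceeds the
    lower box dimension and so belongs to it.\<close>
  have "lower_box_dim (vdist av) (K b) \<le> ereal (real CARD('n))"
    using order_trans[OF lower_le_upper_box_dim upper_box_dim_le_dimension[OF vbounded_K attractor(1)]] .
  also have "\<dots> < ereal (real CARD('n) + 1)" by simp
  finally show "{s. 0 < s \<and> hausdorff_measure (vdist av) s (K b) = 0} \<noteq> {}"
    using hausdorff_measure_eq_0[OF vbounded_K attractor(1)] by blast
next
  fix s assume s: "s \<in> {s. 0 < s \<and> hausdorff_measure (vdist av) s (K b) = 0}"
  show "t \<le> s"
  proof (rule ccontr)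
    assume "\<not> t \<le> s"
    then have "0 < hausdorff_pre (vdist av) s 1 (K b)" using assms s by simp
    also have "\<dots> \<le> hausdorff_measure (vdist av) s (K b)"
      unfolding hausdorff_measure_def by (rule SUP_upper) simp
    finally show False using s by simp
  qed
qed

end

locale affine_haar = affine_system av T M
  for av :: "'a::{field,metric_space} \<Rightarrow> real" and T :: "nat \<Rightarrow> 'a^'n^'n" and M :: nat +
  fixes \<mu> :: "'a measure"
  assumes haar: "haar_measure av \<mu>"
begin

subsection \<open>Haar measure of balls\<close>

lemma sets_mu: "sets \<mu> = sets borel" and space_mu: "space \<mu> = UNIV"
  and mu_translate: "A \<in> sets borel \<Longrightarrow> emeasure \<mu> ((\<lambda>x. a + x) ` A) = emeasure \<mu> A"
  and mu_valring: "emeasure \<mu> (valring av) = 1"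
  using haar unfolding haar_measure_def by auto

definition sball :: "'a \<Rightarrow> real \<Rightarrow> 'a set" where
  "sball c v = {x. av (x - c) \<le> v}"

lemma sball_borel: "sball c v \<in> sets borel"
proof -
  have "sball c v = cball c v" by (auto simp: sball_def dist_av av_minus_commute)
  then show ?thesis by simp
qed

lemma sball_sets [measurable]: "sball c v \<in> sets \<mu>"
  using sball_borel sets_mu by simp

lemma emeasure_sball_translate: "emeasure \<mu> (sball c v) = emeasure \<mu> (sball 0 v)"
proof -
  have "sball c v = (\<lambda>x. c + x) ` sball 0 v"
  proof (intro equalityI subsetI)
    fix x assume "x \<in> sball c v"
    then have "x = c + (x - c)" "x - c \<in> sball 0 v" by (auto simp: sball_def)
    then show "x \<in> (\<lambda>x. c + x) ` sball 0 v" by blast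
  qed (auto simp: sball_def)
  then show ?thesis using mu_translate[OF sball_borel] by simp
qed

text \<open>The larger ball is the disjoint union of the balls of radius \<open>v\<close> about a
  net of \<open>a / v\<close> points, all of the same measure by translation invariance.\<close>

lemma emeasure_sball_ratio:
  assumes "a \<in> vgrp" "v \<in> vgrp" "v \<le> a"
  shows "emeasure \<mu> (sball 0 a) = ennreal (a / v) * emeasure \<mu> (sball 0 v)"
proof -
  have v0: "0 < v" using vgrp_pos assms by blast
  obtain R where net: "fnet v a R" and card: "real (card R) = max 1 (a / v)"
    using net_field[OF assms(1,2)] by blast
  note R = fnetD[OF net]
  have card': "real (card R) = a / v" using card assms v0 by (simp add: max_def le_divide_eq)
  have "sball 0 a = (\<Union>y\<in>R. sball y v)"
  proof (intro equalityI subsetI)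
    fix x assume "x \<in> sball 0 a"
    then show "x \<in> (\<Union>y\<in>R. sball y v)" using R(4)[of x] by (auto simp: sball_def)
  next
    fix x assume "x \<in> (\<Union>y\<in>R. sball y v)"
    then obtain y where "y \<in> R" "av (x - y) \<le> v" by (auto simp: sball_def)
    then show "x \<in> sball 0 a" using av_ultra[of "x - y" y] R(2)[of y] assms by (simp add: sball_def)
  qed
  moreover have "disjoint_family_on (\<lambda>y. sball y v) R"
    unfolding disjoint_family_on_def
  proof (intro ballI impI)
    fix y z assume yz: "y \<in> R" "z \<in> R" "y \<noteq> z"
    show "sball y v \<inter> sball z v = {}"
    proof (rule ccontr)
      assume "sball y v \<inter> sball z v \<noteq> {}"
      then obtain x where "av (x - y) \<le> v" "av (x - z) \<le> v" by (auto simp: sball_def)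
      then have "av (y - z) \<le> v" using av_diff[of "x - z" "x - y"] by simp
      then show False using R(3)[OF yz] by simp
    qed
  qed
  moreover have "(\<lambda>y. sball y v) ` R \<subseteq> sets \<mu>" using sball_sets by blast
  ultimately have "emeasure \<mu> (sball 0 a) = (\<Sum>y\<in>R. emeasure \<mu> (sball y v))"
    using R(1) sum_emeasure[of "\<lambda>y. sball y v" R \<mu>] by simp
  also have "\<dots> = of_nat (card R) * emeasure \<mu> (sball 0 v)"
    by (subst emeasure_sball_translate) simp
  finally show ?thesis using card' by (metis ennreal_of_nat_eq_real_of_nat)
qed

text \<open>Comparison with the valuation ring, which has measure 1 and is either the larger or the
  smaller ball.\<close>

lemma emeasure_sball:
  assumes "v \<in> vgrp" shows "emeasure \<mu> (sball c v) = ennreal v"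
proof -
  have v0: "0 < v" using vgrp_pos assms by blast
  have one: "emeasure \<mu> (sball 0 1) = 1"
    using mu_valring by (simp add: valring_def sball_def)
  have "emeasure \<mu> (sball 0 v) = ennreal v"
  proof (cases "v \<le> 1")
    case True
    have "ennreal v * (ennreal (1 / v) * emeasure \<mu> (sball 0 v)) = ennreal v * 1"
      using emeasure_sball_ratio[OF vgrp_1 assms True] one by simp
    moreover have "ennreal v * ennreal (1 / v) = 1"
      using v0 by (simp add: ennreal_mult[symmetric])
    ultimately show ?thesis by (simp add: mult.assoc[symmetric])
  next
    case False
    then show ?thesis using emeasure_sball_ratio[OF assms vgrp_1] one by simp
  qed
  then show ?thesis using emeasure_sball_translate[of c v] by simp
qed

lemma q_power_vgrp: "q ^ k \<in> vgrp"
  using vgrpI[of "int k"] by simp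

lemma sigma_finite_mu: "sigma_finite_measure \<mu>"
proof
  let ?A = "range (\<lambda>k::nat. sball 0 (q ^ k))"
  have "(\<Union>?A) = space \<mu>"
  proof -
    have "\<exists>k. av x \<le> q ^ k" for x
      using real_arch_pow[OF q_gt_1, of "av x"] less_imp_le by blast
    then show ?thesis by (auto simp: space_mu sball_def)
  qed
  moreover have "emeasure \<mu> a \<noteq> \<infinity>" if "a \<in> ?A" for a
    using that emeasure_sball[OF q_power_vgrp] by auto
  ultimately show "\<exists>A. countable A \<and> A \<subseteq> sets \<mu> \<and> \<Union> A = space \<mu> \<and> (\<forall>a\<in>A. emeasure \<mu> a \<noteq> \<infinity>)"
    using sball_sets by (intro exI[of _ ?A]) auto
qed

abbreviation \<mu>n :: "('n \<Rightarrow> 'a) measure" where "\<mu>n \<equiv> PiM UNIV (\<lambda>_. \<mu>)"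

interpretation coord: product_sigma_finite "\<lambda>_ :: 'n. \<mu>"
  by (rule product_sigma_finite.intro) (rule sigma_finite_mu)

interpretation trans: product_sigma_finite "\<lambda>_ :: nat. \<mu>n"
  by (rule product_sigma_finite.intro) (rule coord.sigma_finite, simp)

definition vbox :: "'a^'n \<Rightarrow> real \<Rightarrow> ('n \<Rightarrow> 'a) set" where
  "vbox z v = Pi\<^sub>E UNIV (\<lambda>j. sball (z $ j) v)"

lemma mem_vbox: "f \<in> vbox z v \<longleftrightarrow> vnorm av (vec_lambda f - z) \<le> v"
  by (auto simp: vbox_def vnorm_le_iff sball_def PiE_def Pi_def)

lemma vbox_sets [measurable]: "vbox z v \<in> sets \<mu>n"
  unfolding vbox_def by (rule sets_PiM_I_finite) auto

lemma emeasure_vbox: assumes "v \<in> vgrp" shows "emeasure \<mu>n (vbox z v) = ennreal (v ^ CARD('n))"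
  unfolding vbox_def using vgrp_pos[OF assms]
  by (subst coord.emeasure_PiM) (auto simp: emeasure_sball[OF assms] ennreal_power)

lemma vgrp_min: "a \<in> vgrp \<Longrightarrow> b \<in> vgrp \<Longrightarrow> min a b \<in> vgrp"
  by (simp add: min_def)

section \<open>Measure of the translations that make a difference small\<close>

text \<open>Subtracting a base point of the set removes \<open>c\<close>; through the isometries
  \<open>Q\<close> and \<open>U\<close> the differences then lie in a box whose sides are the values
  \<open>min \<rho>0 (\<rho> / av (e i))\<close>. A net of this box pulls back to finitely many sets
  \<open>vbox\<close>, whose union is the measurable cover \<open>W\<close>.\<close>

lemma slice_cover:
  fixes A U :: "'a^'n^'n"
  assumes A: "det A \<noteq> 0" and U: "\<And>z. vnorm av (U *v z) = vnorm av z"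
    and \<rho>0: "\<rho>0 \<in> vgrp" and \<rho>: "\<rho> \<in> vgrp"
  obtains W where "W \<in> sets \<mu>n" "emeasure \<mu>n W \<le> ennreal (\<Prod>i<CARD('n). min \<rho>0 (\<rho> / sval A i))"
    "\<And>f. vnorm av (vec_lambda f) \<le> \<rho>0 \<Longrightarrow> vnorm av (A *v (U *v vec_lambda f + c)) \<le> \<rho> \<Longrightarrow> f \<in> W"
proof -
  define X where "X = {z. vnorm av z \<le> \<rho>0 \<and> vnorm av (A *v (U *v z + c)) \<le> \<rho>}"
  show ?thesis
  proof (cases "X = {}")
    case True
    show ?thesis by (rule that[of "{}"]) (use True in \<open>auto simp: X_def\<close>)
  next
    case False
    then obtain z0 where z0: "z0 \<in> X" by blast
    obtain P Q e where "svd A P Q e" using svd_exists[OF A] .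
    note svd = svdD[OF this]
    define a where "a i = min \<rho>0 (\<rho> / av (e i))" for i
    have a: "a i \<in> vgrp" for i
      unfolding a_def using \<rho>0 \<rho> by (intro vgrp_min vgrp_divide av_in_vgrp svd(3))
    \<comment> \<open>With the smallest side as radius, the maxima in the net count disappear and
      the pieces have exactly the volume of the box as total measure.\<close>
    define \<epsilon> where "\<epsilon> = Min (range a)"
    have "\<epsilon> \<in> range a" unfolding \<epsilon>_def by (rule Min_in) auto
    then have \<epsilon>: "\<epsilon> \<in> vgrp" using a by auto
    have \<epsilon>_le: "\<epsilon> \<le> a i" for i unfolding \<epsilon>_def by (rule Min_le) auto
    have \<epsilon>0: "0 < \<epsilon>" using vgrp_pos \<epsilon> by blast
    obtain R where R: "net \<epsilon> {x :: 'a^'n. \<forall>i. av (x $ i) \<le> a i} R" "real (card R) = (\<Prod>i\<in>UNIV. max 1 (a i / \<epsilon>))"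
      using net_box[of a \<epsilon>, OF a \<epsilon>] .
    have fin: "finite R" using R(1) unfolding net_def by blast
    define y where "y z = Q *v (U *v (z - z0))" for z
    have y_diff: "vnorm av (y z - y z') = vnorm av (z - z')" for z z'
    proof -
      have "y z - y z' = Q *v (U *v (z - z'))"
        unfolding y_def by (simp add: matrix_vector_mult_diff_distrib)
      then show ?thesis using In_group_isometry[OF svd(2)] U by simp
    qed
    have y_box: "\<exists>r\<in>R. vnorm av (y z - r) \<le> \<epsilon>" if z: "z \<in> X" for z
    proof -
      have "vnorm av (z - z0) \<le> \<rho>0" using z z0 unfolding X_def by (intro vnorm_diff_le) auto
      then have 1: "vnorm av (y z) \<le> \<rho>0" unfolding y_def using In_group_isometry[OF svd(2)] U by simp
      have "A *v (U *v (z - z0)) = A *v (U *v z + c) - A *v (U *v z0 + c)"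
        by (simp add: matrix_vector_mult_diff_distrib matrix_vector_right_distrib)
      then have "vnorm av (A *v (U *v (z - z0))) \<le> \<rho>" using z z0 unfolding X_def by (auto intro!: vnorm_diff_le)
      then have "vnorm av (\<chi> i. e i * y z $ i) \<le> \<rho>"
        unfolding svd(4) y_def using In_group_isometry[OF svd(1)] by simp
      then have "av (e i) * av (y z $ i) \<le> \<rho>" for i by (simp add: vnorm_le_iff av_mult)
      then have "av (y z $ i) \<le> \<rho> / av (e i)" for i using svd(3) by (simp add: le_divide_eq mult.commute)
      then have "\<forall>i. av (y z $ i) \<le> a i" using 1 unfolding a_def vnorm_le_iff by simp
      then show ?thesis using R(1) unfolding net_def by blast
    qed
    \<comment> \<open>Net points are pulled back by choice instead of inverting \<open>y\<close>;
      one without a nearby point of \<open>X\<close> gets an arbitrary centre, at no extra cost in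
      measure.\<close>
    define sel where "sel r = (SOME z. z \<in> X \<and> vnorm av (y z - r) \<le> \<epsilon>)" for r
    define W where "W = (\<Union>r\<in>R. vbox (sel r) \<epsilon>)"
    show ?thesis
    proof (rule that[of W])
      show "W \<in> sets \<mu>n" unfolding W_def using fin by auto
      have "emeasure \<mu>n W \<le> (\<Sum>r\<in>R. emeasure \<mu>n (vbox (sel r) \<epsilon>))"
        unfolding W_def using fin by (intro emeasure_subadditive_finite) auto
      also have "\<dots> = ennreal (real (card R) * \<epsilon> ^ CARD('n))"
        using emeasure_vbox[OF \<epsilon>] \<epsilon>0 by (simp add: ennreal_mult ennreal_of_nat_eq_real_of_nat)
      also have "real (card R) * \<epsilon> ^ CARD('n) = (\<Prod>i\<in>(UNIV :: 'n set). (a i / \<epsilon>) * \<epsilon>)"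
        unfolding R(2) using \<epsilon>_le \<epsilon>0 by (simp add: max_def le_divide_eq prod_dividef)
      also have "\<dots> = (\<Prod>i\<in>(UNIV :: 'n set). min \<rho>0 (\<rho> / av (e i)))" using \<epsilon>0 by (simp add: a_def)
      also have "\<dots> = (\<Prod>i<CARD('n). min \<rho>0 (\<rho> / sval A i))" by (rule svd(5))
      finally show "emeasure \<mu>n W \<le> ennreal (\<Prod>i<CARD('n). min \<rho>0 (\<rho> / sval A i))" .
      fix f assume "vnorm av (vec_lambda f) \<le> \<rho>0" "vnorm av (A *v (U *v vec_lambda f + c)) \<le> \<rho>"
      then have f: "vec_lambda f \<in> X" unfolding X_def by simp
      then obtain r where r: "r \<in> R" "vnorm av (y (vec_lambda f) - r) \<le> \<epsilon>" using y_box by blast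
      then have sel: "sel r \<in> X \<and> vnorm av (y (sel r) - r) \<le> \<epsilon>"
        unfolding sel_def using f by (intro someI_ex[of "\<lambda>z. z \<in> X \<and> vnorm av (y z - r) \<le> \<epsilon>"]) blast
      have "vnorm av (vec_lambda f - sel r) \<le> \<epsilon>"
        using vdist_ball[of "y (vec_lambda f)" r \<epsilon> "y (sel r)"] r(2) sel y_diff[of "vec_lambda f" "sel r"]
        by (simp add: vdist_def)
      then show "f \<in> W" unfolding W_def using r(1) by (auto simp: mem_vbox)
    qed
  qed
qed

text \<open>Since \<open>\<rho>0 \<ge> 1\<close>, replacing the cap 1 by \<open>\<rho>0\<close>
  costs at most a factor \<open>\<rho>0\<close> per coordinate.\<close>

lemma prod_min_bound:
  fixes A :: "'a^'n^'n"
  assumes "det A \<noteq> 0" "0 \<le> t" "t \<le> real CARD('n)" "1 \<le> \<rho>0" "0 < \<rho>"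
  shows "(\<Prod>i<CARD('n). min \<rho>0 (\<rho> / sval A i)) \<le> \<rho>0 ^ CARD('n) * (\<rho> powr t / sv_fun av t A)"
proof -
  have "(\<Prod>i<CARD('n). min \<rho>0 (\<rho> / sval A i)) \<le> (\<Prod>i<CARD('n). \<rho>0 * min 1 (\<rho> / sval A i))"
  proof (rule prod_mono)
    fix i assume "i \<in> {..<CARD('n)}"
    then have p: "0 < \<rho> / sval A i" using sval_pos[OF assms(1)] assms(5) by simp
    have "\<rho> / sval A i \<le> \<rho>0 * (\<rho> / sval A i)" using mult_right_mono[OF assms(4), of "\<rho> / sval A i"] p by simp
    then show "0 \<le> min \<rho>0 (\<rho> / sval A i) \<and> min \<rho>0 (\<rho> / sval A i) \<le> \<rho>0 * min 1 (\<rho> / sval A i)"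
      using p assms(4) by (auto simp: min_def)
  qed
  also have "\<dots> = \<rho>0 ^ CARD('n) * (\<Prod>i<CARD('n). min 1 (\<rho> / sval A i))" by (simp add: prod.distrib)
  also have "\<dots> \<le> \<rho>0 ^ CARD('n) * (\<rho> powr t / sv_fun av t A)"
    using assms prod_min_le_sv_fun[OF assms(1,2,3,5)] by (intro mult_left_mono) auto
  finally show ?thesis .
qed

subsection \<open>Dependence on the translations\<close>

text \<open>The linear part of \<open>S b w 0\<close> as an affine function of the single
  translation \<open>b i\<close>; see \<open>S_coef\<close>.\<close>

primrec coef :: "nat \<Rightarrow> nat list \<Rightarrow> 'a^'n^'n" where
  "coef i [] = 0"
| "coef i (j # w) = T j ** coef i w + (if j = i then mat 1 else 0)"

lemma S_coef: "S (b(i := z)) w 0 = coef i w *v z + S (b(i := 0)) w 0"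
  by (induction w) (auto simp: matrix_vector_right_distrib matrix_vector_mult_add_rdistrib
      matrix_vector_mul_assoc[symmetric] algebra_simps)

lemma vnorm_coef: "set w \<subseteq> {..<M} \<Longrightarrow> vnorm av (coef i w *v z) \<le> vnorm av z"
proof (induction w)
  case (Cons j w)
  have "vnorm av (T j *v (coef i w *v z)) \<le> vnorm av z"
    using vnorm_T_le_self[of j "coef i w *v z"] Cons by auto
  then show ?case
    by (auto simp: matrix_vector_mult_add_rdistrib matrix_vector_mul_assoc[symmetric] intro!: vnorm_add_le)
qed simp

text \<open>Only the word starting with \<open>i\<close> contributes \<open>mat 1\<close>, because
  \<open>j \<noteq> i\<close>; the other terms carry \<open>T i\<close> or \<open>T j\<close> in
  front of a map of norm at most 1 and so stay within \<open>lam\<close> times the norm of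
  \<open>z\<close>.\<close>

lemma coef_isometry:
  assumes "i < M" "j < M" "i \<noteq> j" "set u \<subseteq> {..<M}" "set v \<subseteq> {..<M}"
  shows "vnorm av ((coef i (i # u) - coef i (j # v)) *v z) = vnorm av z"
proof (cases "z = 0")
  case False
  let ?x = "T i *v (coef i u *v z) - T j *v (coef i v *v z)"
  have "(coef i (i # u) - coef i (j # v)) *v z = z + ?x"
    using assms(3) by (simp add: matrix_vector_mult_diff_rdistrib matrix_vector_mult_add_rdistrib
        matrix_vector_mul_assoc)
  moreover have "vnorm av ?x \<le> lam * vnorm av z"
  proof (rule vnorm_diff_le)
    show "vnorm av (T i *v (coef i u *v z)) \<le> lam * vnorm av z"
      using order_trans[OF vnorm_T_le[OF assms(1)] mult_left_mono[OF vnorm_coef[OF assms(4)]]] lam_pos by simp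
    show "vnorm av (T j *v (coef i v *v z)) \<le> lam * vnorm av z"
      using order_trans[OF vnorm_T_le[OF assms(2)] mult_left_mono[OF vnorm_coef[OF assms(5)]]] lam_pos by simp
  qed
  moreover have "lam * vnorm av z < vnorm av z" using False lam_less_1 by simp
  ultimately show ?thesis using vnorm_add_eq[of ?x z] by simp
qed simp

text \<open>The points depend 1-Lipschitz on the translations, so closeness at scale
  \<open>rad k\<close> survives perturbations of that size; this makes \<open>close_set\<close>
  measurable.\<close>

lemma S_perturb:
  assumes "\<And>i. i < M \<Longrightarrow> vnorm av (b i - b' i) \<le> v" "0 \<le> v"
  shows "set w \<subseteq> {..<M} \<Longrightarrow> vnorm av (S b w 0 - S b' w 0) \<le> v"
proof (induction w)
  case (Cons i w)
  have "S b (i # w) 0 - S b' (i # w) 0 = T i *v (S b w 0 - S b' w 0) + (b i - b' i)"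
    by (simp add: matrix_vector_mult_diff_distrib)
  moreover have "vnorm av (T i *v (S b w 0 - S b' w 0)) \<le> v"
    using order_trans[OF vnorm_T_le_self Cons.IH] Cons.prems by simp
  moreover have "vnorm av (b i - b' i) \<le> v" using assms(1)[of i] Cons.prems by simp
  ultimately show ?case by (simp only: vnorm_add_le)
qed (simp add: assms)

abbreviation \<mu>nM :: "(nat \<Rightarrow> 'n \<Rightarrow> 'a) measure" where "\<mu>nM \<equiv> PiM {..<M} (\<lambda>_. \<mu>n)"

definition vecs :: "(nat \<Rightarrow> 'n \<Rightarrow> 'a) \<Rightarrow> nat \<Rightarrow> 'a^'n" where
  "vecs b = (\<lambda>i. vec_lambda (b i))"

lemma vecs_upd: "vecs (b(i := f)) = (vecs b)(i := vec_lambda f)"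
  by (auto simp: vecs_def)

lemma countable_net:
  assumes "v \<in> vgrp"
  obtains C where "countable C" "\<And>x :: 'a. \<exists>c\<in>C. x \<in> sball c v"
proof -
  have "\<exists>F. \<forall>k. fnet v (q ^ k) (F k) \<and> real (card (F k)) = max 1 (q ^ k / v)"
    by (intro choice allI net_field q_power_vgrp assms)
  then obtain F where F: "\<And>k. fnet v (q ^ k) (F k)" by blast
  have "countable (\<Union>k. F k)" using fnetD(1)[OF F] by (auto intro: countable_finite)
  moreover have "\<exists>c\<in>(\<Union>k. F k). x \<in> sball c v" for x
  proof -
    obtain k where "av x \<le> q ^ k"
      using real_arch_pow[OF q_gt_1, of "av x"] less_imp_le by blast
    then obtain y where "y \<in> F k" "av (x - y) \<le> v" using fnetD(4)[OF F] by blast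
    then show ?thesis by (auto simp: sball_def)
  qed
  ultimately show ?thesis using that by blast
qed

text \<open>The sum of two Borel functions into the field need not be measurable a priori, since no
  countable basis is assumed; sets invariant under small perturbations are countable unions of boxes.\<close>

lemma perturbation_invariant_measurable:
  assumes v: "v \<in> vgrp" and A: "A \<subseteq> space \<mu>nM"
    and inv: "\<And>b b'. b \<in> A \<Longrightarrow> b' \<in> space \<mu>nM \<Longrightarrow> (\<And>i. i < M \<Longrightarrow> vnorm av (vecs b i - vecs b' i) \<le> v) \<Longrightarrow> b' \<in> A"
  shows "A \<in> sets \<mu>nM"
proof -
  obtain C where C: "countable C" "\<And>x :: 'a. \<exists>c\<in>C. x \<in> sball c v"
    by (rule countable_net[OF v]) (rule that)
  define box where "box f = Pi\<^sub>E {..<M} (\<lambda>i. vbox (vec_lambda (f i)) v)" for f :: "nat \<Rightarrow> 'n \<Rightarrow> 'a"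
  define I where "I = {f \<in> Pi\<^sub>E {..<M} (\<lambda>_. Pi\<^sub>E (UNIV :: 'n set) (\<lambda>_. C)). A \<inter> box f \<noteq> {}}"
  have "countable (Pi\<^sub>E {..<M} (\<lambda>_. Pi\<^sub>E (UNIV :: 'n set) (\<lambda>_. C)))"
    by (intro countable_PiE C) auto
  then have "countable I" unfolding I_def by (rule countable_subset[rotated]) auto
  moreover have "box f \<in> sets \<mu>nM" for f
    unfolding box_def by (rule sets_PiM_I_finite) auto
  ultimately have "(\<Union>f\<in>I. box f) \<in> sets \<mu>nM" by (intro sets.countable_UN') auto
  moreover have "A = (\<Union>f\<in>I. box f)"
  proof (intro equalityI subsetI)
    fix b assume b: "b \<in> A"
    obtain g where g: "\<And>x. g x \<in> C" "\<And>x. x \<in> sball (g x) v" using C(2) by metis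
    define f where "f = (\<lambda>i\<in>{..<M}. \<lambda>j. g (b i j))"
    have "b \<in> box f"
      using b A g(2) unfolding box_def f_def
      by (auto simp: space_PiM PiE_iff mem_vbox vnorm_le_iff sball_def)
    moreover have "f \<in> Pi\<^sub>E {..<M} (\<lambda>_. Pi\<^sub>E (UNIV :: 'n set) (\<lambda>_. C))"
      unfolding f_def using g(1) by auto
    ultimately show "b \<in> (\<Union>f\<in>I. box f)" unfolding I_def using b by blast
  next
    fix b' assume "b' \<in> (\<Union>f\<in>I. box f)"
    then obtain f b where f: "b' \<in> box f" "b \<in> A" "b \<in> box f" unfolding I_def by blast
    have "vnorm av (vecs b i - vecs b' i) \<le> v" if "i < M" for i
    proof -
      have "b i \<in> vbox (vec_lambda (f i)) v" "b' i \<in> vbox (vec_lambda (f i)) v"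
        using f that unfolding box_def by auto
      then show ?thesis
        using vdist_ball[of "vecs b i" "vec_lambda (f i)" v "vecs b' i"] by (simp add: mem_vbox vecs_def vdist_def)
    qed
    moreover have "b' \<in> space \<mu>nM" using f(1) unfolding box_def by (auto simp: space_PiM space_mu PiE_iff)
    ultimately show "b' \<in> A" using inv f(2) by blast
  qed
  ultimately show ?thesis by simp
qed

section \<open>Probability that the points of two words are close\<close>

definition close_set :: "real \<Rightarrow> nat \<Rightarrow> nat list \<Rightarrow> nat list \<Rightarrow> (nat \<Rightarrow> 'n \<Rightarrow> 'a) set" where
  "close_set \<rho>0 k w w' = {b \<in> space \<mu>nM. (\<forall>i<M. vnorm av (vecs b i) \<le> \<rho>0) \<and>
     vnorm av (S (vecs b) w 0 - S (vecs b) w' 0) \<le> rad k}"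

lemma close_set_measurable:
  assumes "1 \<le> \<rho>0" "set w \<subseteq> {..<M}" "set w' \<subseteq> {..<M}"
  shows "close_set \<rho>0 k w w' \<in> sets \<mu>nM"
proof (rule perturbation_invariant_measurable[OF rad_vgrp[of k]])
  show "close_set \<rho>0 k w w' \<subseteq> space \<mu>nM" unfolding close_set_def by blast
  fix b b' assume b: "b \<in> close_set \<rho>0 k w w'" and b': "b' \<in> space \<mu>nM"
    and close: "\<And>i. i < M \<Longrightarrow> vnorm av (vecs b i - vecs b' i) \<le> rad k"
  have "vnorm av (vecs b' i) \<le> \<rho>0" if i: "i < M" for i
  proof -
    \<comment> \<open>A perturbation of size \<open>rad k \<le> 1 \<le> \<rho>0\<close> cannot leave
      the ball of radius \<open>\<rho>0\<close>.\<close>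
    have "vnorm av (vecs b i - vecs b' i) \<le> \<rho>0" using close[OF i] rad_le_1[of k] assms(1) by linarith
    moreover have "vnorm av (vecs b i) \<le> \<rho>0" using b i unfolding close_set_def by blast
    ultimately show ?thesis using vnorm_diff_le[of "vecs b i" \<rho>0 "vecs b i - vecs b' i"] by simp
  qed
  moreover have "vnorm av (S (vecs b') w 0 - S (vecs b') w' 0) \<le> rad k"
  proof -
    have 1: "vnorm av (S (vecs b') w 0 - S (vecs b) w 0) \<le> rad k"
      using S_perturb[OF close _ assms(2)] by (simp add: vnorm_minus_commute)
    have 2: "vnorm av (S (vecs b) w 0 - S (vecs b) w' 0) \<le> rad k" using b unfolding close_set_def by blast
    have 3: "vnorm av (S (vecs b) w' 0 - S (vecs b') w' 0) \<le> rad k"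
      using S_perturb[OF close _ assms(3)] by simp
    show ?thesis using vnorm_diff_trans[OF vnorm_diff_trans[OF 1 2] 3] .
  qed
  ultimately show "b' \<in> close_set \<rho>0 k w w'" using b' unfolding close_set_def by blast
qed

lemma emeasure_big_box:
  assumes "\<rho>0 \<in> vgrp" "finite I"
  shows "emeasure (PiM I (\<lambda>_ :: nat. \<mu>n)) (Pi\<^sub>E I (\<lambda>_. vbox 0 \<rho>0)) = ennreal ((\<rho>0 ^ CARD('n)) ^ card I)"
  using assms vgrp_pos[OF assms(1)] by (subst trans.emeasure_PiM) (auto simp: emeasure_vbox ennreal_power)

text \<open>Conditioning on all translations but the one at the first letter where the words differ.\<close>

lemma emeasure_close_set_distinct:
  assumes \<rho>0: "\<rho>0 \<in> vgrp" "1 \<le> \<rho>0" and t: "0 \<le> t" "t \<le> real CARD('n)"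
    and ij: "i < M" "j < M" "i \<noteq> j" and sets: "set p \<subseteq> {..<M}" "set u \<subseteq> {..<M}" "set v \<subseteq> {..<M}"
  shows "emeasure \<mu>nM (close_set \<rho>0 k (p @ i # u) (p @ j # v)) \<le>
    ennreal (\<rho>0 ^ (CARD('n) * M) * (rad k powr t / sv_fun av t (word_map T p)))"
proof -
  let ?n = "CARD('n)" and ?A = "word_map T p" and ?U = "coef i (i # u) - coef i (j # v)"
  let ?X = "close_set \<rho>0 k (p @ i # u) (p @ j # v)"
  define I where "I = {..<M} - {i}"
  have I: "{..<M} = insert i I" "finite I" "i \<notin> I" "card I = M - 1" using ij unfolding I_def by auto
  define D where "D = \<rho>0 ^ ?n * (rad k powr t / sv_fun av t ?A)"
  have detA: "det ?A \<noteq> 0" using det_word_map sets by blast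
  have D0: "0 \<le> D" unfolding D_def using \<rho>0 sv_fun_pos[OF detA t(1)] by simp
  have X: "?X \<in> sets \<mu>nM" using \<rho>0 ij sets by (intro close_set_measurable) auto
  have Xeq: "b \<in> ?X \<longleftrightarrow> b \<in> space \<mu>nM \<and> (\<forall>i<M. vnorm av (vecs b i) \<le> \<rho>0) \<and>
      vnorm av (?A *v (S (vecs b) (i # u) 0 - S (vecs b) (j # v) 0)) \<le> rad k" for b
    unfolding close_set_def S_append S_diff by simp
  \<comment> \<open>With the other translations fixed in \<open>x\<close>, the difference of the
    points is affine in \<open>f\<close> with isometric linear part \<open>?U\<close>, so
    \<open>slice_cover\<close> applies; for \<open>x\<close> outside the box the slice is
    empty.\<close>
  have inner: "(\<integral>\<^sup>+ f. indicator ?X (x(i := f)) \<partial>\<mu>n) \<le> ennreal D * indicator (Pi\<^sub>E I (\<lambda>_. vbox 0 \<rho>0)) x"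
    if x: "x \<in> space (PiM I (\<lambda>_. \<mu>n))" for x
  proof (cases "x \<in> Pi\<^sub>E I (\<lambda>_. vbox 0 \<rho>0)")
    case True
    let ?c = "S ((vecs x)(i := 0)) (i # u) 0 - S ((vecs x)(i := 0)) (j # v) 0"
    obtain W where W: "W \<in> sets \<mu>n" "emeasure \<mu>n W \<le> ennreal (\<Prod>i<CARD('n). min \<rho>0 (rad k / sval ?A i))"
      "\<And>f. vnorm av (vec_lambda f) \<le> \<rho>0 \<Longrightarrow> vnorm av (?A *v (?U *v vec_lambda f + ?c)) \<le> rad k \<Longrightarrow> f \<in> W"
      by (rule slice_cover[OF detA coef_isometry[OF ij sets(2,3)] \<rho>0(1) rad_vgrp[of k], of ?c]) (rule that)
    have "indicator ?X (x(i := f)) \<le> (indicator W f :: ennreal)" for f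
    proof (cases "x(i := f) \<in> ?X")
      case True
      have "S ((vecs x)(i := vec_lambda f)) (i # u) 0 - S ((vecs x)(i := vec_lambda f)) (j # v) 0 =
          ?U *v vec_lambda f + ?c"
        by (simp only: S_coef[of "vecs x" i "vec_lambda f"] matrix_vector_mult_diff_rdistrib) (simp del: S.simps coef.simps)
      then have "vnorm av (?A *v (?U *v vec_lambda f + ?c)) \<le> rad k"
        using True unfolding Xeq vecs_upd by metis
      moreover have "vnorm av (vec_lambda f) \<le> \<rho>0"
        using True ij(1) unfolding Xeq vecs_upd by (metis fun_upd_same)
      ultimately have "f \<in> W" using W(3) by blast
      then show ?thesis by (simp add: indicator_def)
    qed simp
    then have "(\<integral>\<^sup>+ f. indicator ?X (x(i := f)) \<partial>\<mu>n) \<le> (\<integral>\<^sup>+ f. indicator W f \<partial>\<mu>n)"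
      by (intro nn_integral_mono) simp
    also have "\<dots> = emeasure \<mu>n W" using W(1) by simp
    also have "\<dots> \<le> ennreal D"
      using W(2) prod_min_bound[OF detA t \<rho>0(2) rad_pos[of k]] unfolding D_def
      by (meson ennreal_leI order_trans)
    finally show ?thesis using True by simp
  next
    case False
    have "x(i := f) \<notin> ?X" for f
    proof
      assume "x(i := f) \<in> ?X"
      then have *: "vnorm av (vecs (x(i := f)) l) \<le> \<rho>0" if "l < M" for l using that unfolding Xeq by blast
      have "x l \<in> vbox 0 \<rho>0" if "l \<in> I" for l
        using *[of l] that unfolding I_def by (simp add: mem_vbox vecs_def)
      then have "x \<in> Pi\<^sub>E I (\<lambda>_. vbox 0 \<rho>0)"
        using x unfolding space_PiM by (intro PiE_I) (auto dest: PiE_arb)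
      then show False using False by simp
    qed
    then show ?thesis by simp
  qed
  have "emeasure \<mu>nM ?X = (\<integral>\<^sup>+ b. indicator ?X b \<partial>PiM (insert i I) (\<lambda>_. \<mu>n))"
    using X unfolding I(1) by simp
  also have "\<dots> = (\<integral>\<^sup>+ x. (\<integral>\<^sup>+ f. indicator ?X (x(i := f)) \<partial>\<mu>n) \<partial>PiM I (\<lambda>_. \<mu>n))"
    by (rule trans.product_nn_integral_insert[OF I(2,3)]) (use X in \<open>simp add: I(1)\<close>)
  also have "\<dots> \<le> (\<integral>\<^sup>+ x. ennreal D * indicator (Pi\<^sub>E I (\<lambda>_. vbox 0 \<rho>0)) x \<partial>PiM I (\<lambda>_. \<mu>n))"
    by (rule nn_integral_mono) (rule inner)
  also have "\<dots> = ennreal D * emeasure (PiM I (\<lambda>_. \<mu>n)) (Pi\<^sub>E I (\<lambda>_. vbox 0 \<rho>0))"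
    using I(2) by (intro nn_integral_cmult_indicator sets_PiM_I_finite) auto
  also have "\<dots> = ennreal (D * (\<rho>0 ^ ?n) ^ (M - 1))"
    using D0 \<rho>0 unfolding emeasure_big_box[OF \<rho>0(1) I(2)] I(4) by (subst ennreal_mult) auto
  also have "D * (\<rho>0 ^ ?n) ^ (M - 1) = (\<rho>0 ^ ?n * (\<rho>0 ^ ?n) ^ (M - 1)) * (rad k powr t / sv_fun av t ?A)"
    unfolding D_def by simp
  also have "\<rho>0 ^ ?n * (\<rho>0 ^ ?n) ^ (M - 1) = \<rho>0 ^ (?n * M)"
    using ij(1) by (simp add: power_mult power_Suc[symmetric] del: power_Suc)
  finally show ?thesis .
qed

lemma sv_word_le: assumes "w \<in> words M L" "0 \<le> t" shows "sv_fun av t (word_map T w) \<le> (lam ^ L) powr t"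
  using sv_fun_ratio(2)[OF det_words[OF assms(1)] order_refl assms(2), of "low ^ L" "lam ^ L"]
    sval_word_bounds[OF assms(1)] low_pos by (simp add: sv_fun_def)

text \<open>If the words differ, \<open>j\<close> is the length of their common prefix. If they
  coincide, \<open>j = L\<close>, and \<open>lam ^ L \<le> rad k\<close> makes the quotient at least
  1, so the measure of the whole box is a sufficient bound.\<close>

lemma emeasure_close_set:
  assumes \<rho>0: "\<rho>0 \<in> vgrp" "1 \<le> \<rho>0" and t: "0 \<le> t" "t \<le> real CARD('n)"
    and w: "w \<in> words M L" "w' \<in> words M L" and L: "lam ^ L \<le> rad k"
  shows "\<exists>j\<le>L. take j w = take j w' \<and> emeasure \<mu>nM (close_set \<rho>0 k w w') \<le>
    ennreal (\<rho>0 ^ (CARD('n) * M) * (rad k powr t / sv_fun av t (word_map T (take j w))))"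
proof (cases "w = w'")
  case True
  have "close_set \<rho>0 k w w' \<subseteq> Pi\<^sub>E {..<M} (\<lambda>_. vbox 0 \<rho>0)"
  proof
    fix b assume b: "b \<in> close_set \<rho>0 k w w'"
    show "b \<in> Pi\<^sub>E {..<M} (\<lambda>_. vbox 0 \<rho>0)"
    proof (rule PiE_I)
      show "b i \<in> vbox 0 \<rho>0" if "i \<in> {..<M}" for i
        using b that unfolding close_set_def by (simp add: mem_vbox vecs_def)
      show "b i = undefined" if "i \<notin> {..<M}" for i
        using b that unfolding close_set_def space_PiM by (auto dest: PiE_arb)
    qed
  qed
  then have "emeasure \<mu>nM (close_set \<rho>0 k w w') \<le> emeasure \<mu>nM (Pi\<^sub>E {..<M} (\<lambda>_. vbox 0 \<rho>0))"
    by (intro emeasure_mono sets_PiM_I_finite) auto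
  also have "\<dots> = ennreal (\<rho>0 ^ (CARD('n) * M) * 1)"
    by (simp add: emeasure_big_box[OF \<rho>0(1)] power_mult)
  also have "\<dots> \<le> ennreal (\<rho>0 ^ (CARD('n) * M) * (rad k powr t / sv_fun av t (word_map T w)))"
  proof (intro ennreal_leI mult_left_mono)
    have "sv_fun av t (word_map T w) \<le> rad k powr t"
      using order_trans[OF sv_word_le[OF w(1) t(1)] powr_mono2[OF t(1) _ L]] lam_pos by simp
    then show "1 \<le> rad k powr t / sv_fun av t (word_map T w)"
      using sv_word_pos[OF w(1) t(1)] by (simp add: le_divide_eq)
  qed (use \<rho>0 in auto)
  finally show ?thesis using True w by (intro exI[of _ L]) (auto simp: words_def)
next
  case False
  moreover have "length w = length w'" using w by (simp add: words_def)
  ultimately obtain p i u j v where split: "i \<noteq> j" "w = p @ [i] @ u" "w' = p @ [j] @ v"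
    using same_length_different[of w w'] by blast
  have "i < M" "j < M" "set p \<subseteq> {..<M}" "set u \<subseteq> {..<M}" "set v \<subseteq> {..<M}" "length p \<le> L"
    using w split by (auto simp: words_def)
  then show ?thesis
    using emeasure_close_set_distinct[OF \<rho>0 t, of i j p u v k] split by (intro exI[of _ "length p"]) auto
qed

section \<open>Expected energy and the almost sure lower bound\<close>

text \<open>For a fixed prefix length \<open>j\<close>, summing out \<open>w'\<close> produces
  \<open>\<nu> (take j w)\<close>, and \<open>\<nu> \<le> \<phi>\<close> cancels the denominator;
  the total mass 1 remains. There are \<open>L + 1\<close> prefix lengths.\<close>

lemma flow_pair_sum:
  fixes \<nu> \<phi> :: "nat list \<Rightarrow> real"
  assumes nu: "\<nu> [] = 1" "\<And>w. set w \<subseteq> {..<M} \<Longrightarrow> 0 \<le> \<nu> w" "\<And>w. set w \<subseteq> {..<M} \<Longrightarrow> \<nu> w \<le> \<phi> w"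
    and add: "\<And>w. set w \<subseteq> {..<M} \<Longrightarrow> (\<Sum>i<M. \<nu> (w @ [i])) = \<nu> w"
    and pos: "\<And>w. set w \<subseteq> {..<M} \<Longrightarrow> 0 < \<phi> w"
  shows "(\<Sum>w\<in>words M L. \<Sum>w'\<in>words M L. \<nu> w * \<nu> w' * (\<Sum>j\<le>L. of_bool (take j w = take j w') / \<phi> (take j w))) \<le> real (Suc L)"
proof -
  have level: "(\<Sum>w\<in>words M L. \<Sum>w'\<in>words M L. \<nu> w * \<nu> w' * (of_bool (take j w = take j w') / \<phi> (take j w))) \<le> 1"
    if j: "j \<le> L" for j
  proof -
    have inner: "(\<Sum>w'\<in>words M L. \<nu> w' * of_bool (take j w = take j w')) = \<nu> (take j w)" if w: "w \<in> words M L" for w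
    proof -
      have x: "take j w \<in> words M j" using w j by (auto simp: words_def dest: in_set_takeD)
      have "(\<Sum>w'\<in>words M L. \<nu> w' * of_bool (take j w = take j w')) = (\<Sum>u\<in>words M j. \<nu> u * of_bool (take j w = u))"
        by (rule sum_words_flow_take[OF add j])
      also have "\<dots> = (\<Sum>u\<in>words M j. if take j w = u then \<nu> u else 0)" by (intro sum.cong) auto
      also have "\<dots> = \<nu> (take j w)" using x by simp
      finally show ?thesis .
    qed
    have "(\<Sum>w\<in>words M L. \<Sum>w'\<in>words M L. \<nu> w * \<nu> w' * (of_bool (take j w = take j w') / \<phi> (take j w))) =
      (\<Sum>w\<in>words M L. \<nu> w / \<phi> (take j w) * (\<Sum>w'\<in>words M L. \<nu> w' * of_bool (take j w = take j w')))"
      unfolding sum_distrib_left by (intro sum.cong refl) (simp add: field_simps)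
    also have "\<dots> = (\<Sum>w\<in>words M L. \<nu> w * (\<nu> (take j w) / \<phi> (take j w)))"
      by (intro sum.cong refl) (simp only: inner, simp)
    also have "\<dots> = (\<Sum>u\<in>words M j. \<nu> u * (\<nu> u / \<phi> u))"
      by (rule sum_words_flow_take[OF add j])
    also have "\<dots> \<le> (\<Sum>u\<in>words M j. \<nu> u * 1)"
    proof (intro sum_mono mult_left_mono)
      fix u assume "u \<in> words M j"
      then have "set u \<subseteq> {..<M}" by (simp add: words_def)
      then show "\<nu> u / \<phi> u \<le> 1" "0 \<le> \<nu> u" using nu pos by (auto simp: divide_le_eq)
    qed
    also have "\<dots> = 1" using sum_words_flow[OF add, of "[]" j] nu(1) by simp
    finally show ?thesis .
  qed
  have "(\<Sum>w\<in>words M L. \<Sum>w'\<in>words M L. \<nu> w * \<nu> w' * (\<Sum>j\<le>L. of_bool (take j w = take j w') / \<phi> (take j w))) =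
    (\<Sum>j\<le>L. \<Sum>w\<in>words M L. \<Sum>w'\<in>words M L. \<nu> w * \<nu> w' * (of_bool (take j w = take j w') / \<phi> (take j w)))"
    unfolding sum_distrib_left by (subst sum.swap, subst (2) sum.swap, rule refl)
  also have "\<dots> \<le> (\<Sum>j\<le>L. 1)" using level by (intro sum_mono) auto
  finally show ?thesis by simp
qed

text \<open>Each factor \<open>lam ^ a < 1 / q\<close> pays for one step of the scale, and
  \<open>lam ^ c < 1 / \<rho>0\<close> for the size of the attractor. The linear growth of
  \<open>len\<close> is what the energy estimate can absorb.\<close>

lemma length_function:
  assumes "1 \<le> \<rho>0"
  obtains len A where "\<And>k. lam ^ len k * \<rho>0 \<le> rad k" "\<And>k. len k \<le> A * Suc k"
proof -
  obtain a where a: "lam ^ a < 1 / q" using real_arch_pow_inv[of "1 / q" lam] lam_less_1 by auto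
  obtain c where c: "lam ^ c < 1 / \<rho>0" using real_arch_pow_inv[of "1 / \<rho>0" lam] lam_less_1 assms by auto
  show ?thesis
  proof (rule that[of "\<lambda>k. a * k + c" "a + c"])
    fix k
    have "(lam ^ a) ^ k \<le> (1 / q) ^ k" using a lam_pos by (intro power_mono) auto
    moreover have "lam ^ c * \<rho>0 \<le> 1" using c assms by (simp add: less_divide_eq less_imp_le)
    ultimately have "(lam ^ a) ^ k * (lam ^ c * \<rho>0) \<le> (1 / q) ^ k * 1"
      using lam_pos assms by (intro mult_mono) auto
    then show "lam ^ (a * k + c) * \<rho>0 \<le> rad k" unfolding rad_def by (simp add: power_add power_mult mult.assoc)
    show "a * k + c \<le> (a + c) * Suc k" by (simp add: algebra_simps)
  qed
qed

text \<open>The terms of the expected energy are at most a constant times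
  \<open>(k + 1) * x ^ k\<close>: the linear factor counts prefix lengths, and
  \<open>x = q powr (t - t')\<close> compares the probability \<open>rad k powr t'\<close> with the
  weight \<open>rad k powr (- t)\<close>. Hence almost every parameter in the ball has finite
  energy.\<close>

lemma AE_hausdorff_dim_ge:
  assumes \<rho>0: "\<rho>0 \<in> vgrp" "1 \<le> \<rho>0" and t: "0 < t" "t < t'" "t' \<le> real CARD('n)" "t' < d"
  shows "AE b in \<mu>nM. (\<forall>i<M. vnorm av (vecs b i) \<le> \<rho>0) \<longrightarrow> t \<le> hausdorff_dim (vdist av) (K (vecs b))"
proof -
  let ?\<phi> = "\<lambda>w. sv_fun av t' (word_map T w)"
  have t'0: "0 \<le> t'" using t by simp
  have \<phi>_pos: "0 < ?\<phi> w" if "set w \<subseteq> {..<M}" for w using sv_fun_pos[OF det_word_map[OF that] t'0] .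
  obtain \<nu> :: "nat list \<Rightarrow> real" where \<nu>: "\<nu> [] = 1" "\<And>w. set w \<subseteq> {..<M} \<Longrightarrow> 0 \<le> \<nu> w"
    "\<And>w. set w \<subseteq> {..<M} \<Longrightarrow> \<nu> w \<le> ?\<phi> w" "\<And>w. set w \<subseteq> {..<M} \<Longrightarrow> (\<Sum>i<M. \<nu> (w @ [i])) = \<nu> w"
  proof (rule flow_exists[of M ?\<phi>])
    show "0 \<le> ?\<phi> w" if "set w \<subseteq> {..<M}" for w using \<phi>_pos[OF that] by simp
    show "?\<phi> (u @ v) \<le> ?\<phi> u * ?\<phi> v" if "set u \<subseteq> {..<M}" "set v \<subseteq> {..<M}" for u v
      unfolding word_map_append using that by (intro sv_fun_mult_le det_word_map t'0)
    show "\<exists>r. B < (\<Sum>w\<in>words M r. ?\<phi> w)" for B using sv_sum_unbounded[OF t'0 t(4)] unfolding sv_sum_def .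
  qed (rule that)
  have \<nu>w: "0 \<le> \<nu> w" if "w \<in> words M L" for w L using \<nu>(2) that by (auto simp: words_def)
  have \<phi>_take: "0 < ?\<phi> (take j w)" if "w \<in> words M L" for j w L
  proof (rule \<phi>_pos)
    show "set (take j w) \<subseteq> {..<M}" using set_take_subset[of j w] that unfolding words_def by blast
  qed
  obtain len A where len: "\<And>k. lam ^ len k * \<rho>0 \<le> rad k" "\<And>k. len k \<le> A * Suc k"
    by (rule length_function[OF \<rho>0(2)]) (rule that)
  have lam_rad: "lam ^ len k \<le> rad k" for k
  proof -
    have "lam ^ len k * 1 \<le> lam ^ len k * \<rho>0" using \<rho>0(2) lam_pos by (intro mult_left_mono) auto
    then show ?thesis using len(1)[of k] by simp
  qed
  define B where "B = \<rho>0 ^ (CARD('n) * M)"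
  have B0: "0 \<le> B" unfolding B_def using \<rho>0 by simp
  let ?W = "\<lambda>k. words M (len k)"
  let ?X = "\<lambda>k w w'. close_set \<rho>0 k w w'"
  have X: "?X k w w' \<in> sets \<mu>nM" if "w \<in> ?W k" "w' \<in> ?W k" for k w w'
    using that \<rho>0 by (intro close_set_measurable) (auto simp: words_def)
  \<comment> \<open>The energy term of scale \<open>k\<close>, cut off to translations of norm at
    most \<open>\<rho>0\<close>, in \<open>ennreal\<close> so that series and integral can be
    exchanged freely.\<close>
  define h where "h k b = ennreal (rad k powr (- t)) * (\<Sum>w\<in>?W k. \<Sum>w'\<in>?W k. ennreal (\<nu> w * \<nu> w') * indicator (?X k w w') b)" for k b
  have h_meas: "h k \<in> borel_measurable \<mu>nM" for k
    unfolding h_def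
    by (intro borel_measurable_times_ennreal borel_measurable_sum borel_measurable_const borel_measurable_indicator X)
  define x where "x = (1 / q) powr (t' - t)"
  have x: "0 < x" "x < 1" 
  proof -
    have "0 < 1 / q" "1 / q < 1" using q_ge_2 by (auto simp: divide_less_eq)
    then show "0 < x" "x < 1" unfolding x_def using t(2) by (simp_all add: powr01_less_one)
  qed
  have h_le: "(\<integral>\<^sup>+ b. h k b \<partial>\<mu>nM) \<le> ennreal (B * real (Suc A) * (real (Suc k) * x ^ k))" for k
  proof -
    let ?m = "\<lambda>w w'. \<Sum>j\<le>len k. of_bool (take j w = take j w') / ?\<phi> (take j w)"
    have m_nonneg: "0 \<le> ?m w w'" if w: "w \<in> ?W k" for w w'
    proof (intro sum_nonneg divide_nonneg_nonneg)
      fix j show "0 \<le> ?\<phi> (take j w)" using \<phi>_take[OF w] by (rule less_imp_le)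
    qed simp
    have em: "emeasure \<mu>nM (?X k w w') \<le> ennreal (B * rad k powr t' * ?m w w')" if w: "w \<in> ?W k" "w' \<in> ?W k" for w w'
    proof -
      obtain j where j: "j \<le> len k" "take j w = take j w'"
        "emeasure \<mu>nM (?X k w w') \<le> ennreal (B * (rad k powr t' / ?\<phi> (take j w)))"
        using emeasure_close_set[OF \<rho>0 t'0 t(3) w lam_rad] unfolding B_def by blast
      \<comment> \<open>The prefix length \<open>j\<close> depends on the pair; the sum
        \<open>?m\<close> over all common prefixes dominates its term and can be summed against
        \<open>\<nu>\<close>.\<close>
      have "1 / ?\<phi> (take j w) = of_bool (take j w = take j w') / ?\<phi> (take j w)" using j by simp
      also have "\<dots> \<le> ?m w w'"
      proof (rule member_le_sum[of j "{..len k}" "\<lambda>j. of_bool (take j w = take j w') / ?\<phi> (take j w)"])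
        fix i show "0 \<le> of_bool (take i w = take i w') / ?\<phi> (take i w)"
          by (intro divide_nonneg_nonneg less_imp_le[OF \<phi>_take[OF w(1)]]) simp
      qed (use j in auto)
      finally have "B * rad k powr t' * (1 / ?\<phi> (take j w)) \<le> B * rad k powr t' * ?m w w'"
        using B0 by (intro mult_left_mono) auto
      then show ?thesis using j(3) by (simp add: order_trans[OF _ ennreal_leI])
    qed
    have "(\<integral>\<^sup>+ b. h k b \<partial>\<mu>nM) = ennreal (rad k powr (- t)) * (\<Sum>w\<in>?W k. \<Sum>w'\<in>?W k. ennreal (\<nu> w * \<nu> w') * emeasure \<mu>nM (?X k w w'))"
    proof -
      have "(\<integral>\<^sup>+ b. h k b \<partial>\<mu>nM) = ennreal (rad k powr (- t)) *
          (\<integral>\<^sup>+ b. (\<Sum>w\<in>?W k. \<Sum>w'\<in>?W k. ennreal (\<nu> w * \<nu> w') * indicator (?X k w w') b) \<partial>\<mu>nM)"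
        unfolding h_def
        by (intro nn_integral_cmult borel_measurable_times_ennreal borel_measurable_sum borel_measurable_const borel_measurable_indicator X)
      also have "(\<integral>\<^sup>+ b. (\<Sum>w\<in>?W k. \<Sum>w'\<in>?W k. ennreal (\<nu> w * \<nu> w') * indicator (?X k w w') b) \<partial>\<mu>nM) =
        (\<Sum>w\<in>?W k. \<integral>\<^sup>+ b. (\<Sum>w'\<in>?W k. ennreal (\<nu> w * \<nu> w') * indicator (?X k w w') b) \<partial>\<mu>nM)"
        by (intro nn_integral_sum borel_measurable_times_ennreal borel_measurable_sum borel_measurable_const borel_measurable_indicator X)
      also have "\<dots> = (\<Sum>w\<in>?W k. \<Sum>w'\<in>?W k. \<integral>\<^sup>+ b. ennreal (\<nu> w * \<nu> w') * indicator (?X k w w') b \<partial>\<mu>nM)"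
        by (intro sum.cong refl nn_integral_sum borel_measurable_times_ennreal borel_measurable_const borel_measurable_indicator X)
      also have "\<dots> = (\<Sum>w\<in>?W k. \<Sum>w'\<in>?W k. ennreal (\<nu> w * \<nu> w') * emeasure \<mu>nM (?X k w w'))"
        by (intro sum.cong refl nn_integral_cmult_indicator X)
      finally show ?thesis .
    qed
    also have "\<dots> \<le> ennreal (rad k powr (- t)) * (\<Sum>w\<in>?W k. \<Sum>w'\<in>?W k. ennreal (\<nu> w * \<nu> w') * ennreal (B * rad k powr t' * ?m w w'))"
      by (intro mult_left_mono sum_mono em) auto
    also have "\<dots> = ennreal (rad k powr (- t) * (\<Sum>w\<in>?W k. \<Sum>w'\<in>?W k. \<nu> w * \<nu> w' * (B * rad k powr t' * ?m w w')))"
    proof -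
      have nn: "0 \<le> \<nu> w * \<nu> w'" "0 \<le> B * rad k powr t' * ?m w w'" if "w \<in> ?W k" "w' \<in> ?W k" for w w'
        using \<nu>w that B0 m_nonneg by auto
      have "(\<Sum>w\<in>?W k. \<Sum>w'\<in>?W k. ennreal (\<nu> w * \<nu> w') * ennreal (B * rad k powr t' * ?m w w')) =
        (\<Sum>w\<in>?W k. \<Sum>w'\<in>?W k. ennreal (\<nu> w * \<nu> w' * (B * rad k powr t' * ?m w w')))"
        by (intro sum.cong refl) (simp only: ennreal_mult[OF nn])
      also have "\<dots> = ennreal (\<Sum>w\<in>?W k. \<Sum>w'\<in>?W k. \<nu> w * \<nu> w' * (B * rad k powr t' * ?m w w'))"
        using nn by (simp only: sum_ennreal sum_nonneg mult_nonneg_nonneg cong: sum.cong)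
      finally show ?thesis by (simp only: ennreal_mult'[of "rad k powr (- t)"] powr_ge_zero)
    qed
    also have "(\<Sum>w\<in>?W k. \<Sum>w'\<in>?W k. \<nu> w * \<nu> w' * (B * rad k powr t' * ?m w w')) =
        B * rad k powr t' * (\<Sum>w\<in>?W k. \<Sum>w'\<in>?W k. \<nu> w * \<nu> w' * ?m w w')"
      by (simp only: sum_distrib_left mult.assoc mult.left_commute)
    also have "ennreal (rad k powr (- t) * (B * rad k powr t' * (\<Sum>w\<in>?W k. \<Sum>w'\<in>?W k. \<nu> w * \<nu> w' * ?m w w')))
        \<le> ennreal (rad k powr (- t) * (B * rad k powr t' * real (Suc (len k))))"
      by (intro ennreal_leI mult_left_mono mult_nonneg_nonneg powr_ge_zero B0
          flow_pair_sum[OF \<nu>(1) \<nu>(2) \<nu>(3) \<nu>(4) \<phi>_pos])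
    also have "rad k powr (- t) * (B * rad k powr t' * real (Suc (len k))) = B * real (Suc (len k)) * (rad k powr (t' - t))"
      by (simp add: powr_diff powr_minus_divide)
    also have "rad k powr (t' - t) = x ^ k"
      unfolding rad_def x_def by (simp add: powr_power powr_realpow[symmetric] powr_powr mult.commute)
    also have "ennreal (B * real (Suc (len k)) * x ^ k) \<le> ennreal (B * real (Suc A) * (real (Suc k) * x ^ k))"
    proof (rule ennreal_leI)
      have "Suc (len k) \<le> Suc A * Suc k" using len(2)[of k] by simp
      then have "real (Suc (len k)) \<le> real (Suc A) * real (Suc k)" by (metis of_nat_le_iff of_nat_mult)
      then have "B * real (Suc (len k)) * x ^ k \<le> B * (real (Suc A) * real (Suc k)) * x ^ k"
        using B0 x by (intro mult_right_mono mult_left_mono) auto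
      then show "B * real (Suc (len k)) * x ^ k \<le> B * real (Suc A) * (real (Suc k) * x ^ k)" by (simp only: mult.assoc)
    qed
    finally show ?thesis .
  qed
  have "(\<integral>\<^sup>+ b. (\<Sum>k. h k b) \<partial>\<mu>nM) = (\<Sum>k. \<integral>\<^sup>+ b. h k b \<partial>\<mu>nM)"
    by (rule nn_integral_suminf[OF h_meas])
  also have "\<dots> \<le> (\<Sum>k. ennreal (B * real (Suc A) * (real (Suc k) * x ^ k)))"
    by (intro suminf_le h_le) auto
  also have "\<dots> < \<infinity>"
  proof -
    have "summable (\<lambda>k. real (Suc k) * x ^ k)"
      using geometric_deriv_sums[of x] x sums_summable by force
    then have "summable (\<lambda>k. B * real (Suc A) * (real (Suc k) * x ^ k))" by (rule summable_mult)
    then show ?thesis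
      using B0 x by (subst suminf_ennreal2) auto
  qed
  finally have fin: "(\<integral>\<^sup>+ b. (\<Sum>k. h k b) \<partial>\<mu>nM) \<noteq> \<infinity>" by simp
  have "AE b in \<mu>nM. (\<Sum>k. h k b) \<noteq> \<infinity>"
    by (intro nn_integral_PInf_AE borel_measurable_suminf_order h_meas fin)
  then show ?thesis
  proof (rule AE_mp, intro AE_I2 impI)
    fix b assume b: "b \<in> space \<mu>nM" "(\<Sum>k. h k b) \<noteq> \<infinity>" "\<forall>i<M. vnorm av (vecs b i) \<le> \<rho>0"
    define E where "E = enn2real (\<Sum>k. h k b)"
    have E: "(\<Sum>k. h k b) = ennreal E" "0 \<le> E" unfolding E_def using b(2) by (auto simp: less_top)
    have pm_nonneg: "0 \<le> pair_mass \<nu> (vecs b) (len k) k" for k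
      unfolding pair_mass_def using \<nu>w by (intro sum_nonneg mult_nonneg_nonneg) auto
    have h_eq: "h k b = ennreal (rad k powr (- t) * pair_mass \<nu> (vecs b) (len k) k)" for k
    proof -
      have ind: "indicator (?X k w w') b = (ennreal (of_bool (vnorm av (S (vecs b) w 0 - S (vecs b) w' 0) \<le> rad k)))" for w w'
        using b unfolding close_set_def by simp
      have nn: "0 \<le> \<nu> w * \<nu> w'" if "w \<in> ?W k" "w' \<in> ?W k" for w w'
        using \<nu>w that by simp
      have "(\<Sum>w\<in>?W k. \<Sum>w'\<in>?W k. ennreal (\<nu> w * \<nu> w') * indicator (?X k w w') b) =
        (\<Sum>w\<in>?W k. \<Sum>w'\<in>?W k. ennreal (\<nu> w * \<nu> w' * of_bool (vnorm av (S (vecs b) w 0 - S (vecs b) w' 0) \<le> rad k)))"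
        unfolding ind by (intro sum.cong refl ennreal_mult[symmetric] nn) auto
      also have "\<dots> = ennreal (pair_mass \<nu> (vecs b) (len k) k)"
        unfolding pair_mass_def using nn
        by (simp only: sum_ennreal sum_nonneg mult_nonneg_nonneg zero_less_eq_of_bool cong: sum.cong)
      finally show ?thesis unfolding h_def using pm_nonneg by (simp add: ennreal_mult)
    qed
    \<comment> \<open>\<open>E\<close> may vanish, while \<open>hausdorff_pre_lower_bound\<close>
      asks for a positive constant, hence \<open>E + 1\<close>.\<close>
    have energy: "(\<Sum>k\<in>J. rad k powr (- t) * pair_mass \<nu> (vecs b) (len k) k) \<le> E + 1" if J: "finite J" for J
    proof -
      have "ennreal (\<Sum>k\<in>J. rad k powr (- t) * pair_mass \<nu> (vecs b) (len k) k) = (\<Sum>k\<in>J. h k b)"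
        unfolding h_eq using pm_nonneg by (intro sum_ennreal[symmetric]) auto
      also have "\<dots> \<le> ennreal E" unfolding E(1)[symmetric] using J by (intro sum_le_suminf) auto
      finally show ?thesis using E(2) by (simp add: ennreal_le_iff)
    qed
    show "t \<le> hausdorff_dim (vdist av) (K (vecs b))"
    proof (rule hausdorff_dim_lower_bound)
      fix s assume s: "0 < s" "s \<le> t"
      have "0 < ennreal (1 / (2 * (E + 1)))" using E(2) by simp
      also have "\<dots> \<le> hausdorff_pre (vdist av) s 1 (K (vecs b))"
        by (rule hausdorff_pre_lower_bound[where \<nu> = \<nu> and \<rho> = \<rho>0 and len = len and t = t])
           (use \<nu> b(3) len(1) energy E(2) s in auto)
      finally show "0 < hausdorff_pre (vdist av) s 1 (K (vecs b))" .
    qed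
  qed
qed

text \<open>Countably many exponents below the target and radii \<open>q ^ l\<close> exhaust all
  cases, so the exceptional null sets can be united.\<close>

lemma AE_hausdorff_dim: "AE b in \<mu>nM. min (real CARD('n)) d \<le> hausdorff_dim (vdist av) (K (vecs b))"
proof -
  let ?D = "min (real CARD('n)) d"
  have D: "0 < ?D" using affinity_dim_root by simp
  \<comment> \<open>Both sequences increase to \<open>?D\<close> from below with
    \<open>?t j < ?t' j\<close>; the shift by 3 makes already the first \<open>?t j\<close>
    positive.\<close>
  let ?t = "\<lambda>j::nat. ?D * (1 - 2 / real (j + 3))" and ?t' = "\<lambda>j::nat. ?D * (1 - 1 / real (j + 3))"
  have "AE b in \<mu>nM. \<forall>j l :: nat. (\<forall>i<M. vnorm av (vecs b i) \<le> q ^ l) \<longrightarrow> ?t j \<le> hausdorff_dim (vdist av) (K (vecs b))"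
  proof (subst AE_all_countable, intro allI, subst AE_all_countable, intro allI)
    fix j l :: nat
    show "AE b in \<mu>nM. (\<forall>i<M. vnorm av (vecs b i) \<le> q ^ l) \<longrightarrow> ?t j \<le> hausdorff_dim (vdist av) (K (vecs b))"
    proof (rule AE_hausdorff_dim_ge[where t' = "?t' j"])
      show "q ^ l \<in> vgrp" using vgrpI[of "int l"] by simp
      show "1 \<le> q ^ l" using q_ge_2 by (intro one_le_power) auto
      show "0 < ?t j" using D by (intro mult_pos_pos) (auto simp: field_simps)
      show "?t j < ?t' j" using D by (intro mult_strict_left_mono) (auto simp: field_simps)
      have "?t' j < ?D * 1" using D by (intro mult_strict_left_mono) (auto simp: field_simps)
      then show "?t' j \<le> real CARD('n)" "?t' j < d" by auto
    qed
  qed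
  then show ?thesis
  proof (rule AE_mp, intro AE_I2 impI)
    fix b assume b: "\<forall>j l :: nat. (\<forall>i<M. vnorm av (vecs b i) \<le> q ^ l) \<longrightarrow> ?t j \<le> hausdorff_dim (vdist av) (K (vecs b))"
    obtain l where l: "Max ((\<lambda>i. vnorm av (vecs b i)) ` {..<M}) < q ^ l" using real_arch_pow[OF q_gt_1] by blast
    have "vnorm av (vecs b i) \<le> q ^ l" if "i < M" for i
    proof -
      have "vnorm av (vecs b i) \<le> Max ((\<lambda>i. vnorm av (vecs b i)) ` {..<M})" using that by (intro Max_ge) auto
      then show ?thesis using l by simp
    qed
    then have le: "?t j \<le> hausdorff_dim (vdist av) (K (vecs b))" for j using b by blast
    have "?t \<longlonglongrightarrow> ?D * (1 - 0)"
      by (intro tendsto_mult tendsto_diff tendsto_const LIMSEQ_ignore_initial_segment[OF lim_const_over_n])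
    then show "?D \<le> hausdorff_dim (vdist av) (K (vecs b))"
      using LIMSEQ_le_const2[of ?t ?D] le by auto
  qed
qed

end

theorem theorem1p1:
  fixes av :: "'a::{field,metric_space} \<Rightarrow> real"
    and \<mu> :: "'a measure"
    and T :: "nat \<Rightarrow> 'a^'n^'n"
    and M :: nat
  assumes field: "nonarch_lc_field av"
    and norm: "normalised_av av"
    and haar: "haar_measure av \<mu>"
    and M: "M \<ge> 2"
    and nonsing: "\<forall>i<M. det (T i) \<noteq> 0"
    and contr: "\<forall>i<M. opnorm av (T i) < 1"
  shows "(\<forall>b :: nat \<Rightarrow> 'a^'n.
            ereal (hausdorff_dim (vdist av) (self_affine_set T M b))
              \<le> upper_box_dim (vdist av) (self_affine_set T M b) \<and>
            upper_box_dim (vdist av) (self_affine_set T M b) \<le> ereal (affinity_dim av T M))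
       \<and> (AE b in PiM {..<M} (\<lambda>_. PiM (UNIV :: 'n set) (\<lambda>_. \<mu>)).
            ereal (hausdorff_dim (vdist av) (self_affine_set T M (\<lambda>i. vec_lambda (b i))))
              = lower_box_dim (vdist av) (self_affine_set T M (\<lambda>i. vec_lambda (b i))) \<and>
            lower_box_dim (vdist av) (self_affine_set T M (\<lambda>i. vec_lambda (b i)))
              = upper_box_dim (vdist av) (self_affine_set T M (\<lambda>i. vec_lambda (b i))) \<and>
            upper_box_dim (vdist av) (self_affine_set T M (\<lambda>i. vec_lambda (b i)))
              = ereal (min (real CARD('n)) (affinity_dim av T M)))"
proof -
  interpret affine_haar av T M \<mu>
    by unfold_locales (simp_all only: field norm haar M nonsing contr not_False_eq_True)
  have low: "ereal (hausdorff_dim (vdist av) (K b)) \<le> lower_box_dim (vdist av) (K b)" for b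
    using hausdorff_dim_le_lower_box_dim[OF vbounded_K attractor(1)] .
  have up: "upper_box_dim (vdist av) (K b) \<le> ereal d" for b
    using order_trans[OF upper_box_dim_K_le[of b], of "ereal d"] by simp
  have "AE b in \<mu>nM. ereal (hausdorff_dim (vdist av) (K (vecs b))) = lower_box_dim (vdist av) (K (vecs b)) \<and>
      lower_box_dim (vdist av) (K (vecs b)) = upper_box_dim (vdist av) (K (vecs b)) \<and>
      upper_box_dim (vdist av) (K (vecs b)) = ereal (min (real CARD('n)) d)"
    using AE_hausdorff_dim
  proof (rule AE_mp, intro AE_I2 impI)
    fix b assume "min (real CARD('n)) d \<le> hausdorff_dim (vdist av) (K (vecs b))"
    then have "ereal (min (real CARD('n)) d) \<le> ereal (hausdorff_dim (vdist av) (K (vecs b)))"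
      by (simp only: ereal_less_eq)
    \<comment> \<open>The chain of inequalities ends at the value at which it starts, so all of them
      are equalities.\<close>
    note chain = this low[of "vecs b"] lower_le_upper_box_dim[of "vdist av" "K (vecs b)"] upper_box_dim_K_le[of "vecs b"]
    show "ereal (hausdorff_dim (vdist av) (K (vecs b))) = lower_box_dim (vdist av) (K (vecs b)) \<and>
      lower_box_dim (vdist av) (K (vecs b)) = upper_box_dim (vdist av) (K (vecs b)) \<and>
      upper_box_dim (vdist av) (K (vecs b)) = ereal (min (real CARD('n)) d)"
      by (intro conjI; use chain in order)
  qed
  note ae = this[unfolded vecs_def]
  show ?thesis
    by (intro conjI allI) (rule order_trans[OF low lower_le_upper_box_dim], rule up, rule ae)
qed

end
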